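(* Let $k$ be one of the fields below (of characteristic not $2$), $A=J(\mathrm{Mat}_3(k),1)$ the split Albert algebra over $k$, and for $t=t(u_1,u_2,v_1,v_2)$ with $u_1,u_2,v_1,v_2\in k^*$ let the fixed subalgebra of $gt$ in $A$ be isomorphic to $H_3(D,\gamma)$, with $D$ a quaternion subalgebra over $k$ of the split octonion algebra and $\gamma\in(k^* )^3$. Representatives of the isomorphism classes of $k$-involutions of $\mathrm{Aut}(A)$ of the form $\mathcal I_{gt}$ can be taken as follows: \begin{enumerate} \item[(1)] If $k=K$ is algebraically closed or $k=\mathbb F_p$ with $p>2$, then $t=t(1,1,1,1)$ gives a representative of the only isomorphism class. \item[(2)] If $k=\mathbb R$: for $D$ split we can choose $t(1,1,-1,1)$; for $D$ a division algebra, in the positive definite case we can choose $t(1,1,1,1)$, and for the indefinite quadratic form we can choose $t(-1,1,1,1)$. (The quadratic form meant is $Q(a)=\frac12\mathrm{Tr}(a^2)$ restricted to the fixed subalgebra of $gt$.) \item[(3)] If $k=\mathbb Q_2$, we can choose $t(1,1,-1,1)$ for $D$ split and $t(1,1,1,1)$ for $D$ a division algebra. \item[(4)] If $k=\mathbb Q_p$ with $p>2$, we can choose $t(1,1,-1,1)$ for $D$ split and $t(1,1,-p,-Z_p)$ for $D$ a division algebra, where $Z_p$ is the smallest (positive integer) non-square in $\mathbb F_p$. \end{enumerate}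
   Context: First Tits construction $A=J(\mathrm{Mat}_3(k),1)$: the underlying $k$-vector space is $\mathrm{Mat}_3(k)\oplus\mathrm{Mat}_3(k)\oplus\mathrm{Mat}_3(k)$, with elements $a=(a_0,a_1,a_2)$. Put $1=(\mathrm{id},0,0)$, $\mathrm{Tr}(a)=\mathrm{tr}(a_0)$, and $a^{\#}=(a_0^{\#}-a_1a_2,\ a_2^{\#}-a_0a_1,\ a_1^{\#}-a_2a_0)$, where for a $3\times3$ matrix $m$, $m^{\#}$ is its adjugate. Set $a\#b=(a+b)^{\#}-a^{\#}-b^{\#}$ and $\mathrm{Sr}(a,b)=\mathrm{Tr}(a\#b)$. The product is $ab=\tfrac12(a\#b+\mathrm{Tr}(a)b+\mathrm{Tr}(b)a-\mathrm{Sr}(a,b)1)$. $\mathrm{Aut}(A)$ is the (linear) automorphism group of $A$. The element $t(u_1,u_2,v_1,v_2)\in\mathrm{Aut}(A)$ is the map $(a_0,a_1,a_2)\mapsto(ua_0u^{-1},ua_1v^{-1},va_2u^{-1})$ with $u=\mathrm{diag}(u_1,u_1^{-1}u_2,u_2^{-1})$ and $v=\mathrm{diag}(v_1,v_1^{-1}v_2,v_2^{-1})$. The element $g\in\mathrm{Aut}(A)$ is $g(a_0,a_1,a_2)=(a_0^T,a_2^T,a_1^T)$, where $T$ is the transpose. Each $gt$ has order $2$. For $s\in\mathrm{Aut}(A)$, $\mathcal I_s(x)=sxs^{-1}$. For $D$ a quaternion algebra over $k$ with conjugation $\bar{\ }$ and $\gamma=(\gamma_1,\gamma_2,\gamma_3)\in(k^*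 )^3$ viewed as a diagonal matrix, $H_3(D,\gamma)$ is the set of $3\times3$ matrices $x$ over $D$ with diagonal entries in $k$ and $\gamma^{-1}\bar x^T\gamma=x$, with product $\frac12(x\cdot y+y\cdot x)$ (dot: matrix multiplication). $D$ is split if it contains zero divisors. Two $k$-involutions $\varphi,\varphi'$ of $\mathrm{Aut}(A)$ are isomorphic if $\varphi'=\mathcal I_h\circ\varphi\circ\mathcal I_h^{-1}$ for some $h$ in the group of $k$-linear automorphisms of $A$. *)

theory Defs
  imports
    "HOL-Analysis.Analysis"
    "HOL-Algebra.Bij"
    "HOL-Computational_Algebra.Fraction_Field"
    "Berlekamp_Zassenhaus.Finite_Field"
begin

section \<open>The field of p-adic numbers\<close>

text \<open>The ring of p-adic integers is the inverse limit of the rings \<open>\<int>/p^n\<close>; an element is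
  represented by its least non-negative residues. The prime is the cardinality of the index type,
  as for \<^typ>\<open>'p mod_ring\<close>.\<close>

typedef ('p::prime_card) padic_int =
  "{f :: nat \<Rightarrow> int. \<forall>n. f n \<in> {0..<int CARD('p) ^ n} \<and> f (Suc n) mod int CARD('p) ^ n = f n}"
  by (rule exI[of _ "\<lambda>_. 0"]) (use prime_card[where 'a='p] in \<open>auto simp: prime_gt_0_nat\<close>)

setup_lifting type_definition_padic_int

lemma prime_card_gt_1: "int CARD('p::prime_card) > 1"
  using prime_gt_1_nat[OF prime_card[where 'a='p]] by simp

lemma mod_power_Suc_mod_power: "a mod (p::int) ^ Suc n mod p ^ n = a mod p ^ n"
  by (simp add: mod_mod_cancel)

instantiation padic_int :: (prime_card) comm_ring_1
begin

lift_definition zero_padic_int :: "'a padic_int" is "\<lambda>_. 0"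
  using prime_card_gt_1[where 'p='a] by auto

lift_definition one_padic_int :: "'a padic_int" is "\<lambda>n. 1 mod int CARD('a) ^ n"
  using prime_card_gt_1[where 'p='a] by (auto simp: mod_power_Suc_mod_power simp del: power_Suc)

lift_definition plus_padic_int :: "'a padic_int \<Rightarrow> 'a padic_int \<Rightarrow> 'a padic_int"
  is "\<lambda>f g n. (f n + g n) mod int CARD('a) ^ n"
proof -
  fix f g :: "nat \<Rightarrow> int" and n
  assume "\<And>n. f n \<in> {0..<int CARD('a) ^ n} \<and> f (Suc n) mod int CARD('a) ^ n = f n"
    and "\<And>n. g n \<in> {0..<int CARD('a) ^ n} \<and> g (Suc n) mod int CARD('a) ^ n = g n"
  then show "(f n + g n) mod int CARD('a) ^ n \<in> {0..<int CARD('a) ^ n} \<and>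
      (f (Suc n) + g (Suc n)) mod int CARD('a) ^ Suc n mod int CARD('a) ^ n
        = (f n + g n) mod int CARD('a) ^ n"
    using prime_card_gt_1[where 'p='a]
    by (auto simp: mod_power_Suc_mod_power simp del: power_Suc) (metis mod_add_eq)
qed

lift_definition uminus_padic_int :: "'a padic_int \<Rightarrow> 'a padic_int"
  is "\<lambda>f n. (- f n) mod int CARD('a) ^ n"
proof -
  fix f :: "nat \<Rightarrow> int" and n
  assume "\<And>n. f n \<in> {0..<int CARD('a) ^ n} \<and> f (Suc n) mod int CARD('a) ^ n = f n"
  then show "(- f n) mod int CARD('a) ^ n \<in> {0..<int CARD('a) ^ n} \<and>
      (- f (Suc n)) mod int CARD('a) ^ Suc n mod int CARD('a) ^ n = (- f n) mod int CARD('a) ^ n"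
    using prime_card_gt_1[where 'p='a]
    by (auto simp: mod_power_Suc_mod_power simp del: power_Suc) (metis mod_minus_eq)
qed

lift_definition minus_padic_int :: "'a padic_int \<Rightarrow> 'a padic_int \<Rightarrow> 'a padic_int"
  is "\<lambda>f g n. (f n - g n) mod int CARD('a) ^ n"
proof -
  fix f g :: "nat \<Rightarrow> int" and n
  assume "\<And>n. f n \<in> {0..<int CARD('a) ^ n} \<and> f (Suc n) mod int CARD('a) ^ n = f n"
    and "\<And>n. g n \<in> {0..<int CARD('a) ^ n} \<and> g (Suc n) mod int CARD('a) ^ n = g n"
  then show "(f n - g n) mod int CARD('a) ^ n \<in> {0..<int CARD('a) ^ n} \<and>
      (f (Suc n) - g (Suc n)) mod int CARD('a) ^ Suc n mod int CARD('a) ^ n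
        = (f n - g n) mod int CARD('a) ^ n"
    using prime_card_gt_1[where 'p='a]
    by (auto simp: mod_power_Suc_mod_power simp del: power_Suc) (metis mod_diff_eq)
qed

lift_definition times_padic_int :: "'a padic_int \<Rightarrow> 'a padic_int \<Rightarrow> 'a padic_int"
  is "\<lambda>f g n. (f n * g n) mod int CARD('a) ^ n"
proof -
  fix f g :: "nat \<Rightarrow> int" and n
  assume "\<And>n. f n \<in> {0..<int CARD('a) ^ n} \<and> f (Suc n) mod int CARD('a) ^ n = f n"
    and "\<And>n. g n \<in> {0..<int CARD('a) ^ n} \<and> g (Suc n) mod int CARD('a) ^ n = g n"
  then show "(f n * g n) mod int CARD('a) ^ n \<in> {0..<int CARD('a) ^ n} \<and>
      (f (Suc n) * g (Suc n)) mod int CARD('a) ^ Suc n mod int CARD('a) ^ n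
        = (f n * g n) mod int CARD('a) ^ n"
    using prime_card_gt_1[where 'p='a]
    by (auto simp: mod_power_Suc_mod_power simp del: power_Suc) (metis mod_mult_eq)
qed

instance
proof
  fix a b c :: "'a padic_int"
  show "a * b * c = a * (b * c)"
    by transfer (auto simp: fun_eq_iff mod_mult_left_eq mod_mult_right_eq mult.assoc)
  show "a * b = b * a"
    by transfer (simp add: mult.commute)
  show "1 * a = a"
    by transfer (auto simp: fun_eq_iff mod_mult_left_eq)
  show "a + b + c = a + (b + c)"
    by transfer (auto simp: fun_eq_iff mod_add_left_eq mod_add_right_eq add.assoc)
  show "a + b = b + a"
    by transfer (simp add: add.commute)
  show "0 + a = a"
    by transfer (auto simp: fun_eq_iff)
  show "- a + a = 0"
    by transfer (auto simp: fun_eq_iff mod_add_left_eq)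
  show "a - b = a + - b"
    by transfer (auto simp: fun_eq_iff mod_add_right_eq)
  show "(a + b) * c = a * c + b * c"
    by transfer (auto simp: fun_eq_iff mod_mult_left_eq mod_add_eq distrib_right)
  show "(0::'a padic_int) \<noteq> 1"
  proof
    assume "(0::'a padic_int) = 1"
    then have "\<forall>n. (0::int) = 1 mod int CARD('a) ^ n"
      by transfer (simp add: fun_eq_iff)
    from spec[OF this, of 1] show False
      using prime_card_gt_1[where 'p='a] by simp
  qed
qed

end

instance padic_int :: (prime_card) idom
proof
  let ?p = "int CARD('a)"
  have p: "prime ?p"
    using prime_card[where 'a='a] by simp
  fix a b :: "'a padic_int"
  have "\<exists>n. (Rep_padic_int a n * Rep_padic_int b n) mod ?p ^ n \<noteq> 0"
    if "a \<noteq> 0" and "b \<noteq> 0"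
  proof -
    have res: "Rep_padic_int c (n + k) mod ?p ^ n = Rep_padic_int c n" for c :: "'a padic_int" and n k
    proof (induction k)
      case 0
      then show ?case using Rep_padic_int[of c] by simp
    next
      case (Suc k)
      have "?p ^ n dvd ?p ^ (n + k)"
        by (rule le_imp_power_dvd) simp
      then have "Rep_padic_int c (n + Suc k) mod ?p ^ n
          = Rep_padic_int c (Suc (n + k)) mod ?p ^ (n + k) mod ?p ^ n"
        by (simp add: mod_mod_cancel)
      also have "\<dots> = Rep_padic_int c (n + k) mod ?p ^ n"
        using Rep_padic_int[of c] by simp
      finally show ?case using Suc by simp
    qed
    have nz: "\<exists>n. Rep_padic_int c n \<noteq> 0" if "c \<noteq> 0" for c :: "'a padic_int"
    proof (rule ccontr)
      assume "\<nexists>n. Rep_padic_int c n \<noteq> 0"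
      then have "Rep_padic_int c = Rep_padic_int (0 :: 'a padic_int)"
        by (simp add: fun_eq_iff zero_padic_int.rep_eq)
      with that show False
        by (simp add: Rep_padic_int_inject)
    qed
    obtain m where m: "Rep_padic_int a m \<noteq> 0"
      using nz[OF \<open>a \<noteq> 0\<close>] ..
    obtain n where n: "Rep_padic_int b n \<noteq> 0"
      using nz[OF \<open>b \<noteq> 0\<close>] ..
    define x y where "x = Rep_padic_int a (m + n)" and "y = Rep_padic_int b (m + n)"
    have "x mod ?p ^ m \<noteq> 0"
      using res[of a m n] m by (simp add: x_def)
    then have x: "\<not> ?p ^ m dvd x"
      by (simp add: dvd_eq_mod_eq_0)
    have "y mod ?p ^ n \<noteq> 0"
      using res[of b n m] n by (simp add: y_def add.commute)
    then have y: "\<not> ?p ^ n dvd y"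
      by (simp add: dvd_eq_mod_eq_0)
    have xy: "x \<noteq> 0" "y \<noteq> 0"
      using x y by auto
    have pu: "\<not> is_unit ?p"
      using p not_prime_unit by blast
    have "multiplicity ?p (x * y) = multiplicity ?p x + multiplicity ?p y"
      using p xy by (intro prime_elem_multiplicity_mult_distrib) auto
    also have "\<dots> < m + n"
      using x y by (simp add: power_dvd_iff_le_multiplicity[OF xy(1) pu]
          power_dvd_iff_le_multiplicity[OF xy(2) pu])
    finally have "\<not> ?p ^ (m + n) dvd x * y"
      by (subst power_dvd_iff_le_multiplicity[OF _ pu]) (use xy in auto)
    then show ?thesis
      unfolding x_def y_def by (intro exI[of _ "m + n"]) (simp add: dvd_eq_mod_eq_0)
  qed
  then have nonzero: "\<exists>n. Rep_padic_int (a * b) n \<noteq> 0" if "a \<noteq> 0" and "b \<noteq> 0"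
    using that by (simp add: times_padic_int.rep_eq)
  then show "a * b \<noteq> 0" if "a \<noteq> 0" and "b \<noteq> 0"
    using that by (force simp: zero_padic_int.rep_eq)
qed

type_synonym 'p padic = "'p padic_int fract"


section \<open>Matrices\<close>

text \<open>The entry \<open>(i, j)\<close> is the cofactor of the entry \<open>(j, i)\<close>.\<close>

definition adjugate :: "'k::comm_ring_1^'n^'n \<Rightarrow> 'k^'n^'n" where
  "adjugate A = (\<chi> i j. det (\<chi> r c. if r = j then (if c = i then 1 else 0) else A $ r $ c))"

lemma adjugate_2:
  "adjugate (A :: 'k::comm_ring_1^2^2) =
    vector [vector [A$2$2, - A$1$2], vector [- A$2$1, A$1$1]]"
  by (simp add: adjugate_def vec_eq_iff forall_2 det_2)

lemma adjugate_3:
  "adjugate (A :: 'k::comm_ring_1^3^3) = vector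
    [vector [A$2$2 * A$3$3 - A$2$3 * A$3$2, A$1$3 * A$3$2 - A$1$2 * A$3$3, A$1$2 * A$2$3 - A$1$3 * A$2$2],
     vector [A$2$3 * A$3$1 - A$2$1 * A$3$3, A$1$1 * A$3$3 - A$1$3 * A$3$1, A$1$3 * A$2$1 - A$1$1 * A$2$3],
     vector [A$2$1 * A$3$2 - A$2$2 * A$3$1, A$1$2 * A$3$1 - A$1$1 * A$3$2, A$1$1 * A$2$2 - A$1$2 * A$2$1]]"
  by (simp add: adjugate_def vec_eq_iff forall_3 det_3)

definition mat_scale :: "'k::times \<Rightarrow> 'k^'n^'m \<Rightarrow> 'k^'n^'m" where
  "mat_scale c A = map_matrix ((*) c) A"


section \<open>The split Albert algebra as a first Tits construction\<close>

type_synonym 'k albert = "('k^3^3) \<times> ('k^3^3) \<times> ('k^3^3)"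

definition albert_scale :: "'k::field \<Rightarrow> 'k albert \<Rightarrow> 'k albert" where
  "albert_scale c = (\<lambda>(a0, a1, a2). (mat_scale c a0, mat_scale c a1, mat_scale c a2))"

definition albert_one :: "'k::field albert" where
  "albert_one = (mat 1, 0, 0)"

definition albert_Tr :: "'k::field albert \<Rightarrow> 'k" where
  "albert_Tr = (\<lambda>(a0, a1, a2). trace a0)"

definition albert_sharp :: "'k::field albert \<Rightarrow> 'k albert" where
  "albert_sharp = (\<lambda>(a0, a1, a2).
    (adjugate a0 - a1 ** a2, adjugate a2 - a0 ** a1, adjugate a1 - a2 ** a0))"

definition albert_cross :: "'k::field albert \<Rightarrow> 'k albert \<Rightarrow> 'k albert" where
  "albert_cross a b = albert_sharp (a + b) - albert_sharp a - albert_sharp b"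

definition albert_Sr :: "'k::field albert \<Rightarrow> 'k albert \<Rightarrow> 'k" where
  "albert_Sr a b = albert_Tr (albert_cross a b)"

definition albert_mult :: "'k::field albert \<Rightarrow> 'k albert \<Rightarrow> 'k albert" where
  "albert_mult a b = albert_scale (1 / 2)
    (albert_cross a b + albert_scale (albert_Tr a) b + albert_scale (albert_Tr b) a
      - albert_scale (albert_Sr a b) albert_one)"

definition albert_Q :: "'k::field albert \<Rightarrow> 'k" where
  "albert_Q a = 1 / 2 * albert_Tr (albert_mult a a)"

lemma vector_space_albert: "vector_space (albert_scale :: 'k::field \<Rightarrow> _)"
  by unfold_locales
    (auto simp: albert_scale_def mat_scale_def map_matrix_def vec_eq_iff algebra_simps)

definition albert_Aut :: "('k::field albert \<Rightarrow> 'k albert) monoid" where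
  "albert_Aut = \<lparr>carrier = {f. bij f \<and> Vector_Spaces.linear albert_scale albert_scale f \<and>
      (\<forall>a b. f (albert_mult a b) = albert_mult (f a) (f b))}, mult = (\<circ>), one = id\<rparr>"

lemma albert_Aut_carrier_iff:
  "f \<in> carrier albert_Aut \<longleftrightarrow> bij f \<and> (\<forall>a b. f (a + b) = f a + f b) \<and>
    (\<forall>c a. f (albert_scale c a) = albert_scale c (f a)) \<and>
    (\<forall>a b. f (albert_mult a b) = albert_mult (f a) (f b))"
  unfolding albert_Aut_def Vector_Spaces.linear_iff using vector_space_albert by fastforce

lemma group_albert_Aut: "group (albert_Aut :: ('k::field albert \<Rightarrow> _) monoid)"
proof (rule groupI)
  let ?G = "albert_Aut :: ('k albert \<Rightarrow> _) monoid"
  show "\<one>\<^bsub>?G\<^esub> \<in> carrier ?G"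
    unfolding albert_Aut_carrier_iff by (simp add: albert_Aut_def del: split_paired_All)
  show "f \<otimes>\<^bsub>?G\<^esub> h \<in> carrier ?G" if "f \<in> carrier ?G" "h \<in> carrier ?G" for f h
    using that unfolding albert_Aut_carrier_iff by (simp add: albert_Aut_def bij_comp del: split_paired_All)
  show "f \<otimes>\<^bsub>?G\<^esub> h \<otimes>\<^bsub>?G\<^esub> j = f \<otimes>\<^bsub>?G\<^esub> (h \<otimes>\<^bsub>?G\<^esub> j)" for f h j
    by (simp add: albert_Aut_def comp_assoc)
  show "\<one>\<^bsub>?G\<^esub> \<otimes>\<^bsub>?G\<^esub> f = f" for f
    by (simp add: albert_Aut_def)
  fix f assume "f \<in> carrier ?G"
  then have f: "bij f" and add: "f (a + b) = f a + f b"
    and scale: "f (albert_scale c a) = albert_scale c (f a)"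
    and mult: "f (albert_mult a b) = albert_mult (f a) (f b)" for a b c
    unfolding albert_Aut_carrier_iff by blast+
  define h where "h = inv_into UNIV f"
  have fh: "f (h x) = x" and hf: "h (f x) = x" for x
    using f by (simp_all add: h_def bij_is_inj bij_is_surj surj_f_inv_f)
  have "bij h"
    using f by (simp add: h_def bij_imp_bij_inv)
  moreover have "h (a + b) = h a + h b" for a b
    using hf[of "h a + h b"] unfolding add fh .
  moreover have "h (albert_scale c a) = albert_scale c (h a)" for c a
    using hf[of "albert_scale c (h a)"] unfolding scale fh .
  moreover have "h (albert_mult a b) = albert_mult (h a) (h b)" for a b
    using hf[of "albert_mult (h a) (h b)"] unfolding mult fh .
  ultimately have "h \<in> carrier ?G"
    unfolding albert_Aut_carrier_iff by blast
  moreover have "h \<otimes>\<^bsub>?G\<^esub> f = \<one>\<^bsub>?G\<^esub>"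
    using hf by (simp add: albert_Aut_def fun_eq_iff del: split_paired_All)
  ultimately show "\<exists>h\<in>carrier ?G. h \<otimes>\<^bsub>?G\<^esub> f = \<one>\<^bsub>?G\<^esub>"
    by blast
qed


section \<open>The involutions of the automorphism group\<close>

definition torus_mat :: "'k::field \<Rightarrow> 'k \<Rightarrow> 'k^3^3" where
  "torus_mat x y = (\<chi> i j. if i = j then (vector [x, inverse x * y, inverse y] :: 'k^3) $ i else 0)"

definition torus_params :: "('k::field \<times> 'k \<times> 'k \<times> 'k) set" where
  "torus_params = {(u1, u2, v1, v2). u1 \<noteq> 0 \<and> u2 \<noteq> 0 \<and> v1 \<noteq> 0 \<and> v2 \<noteq> 0}"

definition albert_t :: "'k::field \<times> 'k \<times> 'k \<times> 'k \<Rightarrow> 'k albert \<Rightarrow> 'k albert" where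
  "albert_t = (\<lambda>(u1, u2, v1, v2) (a0, a1, a2).
    let u = torus_mat u1 u2; v = torus_mat v1 v2
    in (u ** a0 ** matrix_inv u, u ** a1 ** matrix_inv v, v ** a2 ** matrix_inv u))"

definition albert_g :: "'k::field albert \<Rightarrow> 'k albert" where
  "albert_g = (\<lambda>(a0, a1, a2). (transpose a0, transpose a2, transpose a1))"

definition gt :: "'k::field \<times> 'k \<times> 'k \<times> 'k \<Rightarrow> 'k albert \<Rightarrow> 'k albert" where
  "gt \<tau> = albert_g \<circ> albert_t \<tau>"

text \<open>Conjugation by an element of a group, as an element of \<^const>\<open>AutoGroup\<close> (whose elements are
  functions that are \<^const>\<open>undefined\<close> outside the carrier).\<close>

definition conj_map :: "('a, 'b) monoid_scheme \<Rightarrow> 'a \<Rightarrow> 'a \<Rightarrow> 'a" where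
  "conj_map G s = (\<lambda>x\<in>carrier G. s \<otimes>\<^bsub>G\<^esub> x \<otimes>\<^bsub>G\<^esub> inv\<^bsub>G\<^esub> s)"

abbreviation I_gt :: "'k::field \<times> 'k \<times> 'k \<times> 'k \<Rightarrow> ('k albert \<Rightarrow> 'k albert) \<Rightarrow> ('k albert \<Rightarrow> 'k albert)"
  where "I_gt \<tau> \<equiv> conj_map albert_Aut (gt \<tau>)"

text \<open>Involutions of \<^const>\<open>albert_Aut\<close> are automorphisms of order 2 of the group of \<open>k\<close>-linear
  automorphisms, that is, of the group of rational points; those considered below are inner and so
  come from automorphisms of the algebraic group.\<close>

definition is_involution :: "('a, 'b) monoid_scheme \<Rightarrow> ('a \<Rightarrow> 'a) \<Rightarrow> bool" where
  "is_involution G \<phi> \<longleftrightarrow> \<phi> \<in> carrier (AutoGroup G) \<and> \<phi> \<noteq> \<one>\<^bsub>AutoGroup G\<^esub> \<and>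
    \<phi> \<otimes>\<^bsub>AutoGroup G\<^esub> \<phi> = \<one>\<^bsub>AutoGroup G\<^esub>"

definition isomorphic_involutions :: "('a, 'b) monoid_scheme \<Rightarrow> ('a \<Rightarrow> 'a) \<Rightarrow> ('a \<Rightarrow> 'a) \<Rightarrow> bool" where
  "isomorphic_involutions G \<phi> \<phi>' \<longleftrightarrow> (\<exists>h\<in>carrier G.
    \<phi>' = conj_map G h \<otimes>\<^bsub>AutoGroup G\<^esub> \<phi> \<otimes>\<^bsub>AutoGroup G\<^esub> inv\<^bsub>AutoGroup G\<^esub> conj_map G h)"

definition gt_involutions :: "(('k::field albert \<Rightarrow> 'k albert) \<Rightarrow> ('k albert \<Rightarrow> 'k albert)) set" where
  "gt_involutions = {\<phi>. is_involution albert_Aut \<phi> \<and> (\<exists>\<tau>\<in>torus_params. \<phi> = I_gt \<tau>)}"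

text \<open>Representatives are given by their parameters; distinct elements of \<open>T\<close> are thus required to
  yield distinct classes.\<close>

definition class_representatives :: "('k::field \<times> 'k \<times> 'k \<times> 'k) set \<Rightarrow> bool" where
  "class_representatives T \<longleftrightarrow> (\<forall>\<tau>\<in>T. I_gt \<tau> \<in> gt_involutions) \<and>
    (\<forall>\<phi>\<in>gt_involutions. \<exists>!\<tau>. \<tau> \<in> T \<and> isomorphic_involutions albert_Aut (I_gt \<tau>) \<phi>)"

abbreviation gt_isomorphic :: "'k::field \<times> 'k \<times> 'k \<times> 'k \<Rightarrow> 'k \<times> 'k \<times> 'k \<times> 'k \<Rightarrow> bool"
  where "gt_isomorphic \<sigma> \<tau> \<equiv> isomorphic_involutions albert_Aut (I_gt \<sigma>) (I_gt \<tau>)"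


section \<open>Quaternion subalgebras of the split octonions\<close>

text \<open>The split octonion algebra as the Cayley--Dickson double of the algebra of \<open>2 \<times> 2\<close> matrices,
  whose conjugation is \<^const>\<open>adjugate\<close> and whose norm is \<^const>\<open>det\<close>.\<close>

type_synonym 'k octonion = "('k^2^2) \<times> ('k^2^2)"

definition oct_scale :: "'k::field \<Rightarrow> 'k octonion \<Rightarrow> 'k octonion" where
  "oct_scale c = (\<lambda>(x, y). (mat_scale c x, mat_scale c y))"

definition oct_one :: "'k::field octonion" where
  "oct_one = (mat 1, 0)"

definition oct_mult :: "'k::field octonion \<Rightarrow> 'k octonion \<Rightarrow> 'k octonion" where
  "oct_mult = (\<lambda>(x, y) (u, v). (x ** u + adjugate v ** y, v ** x + y ** adjugate u))"

definition oct_conj :: "'k::field octonion \<Rightarrow> 'k octonion" where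
  "oct_conj = (\<lambda>(x, y). (adjugate x, - y))"

definition oct_norm :: "'k::field octonion \<Rightarrow> 'k" where
  "oct_norm = (\<lambda>(x, y). det x - det y)"

definition oct_bilin :: "'k::field octonion \<Rightarrow> 'k octonion \<Rightarrow> 'k" where
  "oct_bilin x y = oct_norm (x + y) - oct_norm x - oct_norm y"

lemma vector_space_oct: "vector_space (oct_scale :: 'k::field \<Rightarrow> _)"
  by unfold_locales
    (auto simp: oct_scale_def mat_scale_def map_matrix_def vec_eq_iff algebra_simps)

text \<open>A quaternion subalgebra is a composition subalgebra of dimension 4.\<close>

definition quaternion_subalgebra :: "'k::field octonion set \<Rightarrow> bool" where
  "quaternion_subalgebra D \<longleftrightarrow>
    module.subspace oct_scale D \<and> vector_space.dim oct_scale D = 4 \<and>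
    oct_one \<in> D \<and> (\<forall>x\<in>D. \<forall>y\<in>D. oct_mult x y \<in> D) \<and>
    (\<forall>x\<in>D. (\<forall>y\<in>D. oct_bilin x y = 0) \<longrightarrow> x = 0)"

definition split_subalgebra :: "'k::field octonion set \<Rightarrow> bool" where
  "split_subalgebra D \<longleftrightarrow> (\<exists>x\<in>D. \<exists>y\<in>D. x \<noteq> 0 \<and> y \<noteq> 0 \<and> oct_mult x y = 0)"

definition division_subalgebra :: "'k::field octonion set \<Rightarrow> bool" where
  "division_subalgebra D \<longleftrightarrow>
    (\<forall>x\<in>D. x \<noteq> 0 \<longrightarrow> (\<exists>y\<in>D. oct_mult x y = oct_one \<and> oct_mult y x = oct_one))"


section \<open>The Jordan algebras of Hermitian matrices\<close>

text \<open>The last condition is \<open>\<gamma>\<^sup>-\<^sup>1 x\<^sup>* \<gamma> = x\<close> for the conjugate transpose \<open>x\<^sup>*\<close>, with \<open>\<gamma>\<close> read as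
  a diagonal matrix.\<close>

definition H3 :: "'k::field octonion set \<Rightarrow> 'k^3 \<Rightarrow> ('k octonion^3^3) set" where
  "H3 D \<gamma> = {x. (\<forall>i j. x $ i $ j \<in> D) \<and> (\<forall>i. \<exists>c. x $ i $ i = oct_scale c oct_one) \<and>
    (\<forall>i j. oct_scale (inverse (\<gamma> $ i) * \<gamma> $ j) (oct_conj (x $ j $ i)) = x $ i $ j)}"

definition oct_mat_scale :: "'k::field \<Rightarrow> 'k octonion^3^3 \<Rightarrow> 'k octonion^3^3" where
  "oct_mat_scale c = map_matrix (oct_scale c)"

definition oct_mat_mult :: "'k::field octonion^3^3 \<Rightarrow> 'k octonion^3^3 \<Rightarrow> 'k octonion^3^3" where
  "oct_mat_mult x y = (\<chi> i j. \<Sum>k\<in>UNIV. oct_mult (x $ i $ k) (y $ k $ j))"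

definition H3_mult :: "'k::field octonion^3^3 \<Rightarrow> 'k octonion^3^3 \<Rightarrow> 'k octonion^3^3" where
  "H3_mult x y = oct_mat_scale (1 / 2) (oct_mat_mult x y + oct_mat_mult y x)"

definition gt_fixed :: "'k::field \<times> 'k \<times> 'k \<times> 'k \<Rightarrow> 'k albert set" where
  "gt_fixed \<tau> = {a. gt \<tau> a = a}"

definition fixed_iso_H3 :: "'k::field \<times> 'k \<times> 'k \<times> 'k \<Rightarrow> 'k octonion set \<Rightarrow> 'k^3 \<Rightarrow> bool" where
  "fixed_iso_H3 \<tau> D \<gamma> \<longleftrightarrow> quaternion_subalgebra D \<and> (\<forall>i. \<gamma> $ i \<noteq> 0) \<and>
    (\<exists>f. bij_betw f (gt_fixed \<tau>) (H3 D \<gamma>) \<and>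
      (\<forall>a\<in>gt_fixed \<tau>. \<forall>b\<in>gt_fixed \<tau>. f (a + b) = f a + f b) \<and>
      (\<forall>c. \<forall>a\<in>gt_fixed \<tau>. f (albert_scale c a) = oct_mat_scale c (f a)) \<and>
      (\<forall>a\<in>gt_fixed \<tau>. \<forall>b\<in>gt_fixed \<tau>. f (albert_mult a b) = H3_mult (f a) (f b)))"

definition fixed_split :: "'k::field \<times> 'k \<times> 'k \<times> 'k \<Rightarrow> bool" where
  "fixed_split \<tau> \<longleftrightarrow> (\<exists>D \<gamma>. fixed_iso_H3 \<tau> D \<gamma> \<and> split_subalgebra D)"

definition fixed_division :: "'k::field \<times> 'k \<times> 'k \<times> 'k \<Rightarrow> bool" where
  "fixed_division \<tau> \<longleftrightarrow> (\<exists>D \<gamma>. fixed_iso_H3 \<tau> D \<gamma> \<and> division_subalgebra D)"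

definition Q_positive_definite :: "real albert set \<Rightarrow> bool" where
  "Q_positive_definite S \<longleftrightarrow> (\<forall>a\<in>S. a \<noteq> 0 \<longrightarrow> albert_Q a > 0)"

definition Q_indefinite :: "real albert set \<Rightarrow> bool" where
  "Q_indefinite S \<longleftrightarrow> (\<exists>a\<in>S. albert_Q a > 0) \<and> (\<exists>a\<in>S. albert_Q a < 0)"

definition least_nonsquare :: "'p::prime_card itself \<Rightarrow> nat" where
  "least_nonsquare _ = (LEAST n. n > 0 \<and> (\<nexists>x :: 'p mod_ring. of_nat n = x ^ 2))"

end

theory Submission
  imports Defs
begin

text \<open>
  For nonzero \<open>x\<close>, \<open>y\<close> let \<open>T(x, y)\<close> be the diagonal matrix
  with entries \<open>x\<close>, \<open>y / x\<close>, \<open>1 / y\<close>, and put \<open>U =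
  T(u1, u2)\<close>, \<open>V = T(v1, v2)\<close>. The element \<open>gt\<close> is the map
  \<open>(a0, a1, a2) \<mapsto> (U' a0^t U, U' a2^t V, V' a1^t U)\<close>, where \<open>U'\<close>
  and \<open>V'\<close> are the inverses, so everything is determined by the two ternary quadratic
  forms \<open>U\<close> and \<open>V\<close> of determinant 1. The fixed algebra is \<open>H_3(D,
  U)\<close> for the quaternion algebra \<open>D = (-v1, -v2)\<close>, whose norm form is \<open>N =
  \<langle>1, v1, v2, v1 v2\<rangle>\<close>; this is proved in coordinates
  (\<open>fixed_iso_H3_quat_algebra\<close>).

  \<^bold>\<open>From involutions to elements.\<close> The centre of the automorphism group is
  trivial (\<open>central_automorphism_trivial\<close>). Hence two involutions \<open>I_gt\<close>
  are isomorphic if and only if the elements \<open>gt\<close> are conjugate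
  (\<open>isomorphic_of_gt_conj\<close>, \<open>gt_conj_of_isomorphic\<close>).

  \<^bold>\<open>Conjugating.\<close> The automorphisms \<open>(a0, a1, a2) \<mapsto> (p a0 p', p a1
  q', q a2 p')\<close> with \<open>det p = det q\<close> change \<open>U\<close> and
  \<open>V\<close> by congruence, so that only the isometry classes of \<open>U\<close> and
  \<open>V\<close> matter. One further automorphism is needed, the reflection
  \<open>weyl_swap\<close>. Conjugating a congruence of \<open>V\<close> with it shows that
  \<open>u1\<close> and \<open>u2\<close> may both be multiplied by a nonzero value of
  \<open>\<langle>1, v1\<rangle>\<close> or \<open>\<langle>1, v2\<rangle>\<close>
  (\<open>similarity_factor\<close>). If all scalars arise in this way, \<open>U\<close> can be made
  the identity (\<open>gt_conj_collapse_u\<close>). In particular, over every field of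
  characteristic not 2 all \<open>gt\<close> with isotropic \<open>N\<close> are conjugate
  (\<open>gt_conj_of_isotropic\<close>). The fields now differ as follows. Over an algebraically
  closed field and over a finite field of odd prime order the binary forms that occur are universal,
  so that congruences suffice. Over the reals the signs of the parameters decide. Over the p-adic
  numbers there is only one anisotropic \<open>N\<close> up to isometry of \<open>V\<close>, and the
  scalars that arise for it are all nonzero scalars; for odd \<open>p\<close> this follows from the
  parity of valuations, for \<open>p = 2\<close> from the eight square classes.

  \<^bold>\<open>Separating.\<close> The algebra \<open>H_3(D, \<gamma>)\<close> contains a
  two-dimensional subspace all of whose elements have square zero if and only if \<open>D\<close>
  has zero divisors (\<open>H3_split_plane\<close>, \<open>H3_division_no_plane\<close>). This
  property can be read off from the fixed algebra as a Jordan algebra. Therefore a fixed algebra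
  cannot be isomorphic both to some \<open>H_3(D, \<gamma>)\<close> with \<open>D\<close> split and
  to one with \<open>D\<close> a division algebra, and isotropy of \<open>N\<close> is an invariant
  of the class. Over the reals the two classes with \<open>D\<close> a division algebra differ
  because one of them has a nonzero fixed element of square zero, while on the fixed algebra of the
  other \<open>Q\<close> is positive definite.
\<close>

section \<open>Automorphisms of the first Tits construction\<close>

lemmas mat3_simps = vec_eq_iff forall_3 matrix_matrix_mult_def sum_3 mat_scale_def
  map_matrix_def transpose_def adjugate_3 mat_def trace_def

lemma adjugate_mult:
  fixes M N :: "'k::comm_ring_1^3^3"
  shows "adjugate (M ** N) = adjugate N ** adjugate M"
  unfolding mat3_simps vector_3 by (intro conjI; simp add: algebra_simps)

lemma adjugate_mult_self:
  fixes M :: "'k::comm_ring_1^3^3"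
  shows "adjugate M ** M = mat_scale (det M) (mat 1)"
  by (simp add: mat3_simps det_3) (simp add: algebra_simps)

lemma matrix_mult_distrib:
  fixes A B C :: "'k::comm_ring_1^3^3"
  shows "A ** (B + C) = A ** B + A ** C" "(A + B) ** C = A ** C + B ** C"
    "A ** (B - C) = A ** B - A ** C" "(A - B) ** C = A ** C - B ** C"
  by (simp_all add: mat3_simps algebra_simps)

lemma mat_scale_mult_left: "mat_scale c A ** B = mat_scale c (A ** B)"
  and mat_scale_mult_right: "A ** mat_scale c B = mat_scale c (A ** B)"
  for A B :: "'k::comm_ring_1^3^3"
  by (simp_all add: mat3_simps algebra_simps)

lemma mat_scale_mat_scale: "mat_scale c (mat_scale d A) = mat_scale (c * d) A"
  for A :: "'k::comm_ring_1^3^3"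
  by (simp add: mat3_simps algebra_simps)

lemma mat_scale_one [simp]: "mat_scale 1 A = A"
  for A :: "'k::comm_ring_1^3^3"
  by (simp add: mat3_simps)

lemma adjugate_of_inverse:
  fixes p p' :: "'k::comm_ring_1^3^3"
  assumes "p ** p' = mat 1"
  shows "adjugate p = mat_scale (det p) p'"
proof -
  have "adjugate p = adjugate p ** (p ** p')"
    by (simp add: assms)
  also have "\<dots> = mat_scale (det p) p'"
    by (simp add: matrix_mul_assoc adjugate_mult_self mat_scale_mult_left)
  finally show ?thesis .
qed

text \<open>The product is built from the trace, the unit and the linearization of the sharp map.
  So a linear bijection that respects trace, sharp map and unit is an automorphism; all
  automorphisms below are obtained in this way.\<close>

lemma albert_Aut_intro:
  fixes f :: "'k::field albert \<Rightarrow> 'k albert"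
  assumes bij: "bij f"
    and add: "\<And>a b. f (a + b) = f a + f b"
    and scale: "\<And>c a. f (albert_scale c a) = albert_scale c (f a)"
    and Tr: "\<And>a. albert_Tr (f a) = albert_Tr a"
    and sharp: "\<And>a. albert_sharp (f a) = f (albert_sharp a)"
    and one: "f albert_one = albert_one"
  shows "f \<in> carrier albert_Aut"
proof -
  have diff: "f (a - b) = f a - f b" for a b
    using add[of "a - b" b] by (simp del: split_paired_All add: algebra_simps)
  have cross: "albert_cross (f a) (f b) = f (albert_cross a b)" for a b
    unfolding albert_cross_def add[symmetric] sharp diff ..
  have "f (albert_mult a b) = albert_mult (f a) (f b)" for a b
    unfolding albert_mult_def albert_Sr_def cross Tr scale add diff one ..
  then show ?thesis
    unfolding albert_Aut_carrier_iff using bij add scale by blast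
qed

text \<open>The arguments \<open>p'\<close> and \<open>q'\<close> stand for the inverses of
  \<open>p\<close> and \<open>q\<close>; with explicit inverses the identities below are
  identities of matrix products.\<close>

definition tits_aut :: "'k::field^3^3 \<Rightarrow> 'k^3^3 \<Rightarrow> 'k^3^3 \<Rightarrow> 'k^3^3
    \<Rightarrow> 'k albert \<Rightarrow> 'k albert" where
  "tits_aut p p' q q' = (\<lambda>(a0, a1, a2). (p ** a0 ** p', p ** a1 ** q', q ** a2 ** p'))"

text \<open>This is the shape of \<open>gt\<close> for arbitrary forms \<open>U\<close>,
  \<open>V\<close> with inverses \<open>U'\<close>, \<open>V'\<close>. Unlike the set of all
  \<open>gt\<close>, it is stable under conjugation by \<open>tits_aut\<close>.\<close>

definition tits_swap :: "'k::field^3^3 \<Rightarrow> 'k^3^3 \<Rightarrow> 'k^3^3 \<Rightarrow> 'k^3^3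
    \<Rightarrow> 'k albert \<Rightarrow> 'k albert" where
  "tits_swap U U' V V' = (\<lambda>(a0, a1, a2).
     (U' ** transpose a0 ** U, U' ** transpose a2 ** V, V' ** transpose a1 ** U))"

lemma mult_cancel_inverse:
  fixes p p' :: "'k::comm_ring_1^3^3"
  assumes "p ** p' = mat 1"
  shows "a ** p ** p' = a" "p ** (p' ** a) = a"
  using assms by (simp_all only: matrix_mul_assoc[symmetric] matrix_mul_rid)
    (simp only: matrix_mul_assoc matrix_mul_lid)

text \<open>The adjugate reverses products and the adjugate of \<open>p\<close> is \<open>det
  p\<close> times its inverse. In each component of the sharp map the determinants cancel, because
  \<open>det p = det q\<close>.\<close>

lemma tits_aut_in_Aut:
  fixes p p' q q' :: "'k::field^3^3"
  assumes p: "p ** p' = mat 1" and q: "q ** q' = mat 1" and det: "det p = det q"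
  shows "tits_aut p p' q q' \<in> carrier albert_Aut"
proof (rule albert_Aut_intro)
  have p': "p' ** p = mat 1" and q': "q' ** q = mat 1"
    using p q matrix_left_right_inverse by blast+
  have dp: "det p * det p' = 1" and dq: "det q * det q' = 1"
    using p q by (metis det_I det_mul)+
  note adj = adjugate_of_inverse[OF p] adjugate_of_inverse[OF p']
    adjugate_of_inverse[OF q] adjugate_of_inverse[OF q']
  note canc = mult_cancel_inverse[OF p] mult_cancel_inverse[OF p']
    mult_cancel_inverse[OF q] mult_cancel_inverse[OF q']
  have "tits_aut p' p q' q (tits_aut p p' q q' a) = a"
    "tits_aut p p' q q' (tits_aut p' p q' q a) = a" for a
    by (cases a; simp add: tits_aut_def canc matrix_mul_assoc p p' q q' del: split_paired_All)+
  then show "bij (tits_aut p p' q q')"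
    by (metis bijI')
  show "tits_aut p p' q q' (a + b) = tits_aut p p' q q' a + tits_aut p p' q q' b" for a b
    by (cases a; cases b; simp add: tits_aut_def matrix_mult_distrib)
  show "tits_aut p p' q q' (albert_scale c a) = albert_scale c (tits_aut p p' q q' a)" for c a
    by (cases a; simp add: tits_aut_def albert_scale_def mat_scale_mult_left mat_scale_mult_right)
  show "albert_Tr (tits_aut p p' q q' a) = albert_Tr a" for a
  proof (cases a)
    case (fields a0 a1 a2)
    have "trace (p ** a0 ** p') = trace (p' ** (p ** a0))" by (rule trace_mul_sym)
    then show ?thesis
      by (simp add: fields tits_aut_def albert_Tr_def canc)
  qed
  have d: "det p' * det p = 1" "det q' * det p = 1" "det p' * det q = 1" "det p * det p' = 1"
    "det p * det q' = 1" "det q * det p' = 1"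
    using dp dq det by (simp_all add: mult.commute)
  show "albert_sharp (tits_aut p p' q q' a) = tits_aut p p' q q' (albert_sharp a)" for a
    by (cases a; simp add: tits_aut_def albert_sharp_def adjugate_mult adj mat_scale_mult_left
        mat_scale_mult_right mat_scale_mat_scale d matrix_mult_distrib matrix_mul_assoc canc)
  show "tits_aut p p' q q' albert_one = albert_one"
    by (simp add: tits_aut_def albert_one_def p)
qed

lemma albert_g_in_Aut: "(albert_g :: 'k::field albert \<Rightarrow> _) \<in> carrier albert_Aut"
proof (rule albert_Aut_intro)
  have "albert_g (albert_g a) = a" for a :: "'k albert"
    by (cases a; simp add: albert_g_def)
  then show "bij (albert_g :: 'k albert \<Rightarrow> _)"
    by (metis bijI')
  show "albert_g (a + b) = albert_g a + albert_g b" for a b :: "'k albert"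
    by (cases a; cases b; simp add: albert_g_def mat3_simps)
  show "albert_g (albert_scale c a) = albert_scale c (albert_g a)" for c and a :: "'k albert"
    by (cases a; simp add: albert_g_def albert_scale_def mat3_simps)
  show "albert_Tr (albert_g a) = albert_Tr a" for a :: "'k albert"
    by (cases a; simp add: albert_g_def albert_Tr_def mat3_simps)
  show "albert_sharp (albert_g a) = albert_g (albert_sharp a)" for a :: "'k albert"
    by (cases a; simp add: albert_g_def albert_sharp_def mat3_simps algebra_simps)
  show "albert_g (albert_one :: 'k albert) = albert_one"
    by (simp add: albert_g_def albert_one_def mat3_simps)
qed

text \<open>The reflection of the torus in the character \<open>u1 u3 / (u2 v1)\<close>, a long
  root of \<open>F_4\<close> that is not a root of the group of all \<open>tits_aut\<close>. It
  exchanges those pairs of coordinates whose weights differ by this root; the signs make it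
  compatible with the sharp map.\<close>

definition weyl_swap :: "'k::field albert \<Rightarrow> 'k albert" where
  "weyl_swap = (\<lambda>(a, b, c).
    (vector [vector [a$1$1, c$1$3, a$1$3], vector [b$3$1, a$2$2, - b$1$1], vector [a$3$1, - c$1$1, a$3$3]],
     vector [vector [a$2$3, b$1$2, b$1$3], vector [b$2$1, - c$3$2, c$2$2], vector [- a$2$1, b$3$2, b$3$3]],
     vector [vector [a$3$2, c$1$2, - a$1$2], vector [c$2$1, - b$2$3, c$2$3], vector [c$3$1, b$2$2, c$3$3]]))"

lemma weyl_swap_in_Aut: "(weyl_swap :: 'k::field albert \<Rightarrow> _) \<in> carrier albert_Aut"
proof (rule albert_Aut_intro)
  have "weyl_swap (weyl_swap (weyl_swap (weyl_swap a))) = a" for a :: "'k albert"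
    by (cases a; simp add: weyl_swap_def mat3_simps)
  then show "bij (weyl_swap :: 'k albert \<Rightarrow> _)"
    by (metis bijI')
  show "weyl_swap (a + b) = weyl_swap a + weyl_swap b" for a b :: "'k albert"
    by (cases a; cases b; simp add: weyl_swap_def mat3_simps)
  show "weyl_swap (albert_scale c a) = albert_scale c (weyl_swap a)" for c and a :: "'k albert"
    by (cases a; simp add: weyl_swap_def albert_scale_def mat3_simps)
  show "albert_Tr (weyl_swap a) = albert_Tr a" for a :: "'k albert"
    by (cases a; simp add: weyl_swap_def albert_Tr_def mat3_simps)
  show "albert_sharp (weyl_swap a) = weyl_swap (albert_sharp a)" for a :: "'k albert"
    by (cases a; simp add: weyl_swap_def albert_sharp_def mat3_simps; simp add: algebra_simps)
  show "weyl_swap (albert_one :: 'k albert) = albert_one"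
    by (simp add: weyl_swap_def albert_one_def mat3_simps)
qed

lemma torus_mat_mult: "torus_mat x y ** torus_mat x' y' = torus_mat (x * x') (y * y')"
  for x :: "'k::field"
  by (simp add: torus_mat_def mat3_simps)

lemma torus_mat_one: "torus_mat 1 1 = (mat 1 :: 'k::field^3^3)"
  by (simp add: torus_mat_def mat3_simps)

lemma torus_mat_inverse:
  fixes x y :: "'k::field"
  assumes "x \<noteq> 0" "y \<noteq> 0"
  shows "torus_mat x y ** torus_mat (inverse x) (inverse y) = mat 1"
    "torus_mat (inverse x) (inverse y) ** torus_mat x y = mat 1"
  using assms by (simp_all add: torus_mat_mult torus_mat_one)

lemma matrix_inv_eqI:
  fixes A B :: "'k::field^3^3"
  assumes "A ** B = mat 1"
  shows "matrix_inv A = B"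
proof -
  have BA: "B ** A = mat 1"
    using matrix_left_right_inverse1[OF assms] .
  have "C = B" if "A ** C = mat 1 \<and> C ** A = mat 1" for C
  proof -
    have "C = B ** (A ** C)"
      by (rule mult_cancel_inverse(2)[OF BA, symmetric])
    also have "\<dots> = B"
      using that by (simp only: matrix_mul_rid)
    finally show ?thesis .
  qed
  then show ?thesis
    unfolding matrix_inv_def using assms BA by (blast intro: some_equality)
qed

lemma det_torus_mat: "x \<noteq> 0 \<Longrightarrow> y \<noteq> 0 \<Longrightarrow> det (torus_mat x y ::
    'k::field^3^3) = 1"
  by (simp add: torus_mat_def det_3 field_simps)

lemma albert_t_eq:
  assumes "u1 \<noteq> 0" "u2 \<noteq> 0" "v1 \<noteq> 0" "v2 \<noteq> (0 :: 'k::field)"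
  shows "albert_t (u1, u2, v1, v2) = tits_aut (torus_mat u1 u2) (torus_mat (inverse u1) (inverse u2))
      (torus_mat v1 v2) (torus_mat (inverse v1) (inverse v2))"
proof
  fix a :: "'k albert"
  show "albert_t (u1, u2, v1, v2) a = tits_aut (torus_mat u1 u2) (torus_mat (inverse u1) (inverse u2))
      (torus_mat v1 v2) (torus_mat (inverse v1) (inverse v2)) a"
    using matrix_inv_eqI[OF torus_mat_inverse(1)[OF assms(1,2)]]
      matrix_inv_eqI[OF torus_mat_inverse(1)[OF assms(3,4)]]
    by (cases a; simp only: albert_t_def tits_aut_def Let_def prod.case)
qed

lemma gt_eq:
  assumes "u1 \<noteq> 0" "u2 \<noteq> 0" "v1 \<noteq> 0" "v2 \<noteq> (0 :: 'k::field)"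
  shows "gt (u1, u2, v1, v2) = tits_swap (torus_mat u1 u2) (torus_mat (inverse u1) (inverse u2))
      (torus_mat v1 v2) (torus_mat (inverse v1) (inverse v2))"
proof -
  have "transpose (torus_mat x y) = torus_mat x y" for x y :: 'k
    by (simp add: torus_mat_def mat3_simps)
  then show ?thesis
    unfolding gt_def albert_t_eq[OF assms]
    by (intro ext) (auto simp add: albert_g_def tits_aut_def tits_swap_def matrix_transpose_mul
        matrix_mul_assoc)
qed

lemma gt_in_Aut: "\<tau> \<in> torus_params \<Longrightarrow> gt \<tau> \<in> carrier albert_Aut"
proof -
  assume "\<tau> \<in> torus_params"
  then obtain u1 u2 v1 v2 where \<tau>: "\<tau> = (u1, u2, v1, v2)"
    and nz: "u1 \<noteq> 0" "u2 \<noteq> 0" "v1 \<noteq> 0" "v2 \<noteq> 0"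
    by (auto simp: torus_params_def)
  have "albert_t \<tau> \<in> carrier albert_Aut"
    unfolding \<tau> albert_t_eq[OF nz] using nz
    by (intro tits_aut_in_Aut torus_mat_inverse) (simp_all add: det_torus_mat)
  then have "albert_g \<otimes>\<^bsub>albert_Aut\<^esub> albert_t \<tau> \<in> carrier albert_Aut"
    by (intro monoid.m_closed group.is_monoid group_albert_Aut albert_g_in_Aut)
  then show ?thesis by (simp add: gt_def albert_Aut_def)
qed

lemma transpose_torus_mat: "transpose (torus_mat x y) = torus_mat x y"
  for x y :: "'k::field"
  by (simp add: torus_mat_def mat3_simps)

lemma tits_swap_involutive:
  fixes U U' V V' :: "'k::field^3^3"
  assumes "U' ** U = mat 1" "V' ** V = mat 1"
    and "transpose U = U" "transpose U' = U'" "transpose V = V" "transpose V' = V'"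
  shows "tits_swap U U' V V' (tits_swap U U' V V' a) = a"
proof (cases a)
  case (fields a0 a1 a2)
  show ?thesis
    unfolding fields tits_swap_def prod.case matrix_transpose_mul transpose_transpose assms
    by (simp only: matrix_mul_assoc[symmetric] mult_cancel_inverse(2)[OF assms(1)]
        mult_cancel_inverse(2)[OF assms(2)] assms(1,2) matrix_mul_rid)
qed

lemma gt_gt:
  assumes "\<tau> \<in> torus_params"
  shows "gt \<tau> (gt \<tau> a) = a"
  using assms
  by (auto simp: torus_params_def gt_eq torus_mat_inverse transpose_torus_mat tits_swap_involutive)

section \<open>Conjugation, congruence and a reflection outside the congruences\<close>

definition gt_conj :: "'k::field \<times> 'k \<times> 'k \<times> 'k \<Rightarrow> 'k \<times> 'k \<times> 'k
    \<times> 'k \<Rightarrow> bool" where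
  "gt_conj \<sigma> \<tau> \<longleftrightarrow> (\<exists>h\<in>carrier albert_Aut. \<forall>a. h (gt \<sigma>
      a) = gt \<tau> (h a))"

lemma Aut_comp: "f \<in> carrier albert_Aut \<Longrightarrow> h \<in> carrier albert_Aut \<Longrightarrow> f
    \<circ> h \<in> carrier albert_Aut"
  using monoid.m_closed[OF group.is_monoid[OF group_albert_Aut]] by (fastforce simp: albert_Aut_def)

lemma Aut_id: "id \<in> carrier albert_Aut"
  using monoid.one_closed[OF group.is_monoid[OF group_albert_Aut]] by (simp add: albert_Aut_def)

lemma Aut_inverse:
  fixes h :: "'k::field albert \<Rightarrow> 'k albert"
  assumes "h \<in> carrier albert_Aut"
  obtains h' where "h' \<in> carrier albert_Aut" "\<And>a. h (h' a) = a" "\<And>a. h' (h a) = a"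
proof
  let ?h' = "inv\<^bsub>albert_Aut\<^esub> h"
  show "?h' \<in> carrier albert_Aut"
    using group.inv_closed[OF group_albert_Aut assms] .
  have "h \<circ> ?h' = id" "?h' \<circ> h = id"
    using group.r_inv[OF group_albert_Aut assms] group.l_inv[OF group_albert_Aut assms]
    by (simp_all add: albert_Aut_def)
  then show "h (?h' a) = a" "?h' (h a) = a" for a
    by (metis comp_apply id_apply)+
qed

lemma gt_conj_refl: "gt_conj \<sigma> \<sigma>"
  unfolding gt_conj_def using Aut_id by (metis id_apply)

lemma gt_conj_sym: "gt_conj \<sigma> \<tau> \<Longrightarrow> gt_conj \<tau> \<sigma>"
  unfolding gt_conj_def by (metis Aut_inverse)

lemma gt_conj_trans [trans]: "gt_conj \<sigma> \<tau> \<Longrightarrow> gt_conj \<tau> \<upsilon>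
    \<Longrightarrow> gt_conj \<sigma> \<upsilon>"
  unfolding gt_conj_def by (metis Aut_comp comp_apply)

text \<open>Conjugation by \<open>tits_aut\<close> acts on the two forms by congruence.\<close>

lemma tits_aut_swap:
  fixes p p' q q' :: "'k::field^3^3"
  assumes p: "p ** p' = mat 1" and q: "q ** q' = mat 1"
    and U: "U ** U' = mat 1" "U1 ** U1' = mat 1" "U = transpose p ** U1 ** p"
    and V: "V ** V' = mat 1" "V1 ** V1' = mat 1" "V = transpose q ** V1 ** q"
  shows "tits_aut p p' q q' (tits_swap U U' V V' a) = tits_swap U1 U1' V1 V1' (tits_aut p p' q q' a)"
proof -
  have conj: "W ** r' = transpose r ** W1 \<and> r ** W' = W1' ** transpose r'"
    if r: "r ** r' = mat 1" and W: "W ** W' = mat 1" "W1 ** W1' = mat 1" "W = transpose r ** W1 ** r"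
    for r r' W W' W1 W1' :: "'k^3^3"
  proof
    show *: "W ** r' = transpose r ** W1"
      unfolding W(3) by (rule mult_cancel_inverse(1)[OF r])
    have r': "r' ** r = mat 1" and W1: "W1' ** W1 = mat 1"
      by (rule matrix_left_right_inverse1[OF r], rule matrix_left_right_inverse1[OF W(2)])
    have tr: "transpose r' ** transpose r = mat 1"
      unfolding matrix_transpose_mul[symmetric] r by (rule transpose_mat)
    have "W1' ** transpose r' = W1' ** transpose r' ** (W ** W')"
      by (simp only: W(1) matrix_mul_rid)
    also have "\<dots> = W1' ** (transpose r' ** (transpose r ** (W1 ** (r ** W'))))"
      unfolding W(3) by (simp only: matrix_mul_assoc)
    also have "\<dots> = r ** W'"
      by (simp only: mult_cancel_inverse(2)[OF tr] mult_cancel_inverse(2)[OF W1])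
    finally show "r ** W' = W1' ** transpose r'" ..
  qed
  note cU = conj[OF p U] and cV = conj[OF q V]
  show ?thesis
  proof (cases a)
    case (fields a0 a1 a2)
    have "x ** (y ** z ** w) ** v = (x ** y) ** z ** (w ** v)" for x y z w v :: "'k^3^3"
      by (simp only: matrix_mul_assoc)
    moreover have "(x ** y) ** z ** (w ** v) = x ** (y ** z ** w) ** v" for x y z w v :: "'k^3^3"
      by (simp only: matrix_mul_assoc)
    ultimately show ?thesis
      unfolding fields tits_aut_def tits_swap_def prod.case matrix_transpose_mul
      by (simp only: cU[THEN conjunct1] cU[THEN conjunct2] cV[THEN conjunct1] cV[THEN conjunct2]
          matrix_mul_assoc)
        (simp only: cU[THEN conjunct1] cU[THEN conjunct2] cV[THEN conjunct1] cV[THEN conjunct2]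
            matrix_mul_assoc[symmetric])
  qed
qed

text \<open>Isometry of ternary forms of determinant 1. Requiring \<open>det P = 1\<close> makes
  any two such matrices an admissible pair for \<open>tits_aut\<close>.\<close>

definition torus_congruent :: "'k::field \<times> 'k \<Rightarrow> 'k \<times> 'k \<Rightarrow> bool" where
  "torus_congruent = (\<lambda>(x, y) (x', y').
     \<exists>P. det P = 1 \<and> torus_mat x y = transpose P ** torus_mat x' y' ** P)"

lemma torus_congruent_refl: "torus_congruent x x"
  unfolding torus_congruent_def by (cases x) (auto intro!: exI[of _ "mat 1"])

lemma det_one_inverse:
  fixes P :: "'k::field^3^3"
  assumes "det P = 1"
  obtains P' where "P ** P' = mat 1"
  using assms invertible_det_nz[of P] by (auto simp: invertible_def)

lemma gt_conj_congruent:
  fixes u1 :: "'k::field"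
  assumes nz: "u1 \<noteq> 0" "u2 \<noteq> 0" "v1 \<noteq> 0" "v2 \<noteq> 0" "x1 \<noteq> 0" "x2 \<noteq> 0"
      "y1 \<noteq> 0" "y2 \<noteq> 0"
    and "torus_congruent (u1, u2) (x1, x2)" and "torus_congruent (v1, v2) (y1, y2)"
  shows "gt_conj (u1, u2, v1, v2) (x1, x2, y1, y2)"
proof -
  obtain p q where p: "det p = 1" "torus_mat u1 u2 = transpose p ** torus_mat x1 x2 ** p"
    and q: "det q = 1" "torus_mat v1 v2 = transpose q ** torus_mat y1 y2 ** q"
    using assms by (auto simp: torus_congruent_def)
  obtain p' q' where p': "p ** p' = mat 1" and q': "q ** q' = mat 1"
    using det_one_inverse p(1) q(1) by metis
  show ?thesis
    unfolding gt_conj_def gt_eq[OF nz(1-4)] gt_eq[OF nz(5-8)]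
    using tits_aut_swap[OF p' q' torus_mat_inverse(1)[OF nz(1,2)] torus_mat_inverse(1)[OF nz(5,6)] p(2)
        torus_mat_inverse(1)[OF nz(3,4)] torus_mat_inverse(1)[OF nz(7,8)] q(2)]
      tits_aut_in_Aut[OF p' q'] p(1) q(1) by metis
qed

lemma torus_congruent_squares:
  fixes x :: "'k::field"
  assumes "a \<noteq> 0" "b \<noteq> 0" "x \<noteq> 0" "y \<noteq> 0"
  shows "torus_congruent (a\<^sup>2 * x, b\<^sup>2 * y) (x, y)"
proof -
  have "torus_mat (a\<^sup>2 * x) (b\<^sup>2 * y) = transpose (torus_mat a b) ** torus_mat x y ** torus_mat a b"
    using assms by (simp add: transpose_torus_mat torus_mat_mult power2_eq_square ac_simps)
  then show ?thesis
    using assms det_torus_mat by (auto simp: torus_congruent_def)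
qed

text \<open>A binary form \<open>\<langle>a, b\<rangle>\<close> is isometric to \<open>\<langle>n
  a, n b\<rangle>\<close> whenever \<open>n \<noteq> 0\<close> is a value of \<open>\<langle>1, a
  b\<rangle>\<close>: take a vector with value \<open>n a\<close> and one orthogonal to it. Here
  this is done for the first and the third diagonal entry, in the next two lemmas for the other
  two pairs of entries.\<close>

lemma torus_congruent_13:
  fixes x y :: "'k::field"
  assumes nz: "x \<noteq> 0" "y \<noteq> 0" and n: "n = X\<^sup>2 + x * y * Y\<^sup>2" "n \<noteq> 0"
  shows "torus_congruent (n * x, n * y) (x, y)"
proof -
  let ?P = "vector [vector [X, 0, - Y / n], vector [0, 1, 0], vector [x * y * Y, 0, X / n]] :: 'k^3^3"
  have "det ?P = 1"
    using n(2) by (simp add: det_3 field_simps) (simp add: n(1) power2_eq_square)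
  moreover have "torus_mat (n * x) (n * y) = transpose ?P ** torus_mat x y ** ?P"
    using nz n(2) by (simp add: mat3_simps torus_mat_def) (simp add: field_simps; simp add: n(1)
        power2_eq_square algebra_simps)
  ultimately show ?thesis
    by (auto simp: torus_congruent_def)
qed

lemma torus_congruent_23:
  fixes x y :: "'k::field"
  assumes nz: "x \<noteq> 0" "y \<noteq> 0" and n: "n = X\<^sup>2 + x * Y\<^sup>2" "n \<noteq> 0"
  shows "torus_congruent (x, n * y) (x, y)"
proof -
  let ?P = "vector [vector [1, 0, 0], vector [0, X, - x * Y / (y * n)], vector [0, y * Y, X / n]] :: 'k^3^3"
  have "det ?P = 1"
    using nz n(2) by (simp add: det_3 field_simps) (simp add: n(1) power2_eq_square)
  moreover have "torus_mat x (n * y) = transpose ?P ** torus_mat x y ** ?P"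
    using nz n(2) by (simp add: mat3_simps torus_mat_def) (simp add: field_simps; simp add: n(1)
        power2_eq_square algebra_simps)
  ultimately show ?thesis
    by (auto simp: torus_congruent_def)
qed

lemma torus_congruent_12:
  fixes x y :: "'k::field"
  assumes nz: "x \<noteq> 0" "y \<noteq> 0" and n: "n = X\<^sup>2 + y * Y\<^sup>2" "n \<noteq> 0"
  shows "torus_congruent (n * x, y) (x, y)"
proof -
  let ?P = "vector [vector [X, - y * Y / (x * n), 0], vector [x * Y, X / n, 0], vector [0, 0, 1]] :: 'k^3^3"
  have "det ?P = 1"
    using nz n(2) by (simp add: det_3 field_simps) (simp add: n(1) power2_eq_square)
  moreover have "torus_mat (n * x) y = transpose ?P ** torus_mat x y ** ?P"
    using nz n(2) by (simp add: mat3_simps torus_mat_def) (simp add: field_simps; simp add: n(1)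
        power2_eq_square algebra_simps)
  ultimately show ?thesis
    by (auto simp: torus_congruent_def)
qed

definition diag3 :: "'k::field \<Rightarrow> 'k \<Rightarrow> 'k \<Rightarrow> 'k^3^3" where
  "diag3 x y z = vector [vector [x, 0, 0], vector [0, y, 0], vector [0, 0, z]]"

lemma torus_mat_diag3: "torus_mat x y = diag3 x (inverse x * y) (inverse y)"
  by (simp add: torus_mat_def diag3_def mat3_simps)

lemma diag3_mult: "diag3 x y z ** diag3 x' y' z' = diag3 (x * x') (y * y') (z * z')"
  by (simp add: diag3_def mat3_simps)

lemma det_diag3: "det (diag3 x y z) = x * y * z"
  by (simp add: diag3_def det_3)

lemma transpose_diag3: "transpose (diag3 x y z) = diag3 x y z"
  by (simp add: diag3_def mat3_simps)

lemma diag3_one: "diag3 1 1 1 = mat 1"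
  by (simp add: diag3_def mat3_simps)

definition diag_swap :: "'k::field \<Rightarrow> 'k \<Rightarrow> 'k \<Rightarrow> 'k \<Rightarrow> 'k
    \<Rightarrow> 'k \<Rightarrow> 'k albert \<Rightarrow> 'k albert" where
  "diag_swap u1 u2 u3 v1 v2 v3 = tits_swap (diag3 u1 u2 u3) (diag3 (1 / u1) (1 / u2) (1 / u3))
     (diag3 v1 v2 v3) (diag3 (1 / v1) (1 / v2) (1 / v3))"

lemma gt_eq_diag_swap:
  fixes u1 :: "'k::field"
  assumes "u1 \<noteq> 0" "u2 \<noteq> 0" "v1 \<noteq> 0" "v2 \<noteq> 0"
  shows "gt (u1, u2, v1, v2) = diag_swap u1 (u2 / u1) (1 / u2) v1 (v2 / v1) (1 / v2)"
  using assms by (simp add: gt_eq diag_swap_def torus_mat_diag3 divide_inverse mult.commute)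

text \<open>Only the pair \<open>(U, V)\<close> up to a common factor matters. This allows forms
  whose determinants are equal but not 1.\<close>

lemma diag_swap_scale:
  fixes c :: "'k::field"
  assumes "c \<noteq> 0"
  shows "diag_swap (c * u1) (c * u2) (c * u3) (c * v1) (c * v2) (c * v3) = diag_swap u1 u2 u3 v1 v2 v3"
proof
  fix a :: "'k albert"
  show "diag_swap (c * u1) (c * u2) (c * u3) (c * v1) (c * v2) (c * v3) a = diag_swap u1 u2 u3 v1 v2 v3 a"
    using assms by (cases a) (simp add: diag_swap_def tits_swap_def diag3_def mat3_simps field_simps)
qed

text \<open>In terms of the torus, \<open>weyl_swap\<close> multiplies the parameter by a value of
  the coroot. Only the second entry of \<open>U\<close> and the first entry of \<open>V\<close>
  are affected.\<close>

lemma weyl_swap_diag_swap: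
  fixes u1 :: "'k::field"
  assumes nz: "u1 \<noteq> 0" "u2 \<noteq> 0" "u3 \<noteq> 0" "v1 \<noteq> 0" "v2 \<noteq> 0" "v3 \<noteq> 0"
    and eq: "u1 * u2 * u3 = v1 * v2 * v3"
  defines "z \<equiv> u1 * u3 / v1" and "w \<equiv> u1 * u3 / u2"
  shows "weyl_swap (diag_swap u1 u2 u3 v1 v2 v3 a) = diag_swap u1 z u3 w v2 v3 (weyl_swap a)"
proof -
  have *: "v3 / u2 = z / v2" "v2 / u2 = z / v3"
    using nz eq by (simp_all add: field_simps z_def)
  show ?thesis
    apply (cases a)
    apply (simp add: weyl_swap_def diag_swap_def tits_swap_def diag3_def mat3_simps)
    apply (intro conjI)
    using nz eq * apply (simp_all add: w_def z_def field_simps)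
    done
qed

lemma diag3_inverse:
  fixes x :: "'k::field"
  assumes "x \<noteq> 0" "y \<noteq> 0" "z \<noteq> 0"
  shows "diag3 x y z ** diag3 (1 / x) (1 / y) (1 / z) = mat 1"
  using assms by (simp add: diag3_mult diag3_one)

text \<open>After \<open>weyl_swap\<close> the forms have a common determinant different from 1.
  Multiplying both by \<open>v1\<close> makes the determinant a square, and
  \<open>tits_aut\<close> with diagonal matrices removes that square.\<close>

lemma gt_conj_weyl:
  fixes u1 :: "'k::field"
  assumes nz: "u1 \<noteq> 0" "u2 \<noteq> 0" "v1 \<noteq> 0" "v2 \<noteq> 0"
  shows "gt_conj (u1, u2, v1, v2) (v1 * u1, v1 * u2, v1, v1 * v2)"
proof -
  define z where "z = u1 * (1 / u2) / v1"
  define w where "w = u1 * (1 / u2) / (u2 / u1)"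
  (* The squares of the diagonal entries of p = diag(1, r, v1) and q = diag(r, 1, v1) are the quotients of the
      entries of the rescaled and of the required forms. *)
  define r where "r = u1 / u2"
  have r: "r \<noteq> 0" using nz by (simp add: r_def)
  let ?h = "tits_aut (diag3 1 r v1) (diag3 (1 / 1) (1 / r) (1 / v1)) (diag3 r 1 v1) (diag3 (1 / r) (1 / 1) (1 /
      v1))"
  have h: "?h \<in> carrier albert_Aut"
    using nz r by (intro tits_aut_in_Aut diag3_inverse) (simp_all add: det_diag3)
  have "?h (weyl_swap (gt (u1, u2, v1, v2) a)) = gt (v1 * u1, v1 * u2, v1, v1 * v2) (?h (weyl_swap a))" for a
  proof -
    have "weyl_swap (gt (u1, u2, v1, v2) a) = diag_swap u1 z (1 / u2) w (v2 / v1) (1 / v2) (weyl_swap a)"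
      unfolding z_def w_def gt_eq_diag_swap[OF nz] using nz
      by (intro weyl_swap_diag_swap) simp_all
    also have "\<dots> = diag_swap (v1 * u1) (v1 * z) (v1 * (1 / u2)) (v1 * w) (v1 * (v2 / v1)) (v1 * (1 / v2))
        (weyl_swap a)"
      by (rule diag_swap_scale[OF nz(3), THEN fun_cong, symmetric])
    also have "?h \<dots> = gt (v1 * u1, v1 * u2, v1, v1 * v2) (?h (weyl_swap a))"
    proof -
      have "diag3 (v1 * u1) (v1 * z) (v1 * (1 / u2)) = transpose (diag3 1 r v1) **
          diag3 (v1 * u1) (v1 * u2 / (v1 * u1)) (1 / (v1 * u2)) ** diag3 1 r v1"
        using nz by (simp add: transpose_diag3 diag3_mult z_def r_def)
      moreover have "diag3 (v1 * w) (v1 * (v2 / v1)) (v1 * (1 / v2)) = transpose (diag3 r 1 v1) **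
          diag3 v1 (v1 * v2 / v1) (1 / (v1 * v2)) ** diag3 r 1 v1"
        using nz by (simp add: transpose_diag3 diag3_mult w_def r_def ac_simps)
      ultimately show ?thesis
        unfolding gt_eq_diag_swap[OF no_zero_divisors no_zero_divisors nz(3) no_zero_divisors, OF nz(3,1)
            nz(3,2) nz(3,4)]
          diag_swap_def
        using nz r by (intro tits_aut_swap diag3_inverse) (simp_all add: z_def w_def)
    qed
    finally show ?thesis .
  qed
  moreover have "?h \<circ> weyl_swap \<in> carrier albert_Aut"
    by (rule Aut_comp[OF h weyl_swap_in_Aut])
  ultimately show ?thesis
    unfolding gt_conj_def by (metis comp_apply)
qed

section \<open>Similarity factors\<close>

lemma gt_conj_congruent_v:
  fixes u1 :: "'k::field"
  assumes "u1 \<noteq> 0" "u2 \<noteq> 0" "v1 \<noteq> 0" "v2 \<noteq> 0" "y1 \<noteq> 0" "y2 \<noteq> 0"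
    and "torus_congruent (v1, v2) (y1, y2)"
  shows "gt_conj (u1, u2, v1, v2) (u1, u2, y1, y2)"
  using assms by (intro gt_conj_congruent torus_congruent_refl)

lemma gt_conj_congruent_u:
  fixes u1 :: "'k::field"
  assumes "u1 \<noteq> 0" "u2 \<noteq> 0" "v1 \<noteq> 0" "v2 \<noteq> 0" "x1 \<noteq> 0" "x2 \<noteq> 0"
    and "torus_congruent (u1, u2) (x1, x2)"
  shows "gt_conj (u1, u2, v1, v2) (x1, x2, v1, v2)"
  using assms by (intro gt_conj_congruent torus_congruent_refl)

text \<open>The nonzero scalars by which the first and the third entry of \<open>U\<close> can be
  multiplied, up to squares, without changing the class.\<close>

definition similarity_factor :: "'k::field \<Rightarrow> 'k \<Rightarrow> 'k \<Rightarrow> bool" where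
  "similarity_factor v1 v2 n \<longleftrightarrow> n \<noteq> 0 \<and>
     (\<forall>u1 u2. u1 \<noteq> 0 \<longrightarrow> u2 \<noteq> 0 \<longrightarrow> gt_conj (u1, u2, v1, v2)
         (n * u1, n * u2, v1, v2))"

lemma similarity_factor_mult:
  assumes "similarity_factor v1 v2 m" "similarity_factor v1 v2 n"
  shows "similarity_factor v1 v2 (m * n)"
  unfolding similarity_factor_def
proof (intro conjI allI impI)
  show "m * n \<noteq> 0" using assms by (simp add: similarity_factor_def)
  fix u1 u2 :: 'a assume u: "u1 \<noteq> 0" "u2 \<noteq> 0"
  have "gt_conj (u1, u2, v1, v2) (n * u1, n * u2, v1, v2)"
    using assms(2) u by (simp add: similarity_factor_def)
  also have "gt_conj \<dots> (m * (n * u1), m * (n * u2), v1, v2)"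
    using assms u by (simp add: similarity_factor_def)
  finally show "gt_conj (u1, u2, v1, v2) (m * n * u1, m * n * u2, v1, v2)"
    by (simp add: mult.assoc)
qed

lemma similarity_factor_square:
  assumes "a \<noteq> 0" "v1 \<noteq> 0" "v2 \<noteq> 0"
  shows "similarity_factor v1 v2 (a\<^sup>2)"
  unfolding similarity_factor_def
proof (intro conjI allI impI)
  show "a\<^sup>2 \<noteq> 0" using assms by simp
  fix u1 u2 :: 'a assume u: "u1 \<noteq> 0" "u2 \<noteq> 0"
  show "gt_conj (u1, u2, v1, v2) (a\<^sup>2 * u1, a\<^sup>2 * u2, v1, v2)"
    using assms u by (intro gt_conj_sym[OF gt_conj_congruent_u] torus_congruent_squares) auto
qed

lemma similarity_factor_congruent:
  assumes "v1 \<noteq> 0" "v2 \<noteq> 0" "w1 \<noteq> 0" "w2 \<noteq> 0" "torus_congruent (v1, v2) (w1, w2)"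
  shows "similarity_factor v1 v2 n \<longleftrightarrow> similarity_factor w1 w2 n"
proof -
  have *: "gt_conj (u1, u2, v1, v2) (u1, u2, w1, w2)" if "u1 \<noteq> 0" "u2 \<noteq> 0" for u1 u2
    using assms that by (intro gt_conj_congruent_v)
  show ?thesis
  proof -
    have "gt_conj (u1, u2, v1, v2) (n * u1, n * u2, v1, v2) \<longleftrightarrow> gt_conj (u1, u2, w1, w2) (n *
        u1, n * u2, w1, w2)"
      if "u1 \<noteq> 0" "u2 \<noteq> 0" "n \<noteq> 0" for u1 u2
      using *[OF that(1,2)] *[OF no_zero_divisors[OF that(3,1)] no_zero_divisors[OF that(3,2)]]
      by (blast intro: gt_conj_sym gt_conj_trans)
    then show ?thesis
      unfolding similarity_factor_def by blast
  qed
qed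

text \<open>This is the change of \<open>U\<close> that congruences cannot achieve. The reflection
  moves the parameters so that \<open>n\<close> becomes a value of the binary form governing a
  congruence of \<open>V\<close>. Performing it and reflecting back leaves the factor
  \<open>n\<close> on \<open>u1\<close> and \<open>u2\<close>, and a congruence then restores
  \<open>V\<close>.\<close>

lemma similarity_factor_norm_2:
  assumes nz: "v1 \<noteq> 0" "v2 \<noteq> 0" "n \<noteq> 0" and n: "n = X\<^sup>2 + v2 * Y\<^sup>2"
  shows "similarity_factor v1 v2 n"
  unfolding similarity_factor_def
proof (intro conjI allI impI)
  show "n \<noteq> 0" by fact
  fix u1 u2 :: 'a assume u: "u1 \<noteq> 0" "u2 \<noteq> 0"
  (* The steps lead from (n u1, n u2, v1, v2) to (u1, u2, v1, v2): reflect, multiply both entries of the pair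
      (v1, v1 v2) by n, reflect back, and remove the factor n from v1. *)
  have "gt_conj (n * u1, n * u2, v1, v2) (v1 * (n * u1), v1 * (n * u2), v1, v1 * v2)"
    using nz u by (intro gt_conj_weyl) auto
  also have "gt_conj \<dots> (v1 * (n * u1), v1 * (n * u2), n * v1, n * (v1 * v2))"
  proof (rule gt_conj_sym, rule gt_conj_congruent_v)
    have "n = X\<^sup>2 + v1 * (v1 * v2) * (Y / v1)\<^sup>2"
      using nz(1) by (simp add: n field_simps power2_eq_square)
    then show "torus_congruent (n * v1, n * (v1 * v2)) (v1, v1 * v2)"
      using nz by (intro torus_congruent_13) auto
  qed (use nz u in auto)
  also have "gt_conj \<dots> (u1, u2, n * v1, v2)"
    using gt_conj_sym[OF gt_conj_weyl[OF u, of "n * v1" v2]] nz by (simp add: ac_simps)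
  also have "gt_conj \<dots> (u1, u2, v1, v2)"
    using nz u by (intro gt_conj_congruent_v torus_congruent_12[OF _ _ n]) auto
  finally show "gt_conj (u1, u2, v1, v2) (n * u1, n * u2, v1, v2)"
    by (rule gt_conj_sym)
qed

text \<open>The special case \<open>n = x y\<close>, a value of \<open>\<langle>1, x
  y\<rangle>\<close>; up to squares it exchanges the two parameters.\<close>

lemma torus_congruent_swap:
  fixes x :: "'k::field"
  assumes "x \<noteq> 0" "y \<noteq> 0"
  shows "torus_congruent (x\<^sup>2 * y, y\<^sup>2 * x) (x, y)"
  using torus_congruent_13[OF assms, of "x * y" 0 1] assms
  by (simp add: power2_eq_square ac_simps)

lemma similarity_factor_norm_1:
  assumes nz: "v1 \<noteq> 0" "v2 \<noteq> 0" "n \<noteq> 0" and n: "n = X\<^sup>2 + v1 * Y\<^sup>2"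
  shows "similarity_factor v1 v2 n"
proof -
  have "similarity_factor v2 v1 n"
    using nz n by (intro similarity_factor_norm_2)
  then have "similarity_factor (v1\<^sup>2 * v2) (v2\<^sup>2 * v1) n"
    using nz by (subst similarity_factor_congruent[OF _ _ _ _ torus_congruent_squares]) auto
  then show ?thesis
    using nz by (subst similarity_factor_congruent[OF _ _ _ _ torus_congruent_swap, symmetric]) auto
qed

text \<open>A hyperbolic plane represents everything: \<open>n = ((n + 1) / 2)^2 - ((n - 1) /
  2)^2\<close>.\<close>

lemma isotropic_binary_universal:
  fixes c :: "'k::field"
  assumes two: "(2::'k) \<noteq> 0" and c: "c \<noteq> 0" and iso: "x\<^sup>2 + c * y\<^sup>2 = 0" "x \<noteq>
      0 \<or> y \<noteq> 0"
  obtains X Y where "n = X\<^sup>2 + c * Y\<^sup>2"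
proof
  have y: "y \<noteq> 0" and x: "x \<noteq> 0" using iso c by auto
  have cc: "c = - (x\<^sup>2 / y\<^sup>2)"
    using iso y by (simp add: field_simps add_eq_0_iff)
  have four: "(4::'k) \<noteq> 0"
    using no_zero_divisors[OF two two] by simp
  have sixteen: "(16::'k) \<noteq> 0"
    using no_zero_divisors[OF four four] by simp
  show "n = ((n + 1) / 2)\<^sup>2 + c * ((n - 1) * y / (2 * x))\<^sup>2"
    unfolding cc using x y two four sixteen by (simp add: field_simps power2_eq_square)
qed

text \<open>First \<open>u1\<close> becomes 1, so that \<open>U\<close> is \<open>\<langle>1, w,
  w\<rangle>\<close> up to squares. The factor \<open>-1\<close> turns it into \<open>\<langle>-1,
  w, -w\<rangle>\<close>, which contains a hyperbolic plane; therefore \<open>w\<close> can be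
  replaced by 1, and the factor \<open>-1\<close> leads to the identity matrix.\<close>

lemma gt_conj_collapse_u:
  fixes v1 :: "'k::field"
  assumes two: "(2::'k) \<noteq> 0" and nz: "u1 \<noteq> 0" "u2 \<noteq> 0" "v1 \<noteq> 0" "v2 \<noteq> 0"
    and sim: "\<And>n. n \<noteq> 0 \<Longrightarrow> similarity_factor v1 v2 n"
  shows "gt_conj (u1, u2, v1, v2) (1, 1, v1, v2)"
proof -
  define w where "w = u2 / u1"
  have w: "w \<noteq> 0" using nz by (simp add: w_def)
  have step: "gt_conj (x, y, v1, v2) (n * x, n * y, v1, v2)" if "n \<noteq> 0" "x \<noteq> 0" "y \<noteq> 0"
      for n x y
    using sim that by (simp add: similarity_factor_def)
  have "gt_conj (u1, u2, v1, v2) (1, w, v1, v2)"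
    using step[of "1 / u1" u1 u2] nz by (simp add: w_def)
  also have "gt_conj \<dots> (- 1, - w, v1, v2)"
    using step[of "- 1" 1 w] w by simp
  also have "gt_conj \<dots> (- 1, - 1, v1, v2)"
  proof (rule gt_conj_congruent_u)
    obtain X Y where XY: "w = X\<^sup>2 + (- 1) * Y\<^sup>2"
      using isotropic_binary_universal[OF two, of "- 1" 1 1 w] by auto
    show "torus_congruent (- 1, - w) (- 1, - 1)"
      using torus_congruent_23[OF _ _ XY, of "- 1"] w by simp
  qed (use nz w in auto)
  also have "gt_conj \<dots> (1, 1, v1, v2)"
    using step[of "- 1" "- 1" "- 1"] by simp
  finally show ?thesis .
qed

text \<open>Isotropy of the norm form of the quaternion algebra \<open>(-v1, -v2)\<close>.\<close>

definition isotropic :: "'k::field \<Rightarrow> 'k \<Rightarrow> bool" where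
  "isotropic v1 v2 \<longleftrightarrow> (\<exists>x y z w. (x \<noteq> 0 \<or> y \<noteq> 0 \<or> z \<noteq> 0
      \<or> w \<noteq> 0) \<and>
     x\<^sup>2 + v1 * y\<^sup>2 + v2 * z\<^sup>2 + v1 * v2 * w\<^sup>2 = 0)"

text \<open>An isotropic vector gives values \<open>\<alpha>\<close>, \<open>\<beta>\<close> of
  \<open>\<langle>1, v1\<rangle>\<close> with \<open>\<alpha> + v2 \<beta> = 0\<close>. If
  \<open>\<beta> \<noteq> 0\<close>, then the product \<open>\<alpha> \<beta>\<close>, again a
  value of this multiplicative form, is \<open>-v2\<close> times a square, so that
  \<open>v2\<close> can be made \<open>-1\<close>; if \<open>\<beta> = 0\<close>, the form
  \<open>\<langle>1, v1\<rangle>\<close> is universal and the same is possible. From then on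
  \<open>\<langle>1, -1\<rangle>\<close> is available, and both \<open>V\<close> and
  \<open>U\<close> can be normalized.\<close>

lemma gt_conj_of_isotropic:
  fixes v1 :: "'k::field"
  assumes two: "(2::'k) \<noteq> 0" and nz: "u1 \<noteq> 0" "u2 \<noteq> 0" "v1 \<noteq> 0" "v2 \<noteq> 0"
    and iso: "isotropic v1 v2"
  shows "gt_conj (u1, u2, v1, v2) (1, 1, - 1, 1)"
proof -
  obtain x y z w where xyzw: "x \<noteq> 0 \<or> y \<noteq> 0 \<or> z \<noteq> 0 \<or> w \<noteq> 0"
    and eq: "x\<^sup>2 + v1 * y\<^sup>2 + v2 * z\<^sup>2 + v1 * v2 * w\<^sup>2 = 0"
    using iso by (auto simp: isotropic_def)
  define \<alpha> \<beta> where "\<alpha> = x\<^sup>2 + v1 * y\<^sup>2" and "\<beta> = z\<^sup>2 + v1 *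
      w\<^sup>2"
  have v2: "v2 * \<beta> = - \<alpha>"
    using eq by (simp add: \<alpha>_def \<beta>_def algebra_simps eq_neg_iff_add_eq_0)
  have "\<exists>n k X Y. n \<noteq> 0 \<and> k \<noteq> 0 \<and> n * v2 = - (k\<^sup>2) \<and> n = X\<^sup>2 +
      v1 * Y\<^sup>2"
  proof (cases "\<beta> = 0")
    case True
    then have "\<alpha> = 0"
      using v2 by simp
    then obtain a b where "a\<^sup>2 + v1 * b\<^sup>2 = 0" "a \<noteq> 0 \<or> b \<noteq> 0"
      using xyzw True unfolding \<alpha>_def \<beta>_def by blast
    then obtain X Y where "- 1 / v2 = X\<^sup>2 + v1 * Y\<^sup>2"
      using isotropic_binary_universal[OF two nz(3)] by metis
    moreover have "- 1 / v2 \<noteq> 0" "- 1 / v2 * v2 = - (1\<^sup>2)" "(1::'k) \<noteq> 0"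
      using nz by auto
    ultimately show ?thesis
      by blast
  next
    case False
    then have "\<alpha> \<noteq> 0" using v2 nz no_zero_divisors by force
    have "\<alpha> * \<beta> * v2 = \<alpha> * (v2 * \<beta>)"
      by (simp add: ac_simps)
    then have "\<alpha> * \<beta> * v2 = - (\<alpha>\<^sup>2)"
      unfolding v2 by (simp add: power2_eq_square)
    moreover have "\<alpha> * \<beta> = (x * z - v1 * y * w)\<^sup>2 + v1 * (x * w + y * z)\<^sup>2"
      by (simp add: \<alpha>_def \<beta>_def power2_eq_square algebra_simps)
    ultimately show ?thesis
      using \<open>\<alpha> \<noteq> 0\<close> False no_zero_divisors by blast
  qed
  then obtain n k X Y where n: "n \<noteq> 0" "k \<noteq> 0" "n * v2 = - (k\<^sup>2)" "n = X\<^sup>2 + v1 *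
      Y\<^sup>2"
    by blast
  have univ: "\<exists>X Y. m = X\<^sup>2 + (- 1) * Y\<^sup>2" for m :: 'k
  proof -
    obtain X Y where "m = X\<^sup>2 + (- 1) * Y\<^sup>2"
      using isotropic_binary_universal[OF two, of "- 1" 1 1 m] by auto
    then show ?thesis by blast
  qed
  have "gt_conj (u1, u2, v1, v2) (u1, u2, v1, n * v2)"
    using nz n by (intro gt_conj_sym[OF gt_conj_congruent_v] torus_congruent_23[of _ _ _ X Y]) auto
  also have "gt_conj \<dots> (u1, u2, v1, - 1)"
    using torus_congruent_squares[of 1 k v1 "- 1"] nz n by (intro gt_conj_congruent_v) auto
  also have "gt_conj \<dots> (u1, u2, - 1, - 1)"
  proof (rule gt_conj_congruent_v)
    obtain X Y where XY: "- v1 = X\<^sup>2 + (- 1) * Y\<^sup>2"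
      using univ by blast
    show "torus_congruent (v1, - 1) (- 1, - 1)"
      using torus_congruent_12[OF _ _ XY, of "- 1"] nz by simp
  qed (use nz in auto)
  also have "gt_conj \<dots> (u1, u2, - 1, 1)"
  proof (rule gt_conj_congruent_v)
    obtain X Y :: 'k where XY: "- 1 = X\<^sup>2 + (- 1) * Y\<^sup>2"
      using univ[of "- 1"] by blast
    show "torus_congruent (- 1 :: 'k, - 1) (- 1, 1)"
      using torus_congruent_23[OF _ _ XY, of 1] by simp
  qed (use nz in auto)
  also have "gt_conj \<dots> (1, 1, - 1, 1)"
  proof (rule gt_conj_collapse_u[OF two nz(1,2)])
    fix m :: 'k assume "m \<noteq> 0"
    moreover obtain X Y where "m = X\<^sup>2 + (- 1) * Y\<^sup>2"
      using univ by blast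
    ultimately show "similarity_factor (- 1) 1 m"
      using similarity_factor_norm_1[of "- 1" 1 m X Y] by simp
  qed auto
  finally show ?thesis .
qed

section \<open>Inner automorphisms of groups\<close>

lemma conj_map_apply: "x \<in> carrier G \<Longrightarrow> conj_map G s x = s \<otimes>\<^bsub>G\<^esub> x
    \<otimes>\<^bsub>G\<^esub> inv\<^bsub>G\<^esub> s"
  by (simp add: conj_map_def)

context group
begin

lemma conj_map_closed: "s \<in> carrier G \<Longrightarrow> x \<in> carrier G \<Longrightarrow> conj_map G s x
    \<in> carrier G"
  by (simp add: conj_map_apply)

lemma conj_map_one: "conj_map G \<one> = \<one>\<^bsub>AutoGroup G\<^esub>"
  by (auto simp: conj_map_def AutoGroup_def BijGroup_def)

lemma conj_map_conj_map:
  assumes "s \<in> carrier G" "t \<in> carrier G" "x \<in> carrier G"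
  shows "conj_map G s (conj_map G t x) = conj_map G (s \<otimes> t) x"
  using assms by (simp add: conj_map_apply inv_mult_group m_assoc)

lemma conj_map_in_AutoGroup:
  assumes s: "s \<in> carrier G"
  shows "conj_map G s \<in> carrier (AutoGroup G)"
proof -
  have hom: "conj_map G s \<in> hom G G"
  proof (rule homI)
    fix x y assume "x \<in> carrier G" "y \<in> carrier G"
    then show "conj_map G s (x \<otimes> y) = conj_map G s x \<otimes> conj_map G s y"
      using s by (simp add: conj_map_apply m_assoc) (simp add: m_assoc[symmetric])
  qed (use s in \<open>simp add: conj_map_closed\<close>)
  have "bij_betw (conj_map G s) (carrier G) (carrier G)"
    using s by (intro bij_betw_byWitness[where f' = "conj_map G (inv s)"])
      (auto simp: conj_map_conj_map conj_map_closed, auto simp: conj_map_apply)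
  then show ?thesis
    using hom by (auto simp: AutoGroup_def auto_def Bij_def conj_map_def)
qed

lemma conj_map_mult:
  assumes "s \<in> carrier G" "t \<in> carrier G"
  shows "conj_map G s \<otimes>\<^bsub>AutoGroup G\<^esub> conj_map G t = conj_map G (s \<otimes> t)"
proof -
  have "conj_map G s \<in> Bij (carrier G)" "conj_map G t \<in> Bij (carrier G)"
    using assms[THEN conj_map_in_AutoGroup] by (auto simp: AutoGroup_def auto_def)
  then show ?thesis
    using assms by (auto simp: AutoGroup_def BijGroup_def compose_def fun_eq_iff conj_map_conj_map)
      (simp add: conj_map_def)
qed

lemma conj_map_inv:
  assumes "s \<in> carrier G"
  shows "inv\<^bsub>AutoGroup G\<^esub> conj_map G s = conj_map G (inv s)"
  using assms by (intro group.inv_equality[OF AutoGroup])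
    (simp_all add: conj_map_mult conj_map_one conj_map_in_AutoGroup)

lemma isomorphic_involutions_conj_map:
  assumes "s \<in> carrier G" "t \<in> carrier G"
  shows "isomorphic_involutions G (conj_map G s) (conj_map G t) \<longleftrightarrow>
    (\<exists>h\<in>carrier G. conj_map G t = conj_map G (h \<otimes> s \<otimes> inv h))"
  unfolding isomorphic_involutions_def using assms by (simp add: conj_map_inv conj_map_mult)

lemma is_involution_conj_map:
  assumes s: "s \<in> carrier G" "s \<otimes> s = \<one>" and x: "x \<in> carrier G" "s \<otimes> x \<noteq> x
      \<otimes> s"
  shows "is_involution G (conj_map G s)"
proof -
  have "conj_map G s x \<noteq> x"
    using s x by (metis conj_map_apply inv_solve_right m_closed)
  then have "conj_map G s \<noteq> \<one>\<^bsub>AutoGroup G\<^esub>"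
    using x(1) by (auto simp: AutoGroup_def BijGroup_def)
  then show ?thesis
    unfolding is_involution_def using s by (simp add: conj_map_in_AutoGroup conj_map_mult conj_map_one)
qed

end

lemma Aut_mult: "f \<otimes>\<^bsub>albert_Aut\<^esub> h = f \<circ> h"
  by (simp add: albert_Aut_def)

lemma Aut_add: "h \<in> carrier albert_Aut \<Longrightarrow> h (a + b) = h a + h b"
  and Aut_scale: "h \<in> carrier albert_Aut \<Longrightarrow> h (albert_scale c a) = albert_scale c (h a)"
  and Aut_albert_mult: "h \<in> carrier albert_Aut \<Longrightarrow> h (albert_mult a b) = albert_mult (h a) (h
      b)"
  and Aut_bij: "h \<in> carrier albert_Aut \<Longrightarrow> bij h"
  unfolding albert_Aut_carrier_iff by blast+

lemma Aut_zero:
  assumes "h \<in> carrier albert_Aut"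
  shows "h 0 = 0"
  using Aut_add[OF assms, of 0 0] by (simp del: split_paired_All)

lemma albert_mult_diag3:
  fixes x :: "'k::field"
  assumes two: "(2::'k) \<noteq> 0"
  shows "albert_mult (diag3 x y z, 0, 0) (diag3 x' y' z', 0, 0) = (diag3 (x * x') (y * y') (z * z'), 0, 0)"
  using two
  by (simp add: albert_mult_def albert_cross_def albert_sharp_def albert_Tr_def albert_Sr_def
      albert_scale_def albert_one_def diag3_def mat3_simps)
    (simp add: field_simps)

definition matrix_unit :: "3 \<Rightarrow> 3 \<Rightarrow> 'k::field^3^3" where
  "matrix_unit i j = (\<chi> r c. if r = i \<and> c = j then 1 else 0)"

definition cyc :: "'k::field^3^3" where
  "cyc = vector [vector [0, 0, 1], vector [1, 0, 0], vector [0, 1, 0]]"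

text \<open>The transposition of the second and the third coordinate, with a sign that makes its
  determinant 1.\<close>

definition flip :: "'k::field^3^3" where
  "flip = vector [vector [- 1, 0, 0], vector [0, 0, 1], vector [0, 1, 0]]"

lemma cyc_transpose: "cyc ** transpose cyc = (mat 1 :: 'k::field^3^3)" and det_cyc: "det (cyc :: 'k^3^3) = 1"
  by (simp_all add: cyc_def mat3_simps det_3)

lemma flip_flip: "flip ** flip = (mat 1 :: 'k::field^3^3)" and det_flip: "det (flip :: 'k^3^3) = 1"
  by (simp_all add: flip_def mat3_simps det_3)

lemma matrix_unit_span:
  fixes b :: "'k::field^3^3"
  assumes unit: "\<And>i j. S (matrix_unit i j)"
    and add: "\<And>b c. S b \<Longrightarrow> S c \<Longrightarrow> S (b + c)"
    and scale: "\<And>t b. S b \<Longrightarrow> S (mat_scale t b)"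
  shows "S b"
proof -
  have "b = (mat_scale (b$1$1) (matrix_unit 1 1) + mat_scale (b$1$2) (matrix_unit 1 2) + mat_scale (b$1$3)
      (matrix_unit 1 3))
    + (mat_scale (b$2$1) (matrix_unit 2 1) + mat_scale (b$2$2) (matrix_unit 2 2) + mat_scale (b$2$3)
        (matrix_unit 2 3))
    + (mat_scale (b$3$1) (matrix_unit 3 1) + mat_scale (b$3$2) (matrix_unit 3 2) + mat_scale (b$3$3)
        (matrix_unit 3 3))"
    by (simp add: matrix_unit_def mat3_simps)
  moreover have "S \<dots>"
    by (intro add scale unit)
  ultimately show ?thesis by simp
qed

section \<open>Triviality of the centre\<close>

lemma mat_scale_zero: "mat_scale c (0 :: 'k::field^3^3) = 0"
  by (simp add: mat3_simps)

lemma index_mod_3: "(4 :: 3) = 1" "(5 :: 3) = 2"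
  by simp_all

text \<open>If an automorphism fixes an element, it fixes the image of that element under a
  central automorphism \<open>z\<close>. Applied to \<open>E_11\<close>, the sign changes of the
  coordinates and one transposition show that the image is the diagonal matrix with entries
  \<open>x\<close>, \<open>y\<close>, \<open>y\<close> in the first component. Likewise
  \<open>E_22\<close> goes to the matrix with entries \<open>y\<close>, \<open>x\<close>,
  \<open>y\<close>. As \<open>E_11\<close> and \<open>E_22\<close> have product 0, this forces
  \<open>y = 0\<close>, and \<open>x = 1\<close> since the image is a nonzero idempotent. Hence
  \<open>z\<close> fixes the orbit of \<open>E_11\<close> under the automorphism group, and this
  orbit spans the algebra.\<close>

lemma central_automorphism_trivial:
  fixes z :: "'k::field albert \<Rightarrow> 'k albert"
  assumes two: "(2::'k) \<noteq> 0" and z: "z \<in> carrier albert_Aut"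
    and central: "\<And>h a. h \<in> carrier albert_Aut \<Longrightarrow> z (h a) = h (z a)"
  shows "z = id"
proof -
  let ?I = "mat 1 :: 'k^3^3"
  have eq_neg: "x = - x \<longleftrightarrow> x = 0" for x :: 'k
    using two by (metis add.inverse_neutral add_eq_0_iff mult_2 mult_eq_0_iff)
  have eq_neg': "- x = x \<longleftrightarrow> x = 0" for x :: 'k
    using eq_neg by metis
  define P where "P = (diag3 1 (- 1) (- 1) :: 'k^3^3)"
  define Q where "Q = (diag3 (- 1) (- 1) 1 :: 'k^3^3)"
  have PQ: "P ** P = mat 1" "Q ** Q = mat 1" "det P = det ?I" "det Q = det ?I"
    by (simp_all add: P_def Q_def diag3_mult diag3_one det_diag3)
  have flip_e1: "flip ** diag3 1 0 0 ** flip = (diag3 1 0 0 :: 'k^3^3)"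
    by (simp add: flip_def diag3_def mat3_simps)
  have autos: "tits_aut P P ?I ?I \<in> carrier albert_Aut" "tits_aut Q Q ?I ?I \<in> carrier albert_Aut"
    "tits_aut ?I ?I P P \<in> carrier albert_Aut" "tits_aut ?I ?I Q Q \<in> carrier albert_Aut"
    "tits_aut flip flip ?I ?I \<in> carrier albert_Aut"
    "tits_aut cyc (transpose cyc) ?I ?I \<in> carrier albert_Aut"
    "tits_aut ?I ?I cyc (transpose cyc) \<in> carrier albert_Aut"
    using PQ by (intro tits_aut_in_Aut; simp add: flip_flip cyc_transpose det_flip det_cyc)+
  define e1 e2 where "e1 = (diag3 1 0 0 :: 'k^3^3, 0 :: 'k^3^3, 0 :: 'k^3^3)"
    and "e2 = (diag3 0 1 0 :: 'k^3^3, 0 :: 'k^3^3, 0 :: 'k^3^3)"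
  obtain a0 a1 a2 where ze: "z e1 = (a0, a1, a2)" by (cases "z e1")
  have stab: "h (a0, a1, a2) = (a0, a1, a2)" if "h \<in> carrier albert_Aut" "h e1 = e1" for h
    using central[OF that(1), of e1] that(2) ze by simp
  have fix_mats: "P ** a0 ** P = a0" "Q ** a0 ** Q = a0" "a1 ** P = a1" "a1 ** Q = a1"
      "P ** a2 = a2" "Q ** a2 = a2" "flip ** a0 ** flip = a0"
    using stab[OF autos(1)] stab[OF autos(2)] stab[OF autos(3)] stab[OF autos(4)] stab[OF autos(5)]
    by (simp_all add: tits_aut_def e1_def P_def Q_def diag3_mult flip_e1)
  have "a1 = 0"
    using fix_mats(3,4) by (simp add: P_def Q_def diag3_def mat3_simps eq_neg')
  moreover have "a2 = 0"
    using fix_mats(5,6) by (simp add: P_def Q_def diag3_def mat3_simps eq_neg')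
  moreover have "a0 = diag3 (a0$1$1) (a0$2$2) (a0$3$3)"
    using fix_mats(1,2) by (simp add: P_def Q_def diag3_def mat3_simps eq_neg')
  moreover have "a0$2$2 = a0$3$3"
  proof -
    have "(flip ** a0 ** flip)$2$2 = a0$3$3"
      by (simp add: flip_def mat3_simps)
    then show ?thesis by (simp add: fix_mats(7))
  qed
  ultimately obtain x y where z1: "z e1 = (diag3 x y y, 0, 0)"
    using ze by metis
  have e2: "tits_aut cyc (transpose cyc) ?I ?I e1 = e2"
    by (simp add: e1_def e2_def tits_aut_def cyc_def diag3_def mat3_simps)
  have z2: "z e2 = (diag3 y x y, 0, 0)"
    unfolding e2[symmetric] central[OF autos(6)] z1
    by (simp add: e1_def tits_aut_def cyc_def diag3_def mat3_simps)
  have "albert_mult e1 e1 = e1" "albert_mult e1 e2 = 0"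
    by (simp_all add: e1_def e2_def albert_mult_diag3[OF two]) (simp add: diag3_def mat3_simps zero_prod_def)
  then have "albert_mult (z e1) (z e1) = z e1" "albert_mult (z e1) (z e2) = 0"
    using Aut_zero[OF z] by (metis Aut_albert_mult[OF z])+
  then have "diag3 (x * x) (y * y) (y * y) = diag3 x y y"
    "diag3 (x * y) (y * x) (y * y) = 0"
    unfolding z1 z2 albert_mult_diag3[OF two] by (simp_all add: zero_prod_def)
  then have "x * x = x" "y = 0"
    by (simp_all add: diag3_def mat3_simps)
  have "x \<noteq> 0"
  proof
    assume "x = 0"
    with \<open>y = 0\<close> have "z e1 = 0"
      unfolding z1 by (simp add: zero_prod_def diag3_def mat3_simps)
    then have "e1 = 0"
      using Aut_bij[OF z] Aut_zero[OF z] by (metis bij_pointE)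
    then show False
      by (simp add: e1_def zero_prod_def diag3_def mat3_simps)
  qed
  then have e1: "z e1 = e1"
    using z1 \<open>x * x = x\<close> \<open>y = 0\<close> by (simp add: e1_def)
  define F where "F = {a. z a = a}"
  have F_Aut: "h a \<in> F" if "a \<in> F" "h \<in> carrier albert_Aut" for a h
    using that central by (simp add: F_def)
  have F_add: "a + b \<in> F" if "a \<in> F" "b \<in> F" for a b
    using that by (simp add: F_def Aut_add[OF z])
  have F_scale: "albert_scale c a \<in> F" if "a \<in> F" for a c
    using that by (simp add: F_def Aut_scale[OF z])
  have F_zero: "0 \<in> F"
    by (simp add: F_def Aut_zero[OF z])
  define T where "T = (vector [vector [1, 1, 0], vector [0, 1, 0], vector [0, 0, 1]] :: 'k^3^3)"
  define T' where "T' = (vector [vector [1, - 1, 0], vector [0, 1, 0], vector [0, 0, 1]] :: 'k^3^3)"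
  have T: "tits_aut T T' ?I ?I \<in> carrier albert_Aut"
    by (intro tits_aut_in_Aut) (simp_all add: T_def T'_def mat3_simps det_3)
  let ?C = "tits_aut cyc (transpose cyc) ?I ?I" and ?D = "tits_aut ?I ?I cyc (transpose cyc)"
  have cyc_unit: "cyc ** matrix_unit i j = matrix_unit (i + 1) j"
    "matrix_unit i j ** transpose cyc = matrix_unit i (j + 1)"
    "cyc ** matrix_unit i j ** transpose cyc = matrix_unit (i + 1) (j + 1)" for i j
    using exhaust_3[of i] exhaust_3[of j]
    by (auto simp: cyc_def matrix_unit_def mat3_simps)
  have A11: "(matrix_unit 1 1, 0, 0) \<in> F"
  proof -
    have "(matrix_unit 1 1, 0, 0) = e1"
      by (simp add: e1_def matrix_unit_def diag3_def mat3_simps)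
    then show ?thesis using e1 by (simp add: F_def)
  qed
  have "(matrix_unit 2 2, 0, 0) \<in> F"
    using F_Aut[OF A11 autos(6)] by (simp add: tits_aut_def cyc_unit)
  then have A12: "(matrix_unit 1 2, 0, 0) \<in> F"
  proof -
    assume 22: "(matrix_unit 2 2, 0, 0) \<in> F"
    have "tits_aut T T' ?I ?I (matrix_unit 2 2, 0, 0) + albert_scale (- 1) (matrix_unit 2 2, 0, 0)
        = (matrix_unit 1 2, 0, 0)"
      by (simp add: tits_aut_def T_def T'_def albert_scale_def matrix_unit_def mat3_simps)
    then show ?thesis
      using F_add[OF F_Aut[OF 22 T] F_scale[OF 22, of "- 1"]] by simp
  qed
  have "(0, 0, matrix_unit 1 3) \<in> F"
  proof -
    have "albert_scale (- 1) (weyl_swap (matrix_unit 1 2, 0, 0)) = (0, 0, matrix_unit 1 3 :: 'k^3^3)"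
      by (simp add: weyl_swap_def albert_scale_def matrix_unit_def mat3_simps)
    then show ?thesis
      using F_scale[OF F_Aut[OF A12 weyl_swap_in_Aut], of "- 1"] by simp
  qed
  then have A2: "(0, 0, matrix_unit i j) \<in> F" for i j
  proof -
    assume base: "(0, 0, matrix_unit 1 3) \<in> F"
    have row: "(0, 0, matrix_unit (i + 1) j) \<in> F" if "(0, 0, matrix_unit i j) \<in> F" for i j
      using F_Aut[OF that autos(7)] by (simp add: tits_aut_def cyc_unit)
    have col: "(0, 0, matrix_unit i (j + 1)) \<in> F" if "(0, 0, matrix_unit i j) \<in> F" for i j
      using F_Aut[OF that autos(6)] by (simp add: tits_aut_def cyc_unit)
    have "(0, 0, matrix_unit i 3) \<in> F" for i
      using base row[OF base] row[OF row[OF base]] exhaust_3[of i] by (auto simp: index_mod_3)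
    then show ?thesis
      using col[of i 3] col[OF col[of i 3]] exhaust_3[of j] by (auto simp: index_mod_3)
  qed
  have A1: "(0, matrix_unit i j, 0) \<in> F" for i j
  proof -
    have "albert_g (0, 0, matrix_unit j i) = (0, matrix_unit i j, 0 :: 'k^3^3)"
      by (auto simp: albert_g_def transpose_def matrix_unit_def vec_eq_iff)
    then show ?thesis
      using F_Aut[OF A2 albert_g_in_Aut, of j i] by simp
  qed
  have A0: "(matrix_unit i j, 0, 0) \<in> F" for i j
  proof -
    have step: "(matrix_unit (i + 1) (j + 1), 0, 0) \<in> F" if "(matrix_unit i j, 0, 0) \<in> F" for i j
      using F_Aut[OF that autos(6)] by (simp add: tits_aut_def cyc_unit)
    have orbit: "(matrix_unit (i + 1) (j + 1), 0, 0) \<in> F \<and> (matrix_unit (i + 2) (j + 2), 0, 0) \<in> F"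
      if "(matrix_unit i j, 0, 0) \<in> F" for i j
      using step[OF that] step[OF step[OF that]] by (simp add: add.assoc)
    have "flip ** matrix_unit 2 3 ** flip = (matrix_unit 3 2 :: 'k^3^3)"
      by (simp add: flip_def matrix_unit_def mat3_simps)
    moreover have A23: "(matrix_unit 2 3, 0, 0) \<in> F"
      using orbit[OF A12] by simp
    ultimately have A32: "(matrix_unit 3 2, 0, 0) \<in> F"
      using F_Aut[OF A23 autos(5)] by (simp add: tits_aut_def)
    show ?thesis
      using A11 orbit[OF A11] A12 orbit[OF A12] A32 orbit[OF A32] exhaust_3[of i] exhaust_3[of j]
      by (auto simp: index_mod_3)
  qed
  have span: "(a0, 0, 0) \<in> F" "(0, a1, 0) \<in> F" "(0, 0, a2) \<in> F" for a0 a1 a2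
  proof -
    show "(a0, 0, 0) \<in> F"
    proof (rule matrix_unit_span[of "\<lambda>b. (b, 0, 0) \<in> F"])
      show "(b + c, 0, 0) \<in> F" if "(b, 0, 0) \<in> F" "(c, 0, 0) \<in> F" for b c
        using F_add[OF that] by simp
      show "(mat_scale t b, 0, 0) \<in> F" if "(b, 0, 0) \<in> F" for t b
        using F_scale[OF that, of t] by (simp add: albert_scale_def mat_scale_zero)
    qed (rule A0)
    show "(0, a1, 0) \<in> F"
    proof (rule matrix_unit_span[of "\<lambda>b. (0, b, 0) \<in> F"])
      show "(0, b + c, 0) \<in> F" if "(0, b, 0) \<in> F" "(0, c, 0) \<in> F" for b c
        using F_add[OF that] by simp
      show "(0, mat_scale t b, 0) \<in> F" if "(0, b, 0) \<in> F" for t b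
        using F_scale[OF that, of t] by (simp add: albert_scale_def mat_scale_zero)
    qed (rule A1)
    show "(0, 0, a2) \<in> F"
    proof (rule matrix_unit_span[of "\<lambda>b. (0, 0, b) \<in> F"])
      show "(0, 0, b + c) \<in> F" if "(0, 0, b) \<in> F" "(0, 0, c) \<in> F" for b c
        using F_add[OF that] by simp
      show "(0, 0, mat_scale t b) \<in> F" if "(0, 0, b) \<in> F" for t b
        using F_scale[OF that, of t] by (simp add: albert_scale_def mat_scale_zero)
    qed (rule A2)
  qed
  show ?thesis
  proof
    fix a :: "'k albert"
    obtain a0 a1 a2 where a: "a = (a0, a1, a2)" by (cases a)
    have "(a0, 0, 0) + (0, a1, 0) + (0, 0, a2) \<in> F"
      by (intro F_add span)
    then show "z a = id a"
      by (simp add: a F_def)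
  qed
qed

section \<open>Isomorphic involutions are conjugate elements\<close>

lemma isomorphic_of_gt_conj:
  assumes \<sigma>: "\<sigma> \<in> torus_params" and \<tau>: "\<tau> \<in> torus_params" and "gt_conj \<sigma>
      \<tau>"
  shows "gt_isomorphic \<sigma> \<tau>"
proof -
  obtain h where h: "h \<in> carrier albert_Aut" and eq: "\<And>a. h (gt \<sigma> a) = gt \<tau> (h a)"
    using assms by (auto simp: gt_conj_def)
  note G = group.is_monoid[OF group_albert_Aut]
  have "h \<otimes>\<^bsub>albert_Aut\<^esub> gt \<sigma> = gt \<tau> \<otimes>\<^bsub>albert_Aut\<^esub> h"
    using eq by (auto simp: Aut_mult)
  then have "h \<otimes>\<^bsub>albert_Aut\<^esub> gt \<sigma> \<otimes>\<^bsub>albert_Aut\<^esub>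
      inv\<^bsub>albert_Aut\<^esub> h = gt \<tau>"
    using group.inv_solve_right[OF group_albert_Aut] h gt_in_Aut[OF \<sigma>] gt_in_Aut[OF \<tau>]
    by (metis group.inv_closed group_albert_Aut monoid.m_closed[OF G])
  then show ?thesis
    using group.isomorphic_involutions_conj_map[OF group_albert_Aut gt_in_Aut[OF \<sigma>] gt_in_Aut[OF
        \<tau>]] h
    by metis
qed

text \<open>If conjugation by two elements gives the same map, the elements differ by a central
  one.\<close>

lemma gt_conj_of_isomorphic:
  fixes \<sigma> \<tau> :: "'k::field \<times> 'k \<times> 'k \<times> 'k"
  assumes two: "(2::'k) \<noteq> 0" and \<sigma>: "\<sigma> \<in> torus_params" and \<tau>: "\<tau> \<in>
      torus_params"
    and iso: "gt_isomorphic \<sigma> \<tau>"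
  shows "gt_conj \<sigma> \<tau>"
proof -
  let ?G = "albert_Aut :: ('k albert \<Rightarrow> _) monoid"
  interpret G: group ?G by (rule group_albert_Aut)
  note s = gt_in_Aut[OF \<sigma>] and t = gt_in_Aut[OF \<tau>]
  obtain h where h: "h \<in> carrier ?G"
    and eq: "conj_map ?G (gt \<tau>) = conj_map ?G (h \<otimes>\<^bsub>?G\<^esub> gt \<sigma>
        \<otimes>\<^bsub>?G\<^esub> inv\<^bsub>?G\<^esub> h)"
    using iso unfolding G.isomorphic_involutions_conj_map[OF s t] by blast
  define r where "r = h \<otimes>\<^bsub>?G\<^esub> gt \<sigma> \<otimes>\<^bsub>?G\<^esub>
      inv\<^bsub>?G\<^esub> h"
  have r: "r \<in> carrier ?G" using h s by (simp add: r_def)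
  define z where "z = inv\<^bsub>?G\<^esub> gt \<tau> \<otimes>\<^bsub>?G\<^esub> r"
  have z: "z \<in> carrier ?G" using r t by (simp add: z_def)
  have "z \<otimes>\<^bsub>?G\<^esub> x = x \<otimes>\<^bsub>?G\<^esub> z" if x: "x \<in> carrier ?G" for x
  proof -
    have "conj_map ?G z x = conj_map ?G (inv\<^bsub>?G\<^esub> gt \<tau>) (conj_map ?G r x)"
      using x r t by (simp add: z_def G.conj_map_conj_map)
    also have "\<dots> = conj_map ?G (inv\<^bsub>?G\<^esub> gt \<tau>) (conj_map ?G (gt \<tau>) x)"
      by (simp add: eq r_def)
    also have "\<dots> = x"
      using x t by (simp add: G.conj_map_conj_map) (simp add: conj_map_apply)
    finally have "z \<otimes>\<^bsub>?G\<^esub> x \<otimes>\<^bsub>?G\<^esub> inv\<^bsub>?G\<^esub> z = x"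
      using x by (simp add: conj_map_apply)
    then show ?thesis
      using x z by (metis G.inv_solve_right G.m_closed)
  qed
  then have "z (x a) = x (z a)" if "x \<in> carrier ?G" for x a
    using that by (metis Aut_mult comp_apply)
  then have "z = id"
    by (rule central_automorphism_trivial[OF two z])
  then have "inv\<^bsub>?G\<^esub> gt \<tau> \<otimes>\<^bsub>?G\<^esub> r = \<one>\<^bsub>?G\<^esub>"
    by (simp add: z_def albert_Aut_def)
  then have "r = gt \<tau>"
    using r t by (metis G.inv_solve_left G.one_closed G.r_one)
  then have "h \<otimes>\<^bsub>?G\<^esub> gt \<sigma> = gt \<tau> \<otimes>\<^bsub>?G\<^esub> h"
    using h s t unfolding r_def by (metis G.inv_solve_right G.m_closed)
  then show ?thesis
    unfolding gt_conj_def using h by (metis Aut_mult comp_apply)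
qed

text \<open>The map is not the identity, because \<open>gt\<close> does not commute with
  conjugation by a unipotent matrix.\<close>

lemma I_gt_in_gt_involutions:
  fixes \<tau> :: "'k::field \<times> 'k \<times> 'k \<times> 'k"
  assumes \<tau>: "\<tau> \<in> torus_params"
  shows "I_gt \<tau> \<in> gt_involutions"
proof -
  let ?G = "albert_Aut :: ('k albert \<Rightarrow> _) monoid"
  interpret G: group ?G by (rule group_albert_Aut)
  obtain u1 u2 v1 v2 where \<tau>_eq: "\<tau> = (u1, u2, v1, v2)"
    and nz: "u1 \<noteq> 0" "u2 \<noteq> 0" "v1 \<noteq> 0" "v2 \<noteq> 0"
    using \<tau> by (auto simp: torus_params_def)
  define T where "T = (vector [vector [1, 1, 0], vector [0, 1, 0], vector [0, 0, 1]] :: 'k^3^3)"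
  define T' where "T' = (vector [vector [1, - 1, 0], vector [0, 1, 0], vector [0, 0, 1]] :: 'k^3^3)"
  define x where "x = tits_aut T T' (mat 1) (mat 1)"
  have x: "x \<in> carrier ?G"
    unfolding x_def by (intro tits_aut_in_Aut) (simp_all add: T_def T'_def mat3_simps det_3)
  have "fst (gt \<tau> (x (matrix_unit 1 1, 0, 0))) $ 1 $ 2 \<noteq> fst (x (gt \<tau> (matrix_unit 1 1, 0,
      0))) $ 1 $ 2"
    using nz unfolding \<tau>_eq gt_eq[OF nz]
    by (simp add: x_def tits_swap_def tits_aut_def T_def T'_def torus_mat_def matrix_unit_def mat3_simps)
  then have "gt \<tau> \<otimes>\<^bsub>?G\<^esub> x \<noteq> x \<otimes>\<^bsub>?G\<^esub> gt \<tau>"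
    by (metis Aut_mult comp_apply)
  moreover have "gt \<tau> \<otimes>\<^bsub>?G\<^esub> gt \<tau> = \<one>\<^bsub>?G\<^esub>"
    by (auto simp: albert_Aut_def fun_eq_iff gt_gt[OF \<tau>] simp del: split_paired_All)
  ultimately have "is_involution ?G (I_gt \<tau>)"
    by (intro G.is_involution_conj_map[OF gt_in_Aut[OF \<tau>] _ x])
  then show ?thesis
    using \<tau> by (auto simp: gt_involutions_def)
qed

lemma class_representativesI:
  fixes T :: "('k::field \<times> 'k \<times> 'k \<times> 'k) set"
  assumes two: "(2::'k) \<noteq> 0" and T: "T \<subseteq> torus_params"
    and ex: "\<And>\<tau>. \<tau> \<in> torus_params \<Longrightarrow> \<exists>\<sigma>\<in>T. gt_conj
        \<sigma> \<tau>"
    and unique: "\<And>\<sigma> \<sigma>'. \<sigma> \<in> T \<Longrightarrow> \<sigma>' \<in> T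
        \<Longrightarrow> gt_conj \<sigma> \<sigma>' \<Longrightarrow> \<sigma> = \<sigma>'"
  shows "class_representatives T"
  unfolding class_representatives_def
proof (intro conjI ballI)
  show "I_gt \<tau> \<in> gt_involutions" if "\<tau> \<in> T" for \<tau>
    using that T I_gt_in_gt_involutions by blast
  fix \<phi> :: "('k albert \<Rightarrow> 'k albert) \<Rightarrow> ('k albert \<Rightarrow> 'k albert)"
  assume "\<phi> \<in> gt_involutions"
  then obtain \<tau> where \<tau>: "\<tau> \<in> torus_params" and \<phi>: "\<phi> = I_gt \<tau>"
    by (auto simp: gt_involutions_def)
  have iff: "gt_isomorphic \<sigma> \<tau> \<longleftrightarrow> gt_conj \<sigma> \<tau>" if "\<sigma> \<in> T"
      for \<sigma>
    using that T \<tau> isomorphic_of_gt_conj gt_conj_of_isomorphic[OF two] by blast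
  obtain \<sigma> where \<sigma>: "\<sigma> \<in> T" "gt_conj \<sigma> \<tau>"
    using ex[OF \<tau>] by blast
  show "\<exists>!\<sigma>. \<sigma> \<in> T \<and> isomorphic_involutions albert_Aut (I_gt \<sigma>) \<phi>"
  proof
    show "\<sigma> \<in> T \<and> isomorphic_involutions albert_Aut (I_gt \<sigma>) \<phi>"
      using \<sigma> iff \<phi> by blast
    show "\<sigma>' = \<sigma>" if "\<sigma>' \<in> T \<and> isomorphic_involutions albert_Aut (I_gt \<sigma>')
        \<phi>" for \<sigma>'
      using that \<sigma> iff unique gt_conj_trans gt_conj_sym unfolding \<phi> by blast
  qed
qed

section \<open>Octonions, Hermitian matrices and square-zero planes\<close>

lemmas oct_simps = vec_eq_iff forall_2 matrix_matrix_mult_def sum_2 mat_scale_def map_matrix_def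
  adjugate_2 det_2 mat_def oct_mult_def oct_conj_def oct_scale_def oct_one_def oct_norm_def oct_bilin_def

lemma oct_norm_mult: "oct_norm (oct_mult x y) = oct_norm x * oct_norm y"
  by (cases x; cases y) (simp add: oct_simps algebra_simps)

lemma oct_norm_scale: "oct_norm (oct_scale c x) = c\<^sup>2 * oct_norm x"
  by (cases x) (simp add: oct_simps power2_eq_square algebra_simps)

lemma oct_norm_one: "oct_norm oct_one = 1"
  by (simp add: oct_simps)

lemma oct_norm_zero: "oct_norm 0 = 0"
  by (simp add: oct_simps zero_prod_def)

lemma oct_norm_conj: "oct_norm (oct_conj x) = oct_norm x"
  by (cases x) (simp add: oct_simps algebra_simps)

lemma oct_conj_conj: "oct_conj (oct_conj x) = x"
  by (cases x) (simp add: oct_simps)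

lemma oct_conj_mult: "oct_conj (oct_mult x y) = oct_mult (oct_conj y) (oct_conj x)"
  by (cases x; cases y) (simp add: oct_simps algebra_simps)

lemma oct_mult_conj: "oct_mult x (oct_conj x) = oct_scale (oct_norm x) oct_one"
  "oct_mult (oct_conj x) x = oct_scale (oct_norm x) oct_one"
  by (cases x; simp add: oct_simps algebra_simps)+

lemma oct_conj_mult_mult: "oct_mult (oct_conj x) (oct_mult x y) = oct_scale (oct_norm x) y"
  by (cases x; cases y) (simp add: oct_simps algebra_simps)

lemma oct_mult_mult_conj: "oct_mult (oct_mult x y) (oct_conj y) = oct_scale (oct_norm y) x"
  by (cases x; cases y) (simp add: oct_simps algebra_simps)

lemma oct_mult_scale: "oct_mult (oct_scale c x) y = oct_scale c (oct_mult x y)"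
  "oct_mult x (oct_scale c y) = oct_scale c (oct_mult x y)"
  by (cases x; cases y; simp add: oct_simps algebra_simps)+

lemma oct_mult_one: "oct_mult oct_one x = x" "oct_mult x oct_one = x"
  by (cases x; simp add: oct_simps)+

lemma oct_mult_zero: "oct_mult 0 x = 0" "oct_mult x 0 = 0"
  by (cases x; simp add: oct_simps zero_prod_def)+

lemma oct_scale_scale: "oct_scale c (oct_scale d x) = oct_scale (c * d) x"
  by (cases x) (simp add: oct_simps algebra_simps)

lemma oct_scale_zero: "oct_scale 0 x = 0" "oct_scale c 0 = 0"
  by (cases x; simp add: oct_simps zero_prod_def)+

lemma oct_scale_one: "oct_scale 1 x = x"
  by (cases x) (simp add: oct_simps)

lemma oct_scale_add: "oct_scale c (x + y) = oct_scale c x + oct_scale c y"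
  "oct_scale (c + d) x = oct_scale c x + oct_scale d x"
  by (cases x; cases y; simp add: oct_simps algebra_simps)+

lemma oct_scale_eq_zero: "oct_scale c x = 0 \<longleftrightarrow> c = 0 \<or> x = 0"
  by (cases x) (auto simp: oct_simps zero_prod_def)

lemma oct_conj_scale: "oct_conj (oct_scale c x) = oct_scale c (oct_conj x)"
  by (cases x) (simp add: oct_simps algebra_simps)

lemma oct_conj_add: "oct_conj (x + y) = oct_conj x + oct_conj y"
  by (cases x; cases y) (simp add: oct_simps)

lemma oct_conj_zero: "oct_conj 0 = 0"
  by (simp add: oct_simps zero_prod_def)

lemma oct_conj_eq: "oct_conj x = oct_scale (oct_bilin x oct_one) oct_one + oct_scale (- 1) x"
  by (cases x) (simp add: oct_simps algebra_simps)

lemma oct_scale_one_eq: "oct_scale c oct_one = oct_scale d oct_one \<longleftrightarrow> c = d"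
  by (simp add: oct_simps)

lemma quaternion_subalgebra_closed:
  assumes "quaternion_subalgebra D"
  shows "0 \<in> D" "oct_one \<in> D" "x \<in> D \<Longrightarrow> y \<in> D \<Longrightarrow> x + y \<in> D"
      "x \<in> D \<Longrightarrow> oct_scale c x \<in> D"
    "x \<in> D \<Longrightarrow> oct_conj x \<in> D"
proof -
  interpret vector_space oct_scale by (rule vector_space_oct)
  have D: "subspace D" "oct_one \<in> D" using assms by (simp_all add: quaternion_subalgebra_def)
  show "0 \<in> D" "oct_one \<in> D" "x \<in> D \<Longrightarrow> y \<in> D \<Longrightarrow> x + y \<in> D" "x
      \<in> D \<Longrightarrow> oct_scale c x \<in> D"
    using D by (auto intro: subspace_0 subspace_add subspace_scale)
  show "x \<in> D \<Longrightarrow> oct_conj x \<in> D"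
    unfolding oct_conj_eq[of x] using D by (intro subspace_add subspace_scale)
qed

text \<open>If \<open>x y = 0\<close>, then multiplying by conjugates gives \<open>N(x) y =
  0\<close> and \<open>N(y) x = 0\<close>.\<close>

lemma split_subalgebra_null_pair:
  assumes "split_subalgebra D" "quaternion_subalgebra D"
  obtains x y where "x \<in> D" "y \<in> D" "x \<noteq> 0" "y \<noteq> 0" "oct_norm x = 0" "oct_norm y = 0"
    "oct_mult (oct_conj x) y = 0"
proof -
  obtain x y where xy: "x \<in> D" "y \<in> D" "x \<noteq> 0" "y \<noteq> 0" "oct_mult x y = 0"
    using assms by (auto simp: split_subalgebra_def)
  have "oct_norm x = 0" "oct_norm y = 0"
    using oct_conj_mult_mult[of x y] oct_mult_mult_conj[of x y] xy
    by (auto simp: oct_mult_zero oct_scale_eq_zero dest: sym)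
  then show thesis
    using that[of "oct_conj x" y] xy quaternion_subalgebra_closed[OF assms(2)]
    by (metis oct_conj_conj oct_norm_conj oct_conj_zero)
qed

lemma division_subalgebra_anisotropic:
  assumes "division_subalgebra D" "x \<in> D" "oct_norm x = 0"
  shows "x = 0"
proof (rule ccontr)
  assume "x \<noteq> 0"
  then obtain y where "oct_mult x y = oct_one"
    using assms by (auto simp: division_subalgebra_def)
  then show False
    using oct_norm_mult[of x y] assms(3) by (simp add: oct_norm_one)
qed

text \<open>The operations are parameters because the notion is used for subspaces of the Albert
  algebra and for spaces of Hermitian matrices.\<close>

definition square_zero_plane :: "('k::field \<Rightarrow> 'a \<Rightarrow> 'a) \<Rightarrow> ('a \<Rightarrow>
    'a \<Rightarrow> 'a) \<Rightarrow> 'a::ab_group_add set \<Rightarrow> bool" where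
  "square_zero_plane sc ml S \<longleftrightarrow> (\<exists>a\<in>S. \<exists>b\<in>S. \<forall>s t.
     (s \<noteq> 0 \<or> t \<noteq> 0 \<longrightarrow> sc s a + sc t b \<noteq> 0) \<and> ml (sc s a + sc t b)
         (sc s a + sc t b) = 0)"

lemma square_zero_plane_transfer:
  fixes sc :: "'k::field \<Rightarrow> 'a::ab_group_add \<Rightarrow> 'a" and sc' :: "'k \<Rightarrow>
      'b::ab_group_add \<Rightarrow> 'b"
  assumes f: "bij_betw f S S'"
    and S: "0 \<in> S" "\<And>a b. a \<in> S \<Longrightarrow> b \<in> S \<Longrightarrow> a + b \<in> S"
        "\<And>c a. a \<in> S \<Longrightarrow> sc c a \<in> S"
      "\<And>a b. a \<in> S \<Longrightarrow> b \<in> S \<Longrightarrow> ml a b \<in> S"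
    and add: "\<And>a b. a \<in> S \<Longrightarrow> b \<in> S \<Longrightarrow> f (a + b) = f a + f b"
    and scale: "\<And>c a. a \<in> S \<Longrightarrow> f (sc c a) = sc' c (f a)"
    and mult: "\<And>a b. a \<in> S \<Longrightarrow> b \<in> S \<Longrightarrow> f (ml a b) = ml' (f a) (f b)"
  shows "square_zero_plane sc ml S \<longleftrightarrow> square_zero_plane sc' ml' S'"
proof -
  have "f 0 + f 0 = f 0" using add[OF S(1,1)] by simp
  then have f0: "f 0 = 0" by simp
  have zero: "f a = 0 \<longleftrightarrow> a = 0" if "a \<in> S" for a
    using f f0 S(1) that by (metis bij_betw_def inj_on_def)
  have image: "S' = f ` S"
    using f by (simp add: bij_betw_def)
  have "(\<forall>s t. (s \<noteq> 0 \<or> t \<noteq> 0 \<longrightarrow> sc s a + sc t b \<noteq> 0) \<and> ml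
      (sc s a + sc t b) (sc s a + sc t b) = 0) \<longleftrightarrow>
      (\<forall>s t. (s \<noteq> 0 \<or> t \<noteq> 0 \<longrightarrow> sc' s (f a) + sc' t (f b) \<noteq> 0)
          \<and>
        ml' (sc' s (f a) + sc' t (f b)) (sc' s (f a) + sc' t (f b)) = 0)"
    if ab: "a \<in> S" "b \<in> S" for a b
  proof -
    have "sc s a + sc t b \<in> S" "f (sc s a + sc t b) = sc' s (f a) + sc' t (f b)" for s t
      using ab S by (auto simp: add scale)
    then show ?thesis
      using zero S(4) mult by metis
  qed
  then show ?thesis
    unfolding square_zero_plane_def image by simp
qed

lemma H3_mult_self:
  fixes X :: "'k::field octonion^3^3"
  assumes "(2::'k) \<noteq> 0"
  shows "H3_mult X X = oct_mat_mult X X"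
proof -
  have "oct_scale (1 / 2) (x + x) = x" for x :: "'k octonion"
    using assms by (simp add: oct_scale_add(1) oct_scale_add(2)[symmetric] oct_scale_one)
  then show ?thesis
    by (simp add: H3_mult_def oct_mat_scale_def map_matrix_def vec_eq_iff)
qed

text \<open>The matrices with entries \<open>s x\<close> and \<open>t y\<close> at the positions
  \<open>(1, 2)\<close> and \<open>(1, 3)\<close>: all entries of their squares are multiples of
  \<open>N(x)\<close>, \<open>N(y)\<close>, of the product of the conjugate of \<open>x\<close>
  with \<open>y\<close>, or of its conjugate.\<close>

lemma H3_split_plane:
  fixes D :: "'k::field octonion set"
  assumes two: "(2::'k) \<noteq> 0" and D: "quaternion_subalgebra D" "split_subalgebra D" and \<gamma>:
      "\<And>i. \<gamma> $ i \<noteq> 0"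
  shows "square_zero_plane oct_mat_scale H3_mult (H3 D \<gamma>)"
proof -
  obtain x y where xy: "x \<in> D" "y \<in> D" "x \<noteq> 0" "y \<noteq> 0" "oct_norm x = 0" "oct_norm y = 0"
    "oct_mult (oct_conj x) y = 0"
    using split_subalgebra_null_pair[OF D(2,1)] by metis
  have yx: "oct_mult (oct_conj y) x = 0"
    using oct_conj_mult[of "oct_conj x" y] xy(7) by (simp add: oct_conj_conj oct_conj_zero)
  define X where "X s t = (vector [vector [0, oct_scale s x, oct_scale t y],
    vector [oct_scale (s * (inverse (\<gamma>$2) * \<gamma>$1)) (oct_conj x), 0, 0],
    vector [oct_scale (t * (inverse (\<gamma>$3) * \<gamma>$1)) (oct_conj y), 0, 0]] :: 'k octonion^3^3)" for s
        t
  have lin: "oct_mat_scale s (X 1 0) + oct_mat_scale t (X 0 1) = X s t" for s t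
    by (simp add: X_def oct_mat_scale_def map_matrix_def vec_eq_iff forall_3 oct_scale_scale
        oct_scale_zero oct_scale_one)
  have sq: "oct_mat_mult (X s t) (X s t) = 0" for s t
    by (simp add: X_def oct_mat_mult_def vec_eq_iff forall_3 sum_3 oct_mult_zero oct_mult_scale
        oct_mult_conj xy yx oct_scale_zero oct_scale_scale)
  have cancel: "inverse (\<gamma>$1) * \<gamma>$2 * (s * (inverse (\<gamma>$2) * \<gamma>$1)) = s"
    "inverse (\<gamma>$1) * \<gamma>$3 * (s * (inverse (\<gamma>$3) * \<gamma>$1)) = s"
    "inverse (\<gamma>$2) * \<gamma>$1 * s = s * (inverse (\<gamma>$2) * \<gamma>$1)"
    "inverse (\<gamma>$3) * \<gamma>$1 * s = s * (inverse (\<gamma>$3) * \<gamma>$1)" for s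
    using \<gamma>[of 1] \<gamma>[of 2] \<gamma>[of 3] by (simp_all add: field_simps)
  have mem: "X s t \<in> H3 D \<gamma>" for s t
    using xy(1,2) quaternion_subalgebra_closed[OF D(1)]
    by (auto simp: H3_def X_def forall_3 oct_conj_zero oct_conj_scale oct_conj_conj oct_scale_scale
        oct_scale_zero oct_scale_one cancel intro!: exI[of _ 0])
  have nz: "X s t \<noteq> 0" if "s \<noteq> 0 \<or> t \<noteq> 0" for s t
    using that xy(3,4) by (auto simp: X_def vec_eq_iff forall_3 oct_scale_eq_zero)
  show ?thesis
    unfolding square_zero_plane_def
    using mem nz by (intro bexI[of _ "X 1 0"] bexI[of _ "X 0 1"]) (auto simp: lin H3_mult_self[OF two] sq)
qed

lemma H3_scale_add_closed:
  assumes D: "quaternion_subalgebra D" and X: "X \<in> H3 D \<gamma>" "Y \<in> H3 D \<gamma>"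
  shows "oct_mat_scale s X + oct_mat_scale t Y \<in> H3 D \<gamma>"
proof -
  have "\<exists>c. oct_scale s (X $ i $ i) + oct_scale t (Y $ i $ i) = oct_scale c oct_one" for i
  proof -
    obtain c d where "X $ i $ i = oct_scale c oct_one" "Y $ i $ i = oct_scale d oct_one"
      using X by (force simp: H3_def)
    then show ?thesis
      by (intro exI[of _ "s * c + t * d"]) (simp add: oct_scale_scale oct_scale_add)
  qed
  moreover have "oct_scale (inverse (\<gamma> $ i) * \<gamma> $ j) (oct_conj (oct_scale s (X $ j $ i) +
      oct_scale t (Y $ j $ i)))
      = oct_scale s (X $ i $ j) + oct_scale t (Y $ i $ j)" for i j
  proof -
    have "X $ i $ j = oct_scale (inverse (\<gamma> $ i) * \<gamma> $ j) (oct_conj (X $ j $ i))"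
      "Y $ i $ j = oct_scale (inverse (\<gamma> $ i) * \<gamma> $ j) (oct_conj (Y $ j $ i))"
      using X by (simp_all add: H3_def)
    then show ?thesis
      by (simp add: oct_conj_add oct_conj_scale oct_scale_add oct_scale_scale mult.commute)
  qed
  ultimately show ?thesis
    using X quaternion_subalgebra_closed[OF D]
    by (simp add: H3_def oct_mat_scale_def map_matrix_def)
qed

text \<open>Let \<open>p_ab\<close> be the scalar \<open>x_ab x_ba\<close>, a nonzero multiple of
  the norm of \<open>x_ab\<close>. If \<open>x_ii = 0\<close>, the diagonal of the square yields
  \<open>p_ij = - p_ik\<close> and \<open>\<alpha>_j^2 = - p_ij - p_jk\<close>, and the norm of
  its \<open>(i, j)\<close> entry yields \<open>\<alpha>_j^2 p_ij = p_ik p_jk\<close>. Together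
  these give \<open>p_ij^2 = 0\<close>, and the norm is anisotropic.\<close>

lemma H3_division_square_zero:
  fixes D :: "'k::field octonion set"
  assumes D: "division_subalgebra D" and \<gamma>: "\<And>i. \<gamma> $ i \<noteq> 0"
    and X: "X \<in> H3 D \<gamma>" "oct_mat_mult X X = 0"
    and ijk: "i \<noteq> j" "i \<noteq> k" "j \<noteq> k" and Xii: "X $ i $ i = 0"
  shows "X $ i $ j = 0 \<and> X $ i $ k = 0 \<and> X $ j $ i = 0 \<and> X $ k $ i = 0 \<and>
    (X \<noteq> 0 \<longrightarrow> X $ j $ k \<noteq> 0)"
proof -
  have U: "(UNIV :: 3 set) = {i, j, k}"
  proof -
    have "card {i, j, k} = 3" using ijk by simp
    then have "card {i, j, k} = card (UNIV :: 3 set)" by simp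
    then show ?thesis by (metis card_subset_eq finite subset_UNIV)
  qed
  have sum: "(\<Sum>l\<in>UNIV. f l) = f i + f j + f k" for f :: "3 \<Rightarrow> 'k octonion"
    unfolding U using ijk by (simp add: add.assoc)
  have herm: "X $ b $ a = oct_scale (inverse (\<gamma> $ b) * \<gamma> $ a) (oct_conj (X $ a $ b))" for a b
    using X(1) by (simp add: H3_def)
  obtain \<alpha> where \<alpha>: "X $ a $ a = oct_scale (\<alpha> a) oct_one" for a
    using X(1) by (auto simp: H3_def) metis
  have \<alpha>i: "\<alpha> i = 0"
    using Xii \<alpha>[of i] oct_norm_scale[of "\<alpha> i" oct_one] by (simp add: oct_norm_one oct_norm_zero)
  define p where "p a b = inverse (\<gamma> $ b) * \<gamma> $ a * oct_norm (X $ a $ b)" for a b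
  have prod: "oct_mult (X $ a $ b) (X $ b $ a) = oct_scale (p a b) oct_one" for a b
    by (subst herm) (simp add: oct_mult_scale oct_mult_conj oct_scale_scale p_def)
  have p_sym: "p b a = p a b" for a b
    using \<gamma>[of a] \<gamma>[of b]
    by (simp add: p_def herm[of b a] oct_norm_scale oct_norm_conj power2_eq_square field_simps)
  have p_zero: "p a b = 0 \<longleftrightarrow> X $ a $ b = 0" for a b
    using \<gamma>[of a] \<gamma>[of b] division_subalgebra_anisotropic[OF D, of "X $ a $ b"] X(1)
    by (auto simp: p_def H3_def oct_norm_zero)
  have sq: "(\<Sum>l\<in>UNIV. oct_mult (X $ a $ l) (X $ l $ b)) = 0" for a b
    using X(2) by (simp add: oct_mat_mult_def vec_eq_iff)
  have diag_a: "oct_mult (X $ a $ a) (X $ a $ a) = oct_scale ((\<alpha> a)\<^sup>2) oct_one" for a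
    by (simp add: \<alpha> oct_mult_scale oct_mult_one oct_scale_scale power2_eq_square)
  have "oct_scale ((\<alpha> i)\<^sup>2 + p i j + p i k) oct_one = oct_scale 0 oct_one"
    using sq[of i i] unfolding sum by (simp add: prod[of i j] prod[of i k] diag_a oct_scale_add oct_scale_zero)
  then have e1: "p i j + p i k = 0"
    unfolding oct_scale_one_eq by (simp add: \<alpha>i)
  have "oct_scale (p j i + (\<alpha> j)\<^sup>2 + p j k) oct_one = oct_scale 0 oct_one"
    using sq[of j j] unfolding sum by (simp add: prod[of j i] prod[of j k] diag_a oct_scale_add oct_scale_zero)
  then have e2: "p i j + (\<alpha> j)\<^sup>2 + p j k = 0"
    unfolding oct_scale_one_eq by (simp add: p_sym[of i j])
  have "oct_scale (p k i + p k j + (\<alpha> k)\<^sup>2) oct_one = oct_scale 0 oct_one"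
    using sq[of k k] unfolding sum by (simp add: prod[of k i] prod[of k j] diag_a oct_scale_add oct_scale_zero)
  then have e3: "p i k + p j k + (\<alpha> k)\<^sup>2 = 0"
    unfolding oct_scale_one_eq by (simp add: p_sym[of i k] p_sym[of j k])
  have "oct_scale (\<alpha> j) (X $ i $ j) + oct_mult (X $ i $ k) (X $ k $ j) = 0"
    using sq[of i j] unfolding sum Xii by (simp add: \<alpha> oct_mult_scale oct_mult_one oct_mult_zero)
  then have "oct_mult (X $ i $ k) (X $ k $ j) = oct_scale (- 1) (oct_scale (\<alpha> j) (X $ i $ j))"
    by (cases "X $ i $ j"; cases "oct_mult (X $ i $ k) (X $ k $ j)")
      (simp add: oct_simps zero_prod_def eq_neg_iff_add_eq_0 add.commute)
  then have "oct_norm (X $ i $ k) * oct_norm (X $ k $ j) = (\<alpha> j)\<^sup>2 * oct_norm (X $ i $ j)"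
    using oct_norm_mult[of "X $ i $ k" "X $ k $ j"] by (simp add: oct_norm_scale)
  then have "(\<alpha> j)\<^sup>2 * p i j = p i k * p k j"
    using \<gamma>[of i] \<gamma>[of j] \<gamma>[of k] by (simp add: p_def field_simps)
  then have "(\<alpha> j)\<^sup>2 * p i j = p i k * p j k"
    by (simp add: p_sym[of j k])
  moreover have pik: "p i k = - p i j" "p j k = - (p i j + (\<alpha> j)\<^sup>2)"
    by (rule minus_unique[OF e1, symmetric], rule minus_unique[OF e2, symmetric])
  ultimately have "p i j * p i j = 0"
    by (simp add: algebra_simps)
  then have pij: "p i j = 0" by simp
  then have "p i k = 0" using e1 by simp
  have "X = 0" if "X $ j $ k = 0"
  proof -
    have "p j k = 0" using that p_zero by simp
    then have "\<alpha> j = 0" "\<alpha> k = 0"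
      using e2 e3 pij \<open>p i k = 0\<close> by auto
    then have "X $ a $ b = 0" for a b
    proof -
      have "a \<in> {i, j, k}" "b \<in> {i, j, k}" using U by auto
      then have "a = b \<or> p a b = 0"
        using pij \<open>p i k = 0\<close> \<open>p j k = 0\<close> p_sym[of i j] p_sym[of i k] p_sym[of j k]
            by auto
      then show ?thesis
        using p_zero[of a b] \<alpha>[of a] \<open>a \<in> {i, j, k}\<close> \<alpha>i \<open>\<alpha> j =
            0\<close> \<open>\<alpha> k = 0\<close>
        by (auto simp: oct_scale_zero)
    qed
    then show ?thesis by (simp add: vec_eq_iff)
  qed
  moreover have "X $ i $ j = 0" "X $ i $ k = 0" "X $ j $ i = 0" "X $ k $ i = 0"
    using pij \<open>p i k = 0\<close> p_sym[of i j] p_sym[of i k] by (simp_all flip: p_zero)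
  ultimately show ?thesis
    by blast
qed

text \<open>Suppose there is such a plane. It contains nonzero elements with vanishing \<open>(1,
  1)\<close> and with vanishing \<open>(2, 2)\<close> entry. By the previous lemma the entries of
  their sum at \<open>(1, 3)\<close> and \<open>(2, 3)\<close> are not zero, while the one at
  \<open>(1, 2)\<close> is. Then the \<open>(1, 2)\<close> entry of the square of the sum is a
  product of two nonzero elements of \<open>D\<close>.\<close>

lemma H3_division_no_plane:
  fixes D :: "'k::field octonion set"
  assumes two: "(2::'k) \<noteq> 0" and D: "quaternion_subalgebra D" "division_subalgebra D" and \<gamma>:
      "\<And>i. \<gamma> $ i \<noteq> 0"
  shows "\<not> square_zero_plane oct_mat_scale H3_mult (H3 D \<gamma>)"
proof
  assume "square_zero_plane oct_mat_scale H3_mult (H3 D \<gamma>)"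
  then obtain A B where AB: "A \<in> H3 D \<gamma>" "B \<in> H3 D \<gamma>"
    and nz: "\<And>s t. s \<noteq> 0 \<or> t \<noteq> 0 \<Longrightarrow> oct_mat_scale s A + oct_mat_scale t B
        \<noteq> 0"
    and sq: "\<And>s t. H3_mult (oct_mat_scale s A + oct_mat_scale t B) (oct_mat_scale s A + oct_mat_scale t B)
        = 0"
    unfolding square_zero_plane_def by blast
  define X where "X s t = oct_mat_scale s A + oct_mat_scale t B" for s t
  have X_mem: "X s t \<in> H3 D \<gamma>" and X_sq: "oct_mat_mult (X s t) (X s t) = 0" for s t
    using sq H3_scale_add_closed[OF D(1) AB] by (simp_all add: X_def H3_mult_self[OF two])
  have X_add: "X s t + X s' t' = X (s + s') (t + t')" for s t s' t'
    by (simp add: X_def oct_mat_scale_def map_matrix_def vec_eq_iff oct_scale_add)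
  have kill: "\<exists>s t. X s t \<noteq> 0 \<and> X s t $ i $ i = 0" for i
  proof -
    obtain c d where cd: "A $ i $ i = oct_scale c oct_one" "B $ i $ i = oct_scale d oct_one"
      using AB by (force simp: H3_def)
    show ?thesis
    proof (cases "c = 0 \<and> d = 0")
      case True
      then show ?thesis
        using nz[of 1 0] by (intro exI[of _ 1] exI[of _ 0])
          (simp add: X_def cd oct_mat_scale_def map_matrix_def oct_scale_zero)
    next
      case False
      have "X d (- c) $ i $ i = oct_scale (d * c + - c * d) oct_one"
        by (simp only: oct_scale_add(2) oct_scale_scale[symmetric] cd[symmetric])
          (simp add: X_def oct_mat_scale_def map_matrix_def)
      then have "X d (- c) $ i $ i = 0"
        by (simp add: mult.commute oct_scale_zero)
      moreover have "X d (- c) \<noteq> 0"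
        using nz[of d "- c"] False unfolding X_def by auto
      ultimately show ?thesis by blast
    qed
  qed
  obtain s t where a: "X s t \<noteq> 0" "X s t $ 1 $ 1 = 0" using kill by blast
  obtain s' t' where b: "X s' t' \<noteq> 0" "X s' t' $ 2 $ 2 = 0" using kill by blast
  define C where "C = X (s + s') (t + t')"
  note a' = H3_division_square_zero[OF D(2) \<gamma> X_mem X_sq, of 1 2 3, OF _ _ _ a(2)]
  note b' = H3_division_square_zero[OF D(2) \<gamma> X_mem X_sq, of 2 1 3, OF _ _ _ b(2)]
  have a0: "X s t $ 1 $ 2 = 0" "X s t $ 1 $ 3 = 0" "X s t $ 2 $ 3 \<noteq> 0"
    using a' a(1) by simp_all
  have b0: "X s' t' $ 1 $ 2 = 0" "X s' t' $ 2 $ 3 = 0" "X s' t' $ 1 $ 3 \<noteq> 0"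
    using b' b(1) by simp_all
  have C: "C $ 1 $ 2 = 0" "C $ 1 $ 3 \<noteq> 0" "C $ 2 $ 3 \<noteq> 0" "C \<in> H3 D \<gamma>" "oct_mat_mult C
      C = 0"
    using a0 b0 X_mem X_sq unfolding C_def X_add[symmetric] by simp_all (metis X_add)+
  have "(\<Sum>l\<in>UNIV. oct_mult (C $ 1 $ l) (C $ l $ 2)) = 0"
    using C(5) by (simp add: oct_mat_mult_def vec_eq_iff)
  then have "oct_mult (C $ 1 $ 3) (C $ 3 $ 2) = 0"
    by (simp add: sum_3 C(1) oct_mult_zero)
  then have "oct_norm (C $ 1 $ 3) * oct_norm (C $ 3 $ 2) = 0"
    using oct_norm_mult[of "C $ 1 $ 3" "C $ 3 $ 2"] by (simp add: oct_norm_zero)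
  moreover have "C $ 3 $ 2 \<noteq> 0"
  proof
    assume "C $ 3 $ 2 = 0"
    moreover have "C $ 2 $ 3 = oct_scale (inverse (\<gamma> $ 2) * \<gamma> $ 3) (oct_conj (C $ 3 $ 2))"
      using C(4) by (simp add: H3_def)
    ultimately show False
      using C(3) by (simp add: oct_conj_zero oct_scale_zero)
  qed
  moreover have "C $ 1 $ 3 \<in> D" "C $ 3 $ 2 \<in> D"
    using C(4) by (simp_all add: H3_def)
  ultimately show False
    using division_subalgebra_anisotropic[OF D(2), of "C $ 1 $ 3"]
      division_subalgebra_anisotropic[OF D(2), of "C $ 3 $ 2"] C(2) by auto
qed

section \<open>The quaternion algebra of the pair (v1, v2)\<close>

text \<open>The octonion \<open>a + b e1 + c e2 + d e3\<close>, where \<open>e1\<close>,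
  \<open>e2\<close>, \<open>e3\<close> are pure and orthogonal with norms \<open>1 / w1\<close>,
  \<open>1 / w2\<close>, \<open>w1 w2\<close>, and \<open>e1 e2 = - e3 / (w1 w2)\<close>. With
  this choice of norms, rows of the second component of the Albert algebra are coordinates without
  further factors depending on \<open>V\<close>.\<close>

definition quat :: "'k::field \<Rightarrow> 'k \<Rightarrow> 'k \<Rightarrow> 'k \<Rightarrow> 'k \<Rightarrow>
    'k \<Rightarrow> 'k octonion" where
  "quat w1 w2 a b c d =
    (vector [vector [a, - b / w1], vector [b, a]], vector [vector [c, d * w2], vector [d * w1, - c / w2]])"

definition quat_algebra :: "'k::field \<Rightarrow> 'k \<Rightarrow> 'k octonion set" where
  "quat_algebra w1 w2 = {quat w1 w2 a b c d | a b c d. True}"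

lemma quat_mem: "quat w1 w2 a b c d \<in> quat_algebra w1 w2"
  by (auto simp: quat_algebra_def)

lemma quat_algebraE:
  assumes "x \<in> quat_algebra w1 w2"
  obtains a b c d where "x = quat w1 w2 a b c d"
  using assms by (auto simp: quat_algebra_def)

lemma quat_mult:
  assumes "w1 \<noteq> 0" "w2 \<noteq> 0"
  shows "oct_mult (quat w1 w2 a b c d) (quat w1 w2 a' b' c' d') =
    quat w1 w2 (a * a' - b * b' / w1 - c * c' / w2 - d * d' * w1 * w2)
      (a * b' + b * a' - w1 * (c * d' - d * c')) (a * c' + c * a' - w2 * (d * b' - b * d'))
      (a * d' + d * a' - (b * c' - c * b') / (w1 * w2))"
  using assms by (simp add: quat_def oct_simps) (simp add: field_simps)

lemma quat_add: "quat w1 w2 a b c d + quat w1 w2 a' b' c' d' = quat w1 w2 (a + a') (b + b') (c + c') (d + d')"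
  by (simp add: quat_def oct_simps algebra_simps add_divide_distrib diff_divide_distrib)

lemma quat_scale: "oct_scale t (quat w1 w2 a b c d) = quat w1 w2 (t * a) (t * b) (t * c) (t * d)"
  by (simp add: quat_def oct_simps algebra_simps)

lemma quat_conj: "oct_conj (quat w1 w2 a b c d) = quat w1 w2 a (- b) (- c) (- d)"
  by (simp add: quat_def oct_simps)

lemma quat_one: "oct_one = quat w1 w2 1 0 0 0"
  by (simp add: quat_def oct_simps)

lemma quat_zero: "0 = quat w1 w2 0 0 0 0"
  by (simp add: quat_def oct_simps zero_prod_def)

lemma quat_eq_iff: "quat w1 w2 a b c d = quat w1 w2 a' b' c' d' \<longleftrightarrow> a = a' \<and> b = b'
    \<and> c = c' \<and> d = d'"
  if "w1 \<noteq> 0"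
  using that by (auto simp: quat_def oct_simps)

lemma quat_norm:
  assumes "w1 \<noteq> 0" "w2 \<noteq> 0"
  shows "oct_norm (quat w1 w2 a b c d) = a\<^sup>2 + b\<^sup>2 / w1 + c\<^sup>2 / w2 + d\<^sup>2 * w1 * w2"
  using assms by (simp add: quat_def oct_simps power2_eq_square)

lemma quaternion_subalgebra_quat_algebra:
  fixes w1 w2 :: "'k::field"
  assumes two: "(2::'k) \<noteq> 0" and w: "w1 \<noteq> 0" "w2 \<noteq> 0"
  shows "quaternion_subalgebra (quat_algebra w1 w2)"
proof -
  interpret vector_space "oct_scale :: 'k \<Rightarrow> _" by (rule vector_space_oct)
  let ?D = "quat_algebra w1 w2" and ?q = "quat w1 w2"
  have sub: "subspace ?D"
    by (rule subspaceI)
      (auto elim!: quat_algebraE simp: quat_zero[of w1 w2] quat_add quat_scale intro: quat_mem)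
  let ?B = "{?q 1 0 0 0, ?q 0 1 0 0, ?q 0 0 1 0, ?q 0 0 0 1}"
  have span: "span ?B = ?D"
  proof
    show "span ?B \<subseteq> ?D"
      by (rule span_minimal[OF _ sub]) (auto simp: quat_algebra_def)
    show "?D \<subseteq> span ?B"
    proof
      fix x assume "x \<in> ?D"
      then obtain a b c d where "x = ?q a b c d" by (auto simp: quat_algebra_def)
      then have "x = oct_scale a (?q 1 0 0 0) + oct_scale b (?q 0 1 0 0) + oct_scale c (?q 0 0 1 0) + oct_scale
          d (?q 0 0 0 1)"
        by (simp add: quat_add quat_scale)
      then show "x \<in> span ?B"
        by (metis (no_types, lifting) insertI1 insertI2 span_add span_base span_scale)
    qed
  qed
  have "independent ?B"
  proof -
    have "\<forall>v\<in>?B. u v = 0" if "(\<Sum>v\<in>?B. oct_scale (u v) v) = 0" for u :: "'k octonion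
        \<Rightarrow> 'k"
    proof -
      have "(\<Sum>v\<in>?B. oct_scale (u v) v) = ?q (u (?q 1 0 0 0)) (u (?q 0 1 0 0)) (u (?q 0 0 1 0)) (u (?q
          0 0 0 1))"
        using w by (simp add: quat_eq_iff quat_scale quat_add)
      then show ?thesis
        using that w by (simp add: quat_zero[of w1 w2] quat_eq_iff)
    qed
    then show ?thesis
      by (subst dependent_finite) auto
  qed
  moreover have "card ?B = 4"
    using w by (simp add: quat_eq_iff)
  ultimately have dim: "dim ?D = 4"
    unfolding span[symmetric] dim_span by (simp add: dim_eq_card_independent)
  have one: "oct_one \<in> ?D"
    unfolding quat_algebra_def using quat_one[of w1 w2] by blast
  have mult: "oct_mult x y \<in> ?D" if "x \<in> ?D" "y \<in> ?D" for x y
    using that w by (auto elim!: quat_algebraE simp: quat_mult intro: quat_mem)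
  have "x = 0" if x: "x \<in> ?D" and orth: "\<forall>y\<in>?D. oct_bilin x y = 0" for x
  proof -
    obtain a b c d where xq: "x = ?q a b c d" using x by (auto simp: quat_algebra_def)
    have bil: "oct_bilin x (?q a' b' c' d') = 2 * (a * a' + b * b' / w1 + c * c' / w2 + d * d' * w1 * w2)" for
        a' b' c' d'
      using w by (simp add: xq oct_bilin_def quat_add quat_norm power2_eq_square) (simp add: field_simps)
    have "2 * (a * a' + b * b' / w1 + c * c' / w2 + d * d' * w1 * w2) = 0" for a' b' c' d'
      using orth quat_mem unfolding bil[symmetric] by blast
    from this[of 1 0 0 0] this[of 0 1 0 0] this[of 0 0 1 0] this[of 0 0 0 1]
    have "a = 0" "b = 0" "c = 0" "d = 0"
      using two w by simp_all
    then show ?thesis using quat_zero[of w1 w2] by (simp add: xq)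
  qed
  then show ?thesis
    unfolding quaternion_subalgebra_def using sub dim one mult by blast
qed

text \<open>With \<open>w1 = v1\<close> and \<open>w2 = v2 / v1\<close> the norm form is
  \<open>\<langle>1, v1, v2, v1 v2\<rangle>\<close> after scaling of the coordinates.\<close>

lemma quat_algebra_split_or_division:
  fixes v1 v2 :: "'k::field"
  assumes nz: "v1 \<noteq> 0" "v2 \<noteq> 0"
  shows "isotropic v1 v2 \<Longrightarrow> split_subalgebra (quat_algebra v1 (v2 / v1))"
    and "\<not> isotropic v1 v2 \<Longrightarrow> division_subalgebra (quat_algebra v1 (v2 / v1))"
proof -
  let ?D = "quat_algebra v1 (v2 / v1)" and ?q = "quat v1 (v2 / v1)"
  have w: "v1 \<noteq> 0" "v2 / v1 \<noteq> 0" using nz by simp_all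
  have norm: "oct_norm (?q a (v1 * b) (v2 * c) d) = a\<^sup>2 + v1 * b\<^sup>2 + v2 * d\<^sup>2 + v1 * v2 *
      c\<^sup>2" for a b c d
    using nz by (simp add: quat_norm[OF w] power2_eq_square)
  have conj_mem: "oct_conj x \<in> ?D" if "x \<in> ?D" for x
    using that by (auto elim!: quat_algebraE simp: quat_conj intro: quat_mem)
  have iso: "isotropic v1 v2 \<longleftrightarrow> (\<exists>x\<in>?D. x \<noteq> 0 \<and> oct_norm x = 0)"
  proof
    assume "isotropic v1 v2"
    then obtain x y z w where "x \<noteq> 0 \<or> y \<noteq> 0 \<or> z \<noteq> 0 \<or> w \<noteq> 0"
      "x\<^sup>2 + v1 * y\<^sup>2 + v2 * z\<^sup>2 + v1 * v2 * w\<^sup>2 = 0" by (auto simp: isotropic_def)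
    then have "?q x (v1 * y) (v2 * w) z \<noteq> 0" "oct_norm (?q x (v1 * y) (v2 * w) z) = 0"
      using nz by (auto simp: norm quat_zero[of v1 "v2 / v1"] quat_eq_iff)
    then show "\<exists>x\<in>?D. x \<noteq> 0 \<and> oct_norm x = 0"
      using quat_mem by blast
  next
    assume "\<exists>x\<in>?D. x \<noteq> 0 \<and> oct_norm x = 0"
    then obtain a b c d where "?q a b c d \<noteq> 0" "oct_norm (?q a b c d) = 0"
      by (auto simp: quat_algebra_def)
    then have "a \<noteq> 0 \<or> b / v1 \<noteq> 0 \<or> d \<noteq> 0 \<or> c / v2 \<noteq> 0"
      "a\<^sup>2 + v1 * (b / v1)\<^sup>2 + v2 * d\<^sup>2 + v1 * v2 * (c / v2)\<^sup>2 = 0"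
      using nz norm[of a "b / v1" "c / v2" d] by (auto simp: quat_zero[of v1 "v2 / v1"] quat_eq_iff)
    then show "isotropic v1 v2"
      unfolding isotropic_def by blast
  qed
  show "split_subalgebra ?D" if isotropic: "isotropic v1 v2"
  proof -
    obtain x where x: "x \<in> ?D" "x \<noteq> 0" "oct_norm x = 0"
      using iso[THEN iffD1, OF isotropic] by (elim bexE conjE)
    have "oct_mult x (oct_conj x) = 0"
      by (simp add: oct_mult_conj x oct_scale_zero)
    moreover have "oct_conj x \<noteq> 0"
      using x(2) oct_conj_conj[of x] oct_conj_zero by metis
    ultimately show ?thesis
      unfolding split_subalgebra_def by (intro bexI[OF _ x(1)] bexI[OF _ conj_mem[OF x(1)]] conjI x(2))
  qed
  show "division_subalgebra ?D" if "\<not> isotropic v1 v2"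
    unfolding division_subalgebra_def
  proof (intro ballI impI)
    fix x assume x: "x \<in> ?D" "x \<noteq> 0"
    then have n: "oct_norm x \<noteq> 0" using iffD2[OF iso] that by metis
    let ?y = "oct_scale (1 / oct_norm x) (oct_conj x)"
    have "?y \<in> ?D"
      using conj_mem[OF x(1)] by (auto elim!: quat_algebraE simp: quat_scale intro: quat_mem)
    then show "\<exists>y\<in>?D. oct_mult x y = oct_one \<and> oct_mult y x = oct_one"
      using n by (intro bexI[of _ ?y] conjI) (simp_all add: oct_mult_scale oct_mult_conj oct_scale_scale
          oct_scale_one)
  qed
qed

type_synonym 'k coords = "('k \<times> 'k \<times> 'k) \<times> ('k \<times> 'k \<times> 'k \<times> 'k)
    \<times> ('k \<times> 'k \<times> 'k \<times> 'k) \<times> ('k \<times> 'k \<times> 'k \<times> 'k)"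

text \<open>The fixed element with diagonal \<open>d1\<close>, \<open>d2\<close>,
  \<open>d3\<close> and with quaternions at the positions \<open>(1, 2)\<close>, \<open>(2,
  3)\<close>, \<open>(3, 1)\<close>. The scalar part of each is an entry of the first matrix; the
  pure parts are, up to the factors \<open>u1\<close>, \<open>u2\<close>, \<open>u3\<close>, the
  rows 3, 1, 2 of the second matrix.\<close>

definition fixed_elem :: "'k::field \<Rightarrow> 'k \<Rightarrow> 'k \<Rightarrow> 'k \<Rightarrow> 'k
    \<Rightarrow> 'k \<Rightarrow> 'k coords \<Rightarrow> 'k albert" where
  "fixed_elem u1 u2 u3 w1 w2 w3 = (\<lambda>((d1, d2, d3), (x1, b1, c1, e1), (x2, b2, c2, e2), (x3, b3, c3,
      e3)).
    (vector [vector [d1, x1, u3 / u1 * x3], vector [u1 / u2 * x1, d2, x2], vector [x3, u2 / u3 * x2, d3]],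
     vector [vector [u2 * b2, u2 * c2, u2 * e2], vector [u3 * b3, u3 * c3, u3 * e3], vector [u1 * b1, u1 * c1,
         u1 * e1]],
     vector [vector [u1 * u2 / w1 * b2, u2 * u3 / w1 * b3, u3 * u1 / w1 * b1],
             vector [u1 * u2 / w2 * c2, u2 * u3 / w2 * c3, u3 * u1 / w2 * c1],
             vector [u1 * u2 / w3 * e2, u2 * u3 / w3 * e3, u3 * u1 / w3 * e1]]))"

definition herm_elem :: "'k::field \<Rightarrow> 'k \<Rightarrow> 'k \<Rightarrow> 'k \<Rightarrow> 'k
    \<Rightarrow> 'k coords \<Rightarrow> 'k octonion^3^3" where
  "herm_elem u1 u2 u3 w1 w2 = (\<lambda>((d1, d2, d3), (x1, b1, c1, e1), (x2, b2, c2, e2), (x3, b3, c3, e3)).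
    vector [vector [quat w1 w2 d1 0 0 0, quat w1 w2 x1 b1 c1 e1, oct_scale (u3 / u1) (quat w1 w2 x3 (- b3) (-
        c3) (- e3))],
            vector [oct_scale (u1 / u2) (quat w1 w2 x1 (- b1) (- c1) (- e1)), quat w1 w2 d2 0 0 0, quat w1 w2
                x2 b2 c2 e2],
            vector [quat w1 w2 x3 b3 c3 e3, oct_scale (u2 / u3) (quat w1 w2 x2 (- b2) (- c2) (- e2)), quat w1
                w2 d3 0 0 0]])"

text \<open>The common formula for squares in both models. The local function \<open>N\<close> is
  the norm, and \<open>M\<close> computes \<open>t q + s r\<close> where \<open>r\<close> is the
  conjugate of the product of the two quaternions \<open>a' + b' e1 + c' e2 + e' e3\<close> and
  \<open>a'' + b'' e1 + c'' e2 + e'' e3\<close>.\<close>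

definition coords_square :: "'k::field \<Rightarrow> 'k \<Rightarrow> 'k \<Rightarrow> 'k \<Rightarrow> 'k
    \<Rightarrow> 'k coords \<Rightarrow> 'k coords" where
  "coords_square u1 u2 u3 w1 w2 = (\<lambda>((d1, d2, d3), (x1, b1, c1, e1), (x2, b2, c2, e2), (x3, b3, c3,
      e3)).
    let N = (\<lambda>x b c e. x\<^sup>2 + b\<^sup>2 / w1 + c\<^sup>2 / w2 + e\<^sup>2 * w1 * w2);
        n1 = u1 / u2 * N x1 b1 c1 e1; n2 = u2 / u3 * N x2 b2 c2 e2; n3 = u3 / u1 * N x3 b3 c3 e3;
        M = (\<lambda>t x b c e s a' b' c' e' a'' b'' c'' e''.
          (t * x + s * (a' * a'' - b' * b'' / w1 - c' * c'' / w2 - e' * e'' * w1 * w2),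
           t * b - s * (a' * b'' + b' * a'' - w1 * (c' * e'' - e' * c'')),
           t * c - s * (a' * c'' + c' * a'' - w2 * (e' * b'' - b' * e'')),
           t * e - s * (a' * e'' + e' * a'' - (b' * c'' - c' * b'') / (w1 * w2))))
    in ((d1\<^sup>2 + n1 + n3, d2\<^sup>2 + n1 + n2, d3\<^sup>2 + n2 + n3),
        M (d1 + d2) x1 b1 c1 e1 (u2 / u1) x2 b2 c2 e2 x3 b3 c3 e3,
        M (d2 + d3) x2 b2 c2 e2 (u3 / u2) x3 b3 c3 e3 x1 b1 c1 e1,
        M (d3 + d1) x3 b3 c3 e3 (u1 / u3) x1 b1 c1 e1 x2 b2 c2 e2))"

lemma herm_elem_square:
  fixes u1 :: "'k::field"
  assumes nz: "u1 \<noteq> 0" "u2 \<noteq> 0" "u3 \<noteq> 0" "w1 \<noteq> 0" "w2 \<noteq> 0"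
  shows "oct_mat_mult (herm_elem u1 u2 u3 w1 w2 c) (herm_elem u1 u2 u3 w1 w2 c) =
    herm_elem u1 u2 u3 w1 w2 (coords_square u1 u2 u3 w1 w2 c)"
proof -
  obtain d1 d2 d3 x1 b1 c1 e1 x2 b2 c2 e2 x3 b3 c3 e3 where
    c: "c = ((d1, d2, d3), (x1, b1, c1, e1), (x2, b2, c2, e2), (x3, b3, c3, e3))"
    by (metis prod.exhaust)
  show ?thesis
    unfolding c using nz
    by (simp add: herm_elem_def coords_square_def Let_def oct_mat_mult_def vec_eq_iff forall_3 sum_3
        quat_mult quat_scale quat_add quat_eq_iff power2_eq_square)
      (intro conjI; simp add: field_simps)
qed

text \<open>Since \<open>a # a\<close> is twice the sharp of \<open>a\<close>, squares need no
  division by 2.\<close>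

lemma albert_square:
  fixes a :: "'k::field albert"
  assumes "(2::'k) \<noteq> 0"
  shows "albert_mult a a = albert_sharp a + albert_scale (albert_Tr a) a
    + albert_scale (- albert_Tr (albert_sharp a)) albert_one"
proof (cases a)
  case (fields a0 a1 a2)
  show ?thesis
    unfolding fields using assms
    by (simp add: albert_mult_def albert_cross_def albert_sharp_def albert_Tr_def albert_Sr_def
      albert_scale_def albert_one_def mat3_simps)
qed

lemma fixed_elem_square:
  fixes u1 :: "'k::field"
  assumes two: "(2::'k) \<noteq> 0" and nz: "u1 \<noteq> 0" "u2 \<noteq> 0" "w1 \<noteq> 0" "w2 \<noteq> 0"
    and u3: "u3 = 1 / (u1 * u2)" and w3: "w3 = 1 / (w1 * w2)"
  shows "albert_mult (fixed_elem u1 u2 u3 w1 w2 w3 c) (fixed_elem u1 u2 u3 w1 w2 w3 c)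
     = fixed_elem u1 u2 u3 w1 w2 w3 (coords_square u1 u2 u3 w1 w2 c)"
proof -
  obtain d1 d2 d3 x1 b1 c1 e1 x2 b2 c2 e2 x3 b3 c3 e3 where
    c: "c = ((d1, d2, d3), (x1, b1, c1, e1), (x2, b2, c2, e2), (x3, b3, c3, e3))"
    by (metis prod.exhaust)
  show ?thesis
    unfolding c albert_square[OF two] u3 w3 using nz
    by (simp add: fixed_elem_def coords_square_def Let_def albert_sharp_def albert_Tr_def
        albert_scale_def albert_one_def mat3_simps)
     (intro conjI; simp add: field_simps power2_eq_square)
qed

section \<open>The fixed algebra as an algebra of Hermitian matrices\<close>

definition fixed_coords :: "'k::field \<Rightarrow> 'k \<Rightarrow> 'k \<Rightarrow> 'k albert \<Rightarrow>
    'k coords" where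
  "fixed_coords u1 u2 u3 = (\<lambda>(a, m, m'). ((a$1$1, a$2$2, a$3$3),
     (a$1$2, m$3$1 / u1, m$3$2 / u1, m$3$3 / u1), (a$2$3, m$1$1 / u2, m$1$2 / u2, m$1$3 / u2),
     (a$3$1, m$2$1 / u3, m$2$2 / u3, m$2$3 / u3)))"

definition coords_scale :: "'k::field \<Rightarrow> 'k coords \<Rightarrow> 'k coords" where
  "coords_scale t = (\<lambda>((d1, d2, d3), (x1, b1, c1, e1), (x2, b2, c2, e2), (x3, b3, c3, e3)).
    ((t * d1, t * d2, t * d3), (t * x1, t * b1, t * c1, t * e1), (t * x2, t * b2, t * c2, t * e2), (t * x3, t *
        b3, t * c3, t * e3)))"

lemma coordsE:
  obtains d1 d2 d3 x1 b1 c1 e1 x2 b2 c2 e2 x3 b3 c3 e3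
  where "c = ((d1, d2, d3), (x1, b1, c1, e1), (x2, b2, c2, e2), (x3, b3, c3, e3))"
  by (metis prod.exhaust)

lemma fixed_coords_add: "fixed_coords u1 u2 u3 (a + b) = fixed_coords u1 u2 u3 a + fixed_coords u1 u2 u3 b"
  by (cases a; cases b) (simp add: fixed_coords_def add_divide_distrib)

lemma fixed_coords_scale: "fixed_coords u1 u2 u3 (albert_scale t a) = coords_scale t (fixed_coords u1 u2 u3 a)"
  by (cases a) (simp add: fixed_coords_def coords_scale_def albert_scale_def mat_scale_def map_matrix_def)

lemma herm_elem_add: "herm_elem u1 u2 u3 w1 w2 (c + c') = herm_elem u1 u2 u3 w1 w2 c + herm_elem u1 u2 u3 w1 w2
    c'"
  by (rule coordsE[of c]; rule coordsE[of c'])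
    (simp add: herm_elem_def vec_eq_iff forall_3 quat_add quat_scale ring_distribs
      add_divide_distrib diff_divide_distrib)

lemma herm_elem_scale: "herm_elem u1 u2 u3 w1 w2 (coords_scale t c) = oct_mat_scale t (herm_elem u1 u2 u3 w1 w2
    c)"
  by (rule coordsE[of c])
    (simp add: herm_elem_def coords_scale_def oct_mat_scale_def map_matrix_def vec_eq_iff forall_3 quat_scale
        ac_simps)

lemma fixed_coords_fixed_elem:
  assumes "u1 \<noteq> 0" "u2 \<noteq> 0" "u3 \<noteq> 0"
  shows "fixed_coords u1 u2 u3 (fixed_elem u1 u2 u3 w1 w2 w3 c) = c"
  using assms by (cases rule: coordsE[of c]) (simp add: fixed_elem_def fixed_coords_def)

lemma fixed_elem_in_gt_fixed:
  fixes u1 :: "'k::field"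
  assumes nz: "u1 \<noteq> 0" "u2 \<noteq> 0" "v1 \<noteq> 0" "v2 \<noteq> 0"
  shows "fixed_elem u1 (u2 / u1) (1 / u2) v1 (v2 / v1) (1 / v2) c \<in> gt_fixed (u1, u2, v1, v2)"
  using nz by (cases rule: coordsE[of c])
    (simp add: gt_fixed_def gt_eq_diag_swap diag_swap_def tits_swap_def diag3_def fixed_elem_def mat3_simps
        ac_simps)

lemma gt_fixed_eq_zero:
  fixes u1 :: "'k::field"
  assumes nz: "u1 \<noteq> 0" "u2 \<noteq> 0" "v1 \<noteq> 0" "v2 \<noteq> 0" and a: "a \<in> gt_fixed (u1, u2,
      v1, v2)"
    and zero: "fixed_coords u1 (u2 / u1) (1 / u2) a = 0"
  shows "a = 0"
proof -
  obtain a0 a1 a2 where a_eq: "a = (a0, a1, a2)" by (cases a)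
  have fixed: "diag_swap u1 (u2 / u1) (1 / u2) v1 (v2 / v1) (1 / v2) (a0, a1, a2) = (a0, a1, a2)"
    using a nz by (simp add: gt_fixed_def gt_eq_diag_swap a_eq)
  have a1: "a1 = 0" and a0: "a0 $ 1 $ 1 = 0" "a0 $ 2 $ 2 = 0" "a0 $ 3 $ 3 = 0" "a0 $ 1 $ 2 = 0" "a0 $ 2 $ 3 =
      0" "a0 $ 3 $ 1 = 0"
    using zero nz by (simp_all add: a_eq fixed_coords_def zero_prod_def mat3_simps)
  have "a0 $ 2 $ 1 = 0" "a0 $ 3 $ 2 = 0" "a0 $ 1 $ 3 = 0" "a2 = 0"
    using fixed by (simp_all add: diag_swap_def tits_swap_def diag3_def mat3_simps a0 a1)
  then show ?thesis
    using a0 a1 by (simp add: a_eq zero_prod_def mat3_simps)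
qed

lemma gt_fixed_closed:
  assumes \<tau>: "\<tau> \<in> torus_params"
  shows "0 \<in> gt_fixed \<tau>" "a \<in> gt_fixed \<tau> \<Longrightarrow> b \<in> gt_fixed \<tau>
      \<Longrightarrow> a + b \<in> gt_fixed \<tau>"
    "a \<in> gt_fixed \<tau> \<Longrightarrow> albert_scale c a \<in> gt_fixed \<tau>"
    "a \<in> gt_fixed \<tau> \<Longrightarrow> b \<in> gt_fixed \<tau> \<Longrightarrow> albert_mult a b \<in>
        gt_fixed \<tau>"
  using Aut_zero[OF gt_in_Aut[OF \<tau>]] Aut_add[OF gt_in_Aut[OF \<tau>]] Aut_scale[OF gt_in_Aut[OF \<tau>]]
    Aut_albert_mult[OF gt_in_Aut[OF \<tau>]]
  by (simp_all add: gt_fixed_def del: split_paired_All)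

text \<open>The difference of the two sides is a fixed element all of whose coordinates vanish.\<close>

lemma gt_fixed_eq_fixed_elem:
  fixes u1 :: "'k::field"
  assumes nz: "u1 \<noteq> 0" "u2 \<noteq> 0" "v1 \<noteq> 0" "v2 \<noteq> 0" and a: "a \<in> gt_fixed (u1, u2,
      v1, v2)"
  shows "fixed_elem u1 (u2 / u1) (1 / u2) v1 (v2 / v1) (1 / v2) (fixed_coords u1 (u2 / u1) (1 / u2) a) = a"
proof -
  let ?\<tau> = "(u1, u2, v1, v2)"
  let ?b = "fixed_elem u1 (u2 / u1) (1 / u2) v1 (v2 / v1) (1 / v2) (fixed_coords u1 (u2 / u1) (1 / u2) a)"
  have \<tau>: "?\<tau> \<in> torus_params" using nz by (simp add: torus_params_def)
  have "a + albert_scale (- 1) ?b \<in> gt_fixed ?\<tau>"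
    by (intro gt_fixed_closed[OF \<tau>] a fixed_elem_in_gt_fixed[OF nz])
  moreover have "fixed_coords u1 (u2 / u1) (1 / u2) (a + albert_scale (- 1) ?b) = 0"
  proof -
    have "c + coords_scale (- 1) c = 0" for c :: "'k coords"
      by (cases rule: coordsE[of c]) (simp add: coords_scale_def zero_prod_def)
    moreover have "fixed_coords u1 (u2 / u1) (1 / u2) ?b = fixed_coords u1 (u2 / u1) (1 / u2) a"
      using nz by (intro fixed_coords_fixed_elem) simp_all
    ultimately show ?thesis
      by (simp only: fixed_coords_add fixed_coords_scale)
  qed
  ultimately have "a + albert_scale (- 1) ?b = 0"
    by (rule gt_fixed_eq_zero[OF nz])
  moreover have "albert_scale (- 1) x = - x" for x :: "'k albert"
    by (cases x) (simp add: albert_scale_def mat3_simps)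
  ultimately show ?thesis
    by simp
qed

lemma herm_elem_in_H3:
  fixes u1 :: "'k::field"
  assumes nz: "u1 \<noteq> 0" "u2 \<noteq> 0" "u3 \<noteq> 0"
  shows "herm_elem u1 u2 u3 w1 w2 c \<in> H3 (quat_algebra w1 w2) (vector [u1, u2, u3])"
proof -
  have diag: "\<exists>t. quat w1 w2 d 0 0 0 = oct_scale t oct_one" for d
    by (intro exI[of _ d]) (simp add: quat_one[of w1 w2] quat_scale)
  show ?thesis
    using nz by (cases rule: coordsE[of c])
      (simp add: H3_def herm_elem_def forall_3 quat_mem quat_scale quat_conj diag field_simps)
qed

lemma H3_eq_herm_elem:
  fixes u1 :: "'k::field"
  assumes nz: "u1 \<noteq> 0" "u2 \<noteq> 0" "u3 \<noteq> 0" and X: "X \<in> H3 (quat_algebra w1 w2) (vector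
      [u1, u2, u3])"
  obtains c where "X = herm_elem u1 u2 u3 w1 w2 c"
proof -
  have mem: "X $ i $ j \<in> quat_algebra w1 w2" for i j using X by (simp add: H3_def)
  obtain x1 b1 c1 e1 where 1: "X $ 1 $ 2 = quat w1 w2 x1 b1 c1 e1" using mem by (rule quat_algebraE)
  obtain x2 b2 c2 e2 where 2: "X $ 2 $ 3 = quat w1 w2 x2 b2 c2 e2" using mem by (rule quat_algebraE)
  obtain x3 b3 c3 e3 where 3: "X $ 3 $ 1 = quat w1 w2 x3 b3 c3 e3" using mem by (rule quat_algebraE)
  have "\<exists>d. X $ i $ i = quat w1 w2 d 0 0 0" for i
  proof -
    obtain t where "X $ i $ i = oct_scale t oct_one" using X by (force simp: H3_def)
    then show ?thesis by (intro exI[of _ t]) (simp add: quat_one[of w1 w2] quat_scale)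
  qed
  then obtain d where d: "\<And>i. X $ i $ i = quat w1 w2 (d i) 0 0 0" by metis
  have herm: "X $ i $ j = oct_scale (inverse (vector [u1, u2, u3] $ i) * vector [u1, u2, u3] $ j) (oct_conj (X
      $ j $ i))" for i j
    using X by (simp add: H3_def)
  have "X = herm_elem u1 u2 u3 w1 w2 ((d 1, d 2, d 3), (x1, b1, c1, e1), (x2, b2, c2, e2), (x3, b3, c3, e3))"
    using herm[of 2 1] herm[of 3 2] herm[of 1 3]
    by (simp add: herm_elem_def vec_eq_iff forall_3 1 2 3 d quat_conj quat_scale divide_inverse mult.commute)
  then show thesis by (rule that)
qed

lemma albert_mult_polarize:
  fixes a b :: "'k::field albert"
  assumes two: "(2::'k) \<noteq> 0"
  shows "albert_mult (a + b) (a + b) = albert_mult a a + albert_mult b b + albert_scale 2 (albert_mult a b)"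
proof -
  have double: "albert_scale 2 (albert_mult a b) = albert_cross a b + albert_scale (albert_Tr a) b
      + albert_scale (albert_Tr b) a - albert_scale (albert_Sr a b) albert_one"
    using two by (simp add: albert_mult_def albert_scale_def mat3_simps split: prod.split)
  show ?thesis
    unfolding albert_square[OF two] double
    by (cases a; cases b)
      (simp add: albert_cross_def albert_sharp_def albert_Tr_def albert_Sr_def
        albert_scale_def albert_one_def mat3_simps; intro conjI; simp add: algebra_simps)
qed

lemma oct_mult_add: "oct_mult (x + y) z = oct_mult x z + oct_mult y z" "oct_mult z (x + y) = oct_mult z x +
    oct_mult z y"
  by (cases x; cases y; cases z; simp add: oct_simps algebra_simps)+

lemma H3_mult_polarize:
  fixes X Y :: "'k::field octonion^3^3"
  assumes two: "(2::'k) \<noteq> 0"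
  shows "H3_mult (X + Y) (X + Y) = H3_mult X X + H3_mult Y Y + oct_mat_scale 2 (H3_mult X Y)"
proof -
  have "oct_mat_scale 2 (H3_mult X Y) = oct_mat_mult X Y + oct_mat_mult Y X"
    using two by (simp add: H3_mult_def oct_mat_scale_def map_matrix_def vec_eq_iff oct_scale_scale
        oct_scale_one)
  then show ?thesis
    by (simp add: H3_mult_self[OF two] oct_mat_mult_def vec_eq_iff oct_mult_add sum.distrib)
qed

text \<open>Both coordinate systems are linear, and squares have the same coordinates in both. As
  2 is invertible, polarization extends this to products.\<close>

lemma fixed_iso_H3_quat_algebra:
  fixes u1 :: "'k::field"
  assumes two: "(2::'k) \<noteq> 0" and nz: "u1 \<noteq> 0" "u2 \<noteq> 0" "v1 \<noteq> 0" "v2 \<noteq> 0"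
  shows "fixed_iso_H3 (u1, u2, v1, v2) (quat_algebra v1 (v2 / v1)) (vector [u1, u2 / u1, 1 / u2])"
proof -
  let ?\<tau> = "(u1, u2, v1, v2)" and ?\<gamma> = "vector [u1, u2 / u1, 1 / u2] :: 'k^3"
  have nz': "u2 / u1 \<noteq> 0" "1 / u2 \<noteq> 0" "v2 / v1 \<noteq> 0" using nz by simp_all
  have \<tau>: "?\<tau> \<in> torus_params" using nz by (simp add: torus_params_def)
  let ?\<Phi> = "fixed_elem u1 (u2 / u1) (1 / u2) v1 (v2 / v1) (1 / v2)"
  let ?\<Psi> = "herm_elem u1 (u2 / u1) (1 / u2) v1 (v2 / v1)"
  let ?c = "fixed_coords u1 (u2 / u1) (1 / u2)"
  define f where "f a = ?\<Psi> (?c a)" for a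
  have f_add: "f (a + b) = f a + f b" and f_scale: "f (albert_scale t a) = oct_mat_scale t (f a)" for a b t
    by (simp_all only: f_def fixed_coords_add herm_elem_add fixed_coords_scale herm_elem_scale)
  note \<Phi>c = gt_fixed_eq_fixed_elem[OF nz] and c\<Phi> = fixed_coords_fixed_elem[OF nz(1) nz'(1,2)]
  have f_square: "f (albert_mult a a) = H3_mult (f a) (f a)" if "a \<in> gt_fixed ?\<tau>" for a
  proof -
    have "albert_mult a a = ?\<Phi> (coords_square u1 (u2 / u1) (1 / u2) v1 (v2 / v1) (?c a))"
      using fixed_elem_square[OF two nz(1) nz'(1) nz(3) nz'(3), of "1 / u2" "1 / v2" "?c a"] nz
      unfolding \<Phi>c[OF that] by simp
    then show ?thesis
      using herm_elem_square[OF nz(1) nz'(1,2) nz(3) nz'(3), of "?c a"]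
      by (simp add: f_def c\<Phi> H3_mult_self[OF two])
  qed
  have f_mult: "f (albert_mult a b) = H3_mult (f a) (f b)" if ab: "a \<in> gt_fixed ?\<tau>" "b \<in> gt_fixed
      ?\<tau>" for a b
  proof -
    have "f (albert_mult (a + b) (a + b)) = H3_mult (f a + f b) (f a + f b)"
      using f_square[OF gt_fixed_closed(2)[OF \<tau> ab]] by (simp only: f_add)
    then have "oct_mat_scale 2 (f (albert_mult a b)) = oct_mat_scale 2 (H3_mult (f a) (f b))"
      unfolding albert_mult_polarize[OF two] H3_mult_polarize[OF two] f_add f_scale
        f_square[OF ab(1)] f_square[OF ab(2)] by simp
    then have "oct_mat_scale (1 / 2) (oct_mat_scale 2 (f (albert_mult a b))) =
        oct_mat_scale (1 / 2) (oct_mat_scale 2 (H3_mult (f a) (f b)))" by simp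
    then show ?thesis
      using two by (simp add: oct_mat_scale_def map_matrix_def vec_eq_iff oct_scale_scale oct_scale_one)
  qed
  have "bij_betw f (gt_fixed ?\<tau>) (H3 (quat_algebra v1 (v2 / v1)) ?\<gamma>)"
    unfolding bij_betw_def
  proof
    have w: "v1 \<noteq> 0" by fact
    have \<Psi>_inj: "c = c'" if "?\<Psi> c = ?\<Psi> c'" for c c'
      using that by (cases rule: coordsE[of c]; cases rule: coordsE[of c'])
        (simp add: herm_elem_def vec_eq_iff forall_3 quat_eq_iff[OF w])
    show "inj_on f (gt_fixed ?\<tau>)"
    proof (rule inj_onI)
      fix a b assume ab: "a \<in> gt_fixed ?\<tau>" "b \<in> gt_fixed ?\<tau>" "f a = f b"
      have "?c a = ?c b"
        using \<Psi>_inj ab(3) by (simp add: f_def)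
      then have "?\<Phi> (?c a) = ?\<Phi> (?c b)" by (rule arg_cong)
      then show "a = b" unfolding \<Phi>c[OF ab(1)] \<Phi>c[OF ab(2)] .
    qed
    show "f ` gt_fixed ?\<tau> = H3 (quat_algebra v1 (v2 / v1)) ?\<gamma>"
    proof
      show "f ` gt_fixed ?\<tau> \<subseteq> H3 (quat_algebra v1 (v2 / v1)) ?\<gamma>"
        unfolding f_def by (intro image_subsetI herm_elem_in_H3[OF nz(1) nz'(1,2)])
      show "H3 (quat_algebra v1 (v2 / v1)) ?\<gamma> \<subseteq> f ` gt_fixed ?\<tau>"
      proof
        fix X assume "X \<in> H3 (quat_algebra v1 (v2 / v1)) ?\<gamma>"
        then obtain c where "X = ?\<Psi> c" by (rule H3_eq_herm_elem[OF nz(1) nz'(1,2)])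
        then have "X = f (?\<Phi> c)" by (simp add: f_def c\<Phi>)
        then show "X \<in> f ` gt_fixed ?\<tau>"
          using fixed_elem_in_gt_fixed[OF nz] by blast
      qed
    qed
  qed
  moreover have "\<forall>i. ?\<gamma> $ i \<noteq> 0"
    using nz by (simp add: forall_3)
  ultimately show ?thesis
    unfolding fixed_iso_H3_def
    using quaternion_subalgebra_quat_algebra[OF two nz(3) nz'(3)] f_add f_scale f_mult by blast
qed

lemma fixed_iso_H3_plane:
  fixes \<tau> :: "'k::field \<times> 'k \<times> 'k \<times> 'k"
  assumes two: "(2::'k) \<noteq> 0" and \<tau>: "\<tau> \<in> torus_params" and iso: "fixed_iso_H3 \<tau> D
      \<gamma>"
  shows "split_subalgebra D \<Longrightarrow> square_zero_plane albert_scale albert_mult (gt_fixed \<tau>)"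
    and "division_subalgebra D \<Longrightarrow> \<not> square_zero_plane albert_scale albert_mult (gt_fixed
        \<tau>)"
proof -
  have D: "quaternion_subalgebra D" and \<gamma>: "\<And>i. \<gamma> $ i \<noteq> 0"
    using iso by (simp_all add: fixed_iso_H3_def)
  obtain f where f: "bij_betw f (gt_fixed \<tau>) (H3 D \<gamma>)"
    and add: "\<And>a b. a \<in> gt_fixed \<tau> \<Longrightarrow> b \<in> gt_fixed \<tau> \<Longrightarrow> f
        (a + b) = f a + f b"
    and scale: "\<And>c a. a \<in> gt_fixed \<tau> \<Longrightarrow> f (albert_scale c a) = oct_mat_scale c (f
        a)"
    and mult: "\<And>a b. a \<in> gt_fixed \<tau> \<Longrightarrow> b \<in> gt_fixed \<tau> \<Longrightarrow> f
        (albert_mult a b) = H3_mult (f a) (f b)"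
    using iso unfolding fixed_iso_H3_def by (elim conjE exE) metis
  have "square_zero_plane albert_scale albert_mult (gt_fixed \<tau>) \<longleftrightarrow> square_zero_plane
      oct_mat_scale H3_mult (H3 D \<gamma>)"
    by (rule square_zero_plane_transfer[OF f]) (rule gt_fixed_closed[OF \<tau>] add scale mult; assumption)+
  then show "split_subalgebra D \<Longrightarrow> square_zero_plane albert_scale albert_mult (gt_fixed \<tau>)"
    and "division_subalgebra D \<Longrightarrow> \<not> square_zero_plane albert_scale albert_mult (gt_fixed
        \<tau>)"
    using H3_split_plane[OF two D _ \<gamma>] H3_division_no_plane[OF two D _ \<gamma>] by blast+
qed

lemma gt_conj_fixed_bij:
  assumes "gt_conj \<sigma> \<tau>"
  obtains h where "h \<in> carrier albert_Aut" "bij_betw h (gt_fixed \<sigma>) (gt_fixed \<tau>)"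
proof -
  obtain h where h: "h \<in> carrier albert_Aut" "\<And>a. h (gt \<sigma> a) = gt \<tau> (h a)"
    using assms by (auto simp: gt_conj_def)
  obtain h' where h': "h' \<in> carrier albert_Aut" "\<And>a. h (h' a) = a" "\<And>a. h' (h a) = a"
    using Aut_inverse[OF h(1)] by metis
  have h'_gt: "gt \<sigma> (h' a) = h' (gt \<tau> a)" for a
    using h(2)[of "h' a"] h'(2)[of a] h'(3)[of "gt \<sigma> (h' a)"] by metis
  have "bij_betw h (gt_fixed \<sigma>) (gt_fixed \<tau>)"
  proof (rule bij_betw_byWitness[where f' = h'])
    show "h ` gt_fixed \<sigma> \<subseteq> gt_fixed \<tau>"
      unfolding gt_fixed_def using h(2) by (metis (mono_tags, lifting) image_subsetI mem_Collect_eq)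
    show "h' ` gt_fixed \<tau> \<subseteq> gt_fixed \<sigma>"
      unfolding gt_fixed_def using h'_gt by (metis (mono_tags, lifting) image_subsetI mem_Collect_eq)
  qed (simp_all only: h' simp_thms Ball_def)
  then show thesis using that h by blast
qed

text \<open>The existence of a square-zero plane depends on the fixed algebra only. So the type of
  one coordinatization determines the type of all.\<close>

lemma fixed_types:
  fixes u1 :: "'k::field"
  assumes two: "(2::'k) \<noteq> 0" and nz: "u1 \<noteq> 0" "u2 \<noteq> 0" "v1 \<noteq> 0" "v2 \<noteq> 0"
  shows "fixed_split (u1, u2, v1, v2) \<longleftrightarrow> isotropic v1 v2"
    and "fixed_division (u1, u2, v1, v2) \<longleftrightarrow> \<not> isotropic v1 v2"
    and "square_zero_plane albert_scale albert_mult (gt_fixed (u1, u2, v1, v2)) \<longleftrightarrow> isotropic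
        v1 v2"
proof -
  let ?\<tau> = "(u1, u2, v1, v2)"
  have \<tau>: "?\<tau> \<in> torus_params" using nz by (simp add: torus_params_def)
  note iso = fixed_iso_H3_quat_algebra[OF two nz]
  note plane = fixed_iso_H3_plane[OF two \<tau>]
  show *: "square_zero_plane albert_scale albert_mult (gt_fixed ?\<tau>) \<longleftrightarrow> isotropic v1 v2"
    using plane[OF iso] quat_algebra_split_or_division[OF nz(3,4)] by blast
  show "fixed_split ?\<tau> \<longleftrightarrow> isotropic v1 v2" "fixed_division ?\<tau>
      \<longleftrightarrow> \<not> isotropic v1 v2"
    unfolding fixed_split_def fixed_division_def
    using * plane iso quat_algebra_split_or_division[OF nz(3,4)] by blast+
qed

lemma gt_conj_isotropic:
  fixes u1 :: "'k::field"
  assumes two: "(2::'k) \<noteq> 0" and nz: "u1 \<noteq> 0" "u2 \<noteq> 0" "v1 \<noteq> 0" "v2 \<noteq> 0"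
    "x1 \<noteq> 0" "x2 \<noteq> 0" "y1 \<noteq> 0" "y2 \<noteq> 0" and conj: "gt_conj (u1, u2, v1, v2) (x1,
        x2, y1, y2)"
  shows "isotropic v1 v2 \<longleftrightarrow> isotropic y1 y2"
proof -
  have \<tau>: "(u1, u2, v1, v2) \<in> torus_params" using nz by (simp add: torus_params_def)
  obtain h where h: "h \<in> carrier albert_Aut" "bij_betw h (gt_fixed (u1, u2, v1, v2)) (gt_fixed (x1, x2, y1,
      y2))"
    using gt_conj_fixed_bij[OF conj] .
  show ?thesis
    unfolding fixed_types(3)[OF two nz(1-4), symmetric] fixed_types(3)[OF two nz(5-8), symmetric]
    by (rule square_zero_plane_transfer[OF h(2)])
      (simp_all add: gt_fixed_closed[OF \<tau>] Aut_add[OF h(1)] Aut_scale[OF h(1)] Aut_albert_mult[OF h(1)]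
          del: split_paired_All)
qed

section \<open>Normalizing the pair (v1, v2)\<close>

lemma torus_congruent_isotropic:
  fixes v1 :: "'k::field"
  assumes "(2::'k) \<noteq> 0" "v1 \<noteq> 0" "v2 \<noteq> 0" "w1 \<noteq> 0" "w2 \<noteq> 0" "torus_congruent
      (v1, v2) (w1, w2)"
  shows "isotropic v1 v2 \<longleftrightarrow> isotropic w1 w2"
  using assms by (intro gt_conj_isotropic[of 1 1 _ _ 1 1] gt_conj_congruent_v) auto

text \<open>The alternative is unchanged by isometries of \<open>V\<close>. Therefore it can be
  proved by normalizing \<open>v1\<close> and \<open>v2\<close> step by step.\<close>

definition reducible_to :: "'k::field \<Rightarrow> 'k \<Rightarrow> 'k \<Rightarrow> 'k \<Rightarrow> bool"
    where
  "reducible_to d1 d2 v1 v2 \<longleftrightarrow> isotropic v1 v2 \<or>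
     (\<forall>u1 u2. u1 \<noteq> 0 \<longrightarrow> u2 \<noteq> 0 \<longrightarrow> gt_conj (u1, u2, v1, v2)
         (u1, u2, d1, d2))"

lemma reducible_to_congruent:
  fixes v1 :: "'k::field"
  assumes two: "(2::'k) \<noteq> 0" and nz: "v1 \<noteq> 0" "v2 \<noteq> 0" "w1 \<noteq> 0" "w2 \<noteq> 0"
    and cong: "torus_congruent (v1, v2) (w1, w2)"
  shows "reducible_to d1 d2 v1 v2 \<longleftrightarrow> reducible_to d1 d2 w1 w2"
proof -
  have "gt_conj (u1, u2, v1, v2) (u1, u2, d1, d2) \<longleftrightarrow> gt_conj (u1, u2, w1, w2) (u1, u2, d1,
      d2)"
    if "u1 \<noteq> 0" "u2 \<noteq> 0" for u1 u2
    using gt_conj_congruent_v[OF that nz cong] by (blast intro: gt_conj_sym gt_conj_trans)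
  then show ?thesis
    unfolding reducible_to_def using torus_congruent_isotropic[OF two nz cong] by blast
qed

lemma reducible_to_refl: "reducible_to d1 d2 d1 d2"
  by (simp add: reducible_to_def gt_conj_refl)

context
  fixes d1 d2 :: "'k::field"
  assumes two: "(2::'k) \<noteq> 0"
begin

lemma reducible_squares:
  assumes "a \<noteq> 0" "b \<noteq> 0" "x \<noteq> 0" "y \<noteq> 0"
  shows "reducible_to d1 d2 (a\<^sup>2 * x) (b\<^sup>2 * y) \<longleftrightarrow> reducible_to d1 d2 x y"
  using assms by (intro reducible_to_congruent[OF two] torus_congruent_squares) auto

lemma reducible_swap:
  assumes "x \<noteq> 0" "y \<noteq> 0"
  shows "reducible_to d1 d2 x y \<longleftrightarrow> reducible_to d1 d2 y x"
proof -
  have "reducible_to d1 d2 (x\<^sup>2 * y) (y\<^sup>2 * x) \<longleftrightarrow> reducible_to d1 d2 x y"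
    using assms by (intro reducible_to_congruent[OF two] torus_congruent_swap) auto
  then show ?thesis
    using reducible_squares[of x y y x] assms by simp
qed

lemma reducible_12:
  assumes "x \<noteq> 0" "y \<noteq> 0" "n \<noteq> 0" "n = X\<^sup>2 + y * Y\<^sup>2"
  shows "reducible_to d1 d2 (n * x) y \<longleftrightarrow> reducible_to d1 d2 x y"
  using assms(1-3) by (intro reducible_to_congruent[OF two] torus_congruent_12[OF _ _ assms(4)]) auto

lemma reducible_23:
  assumes "x \<noteq> 0" "y \<noteq> 0" "n \<noteq> 0" "n = X\<^sup>2 + x * Y\<^sup>2"
  shows "reducible_to d1 d2 x (n * y) \<longleftrightarrow> reducible_to d1 d2 x y"
  using assms(1-3) by (intro reducible_to_congruent[OF two] torus_congruent_23[OF _ _ assms(4)]) auto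

lemma reducible_13:
  assumes "x \<noteq> 0" "y \<noteq> 0" "n \<noteq> 0" "n = X\<^sup>2 + x * y * Y\<^sup>2"
  shows "reducible_to d1 d2 (n * x) (n * y) \<longleftrightarrow> reducible_to d1 d2 x y"
  using assms(1-3) by (intro reducible_to_congruent[OF two] torus_congruent_13[OF _ _ assms(4)]) auto

text \<open>Here \<open>x\<close> itself is the value of \<open>\<langle>1, x\<rangle>\<close>
  that is used.\<close>

lemma reducible_mult:
  assumes "x \<noteq> 0" "y \<noteq> 0"
  shows "reducible_to d1 d2 x (x * y) \<longleftrightarrow> reducible_to d1 d2 x y"
  using assms by (intro reducible_23[of _ _ _ 0 1]) auto

end

section \<open>Squares in prime fields and the ring of p-adic integers\<close>

text \<open>The map \<open>x \<mapsto> x^2\<close> is at most two-to-one, and one-to-one over 0;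
  so more than half of the elements are squares.\<close>

lemma card_squares_mod_ring:
  "card (UNIV :: 'p::prime_card mod_ring set) + 1 \<le> 2 * card (range (\<lambda>x :: 'p mod_ring. x\<^sup>2))"
proof -
  let ?F = "UNIV :: 'p mod_ring set"
  let ?S = "range (\<lambda>x :: 'p mod_ring. x\<^sup>2)"
  have fibre: "card {x :: 'p mod_ring. x\<^sup>2 = s} \<le> (if s = 0 then 1 else 2)" for s
  proof (cases "\<exists>x. x\<^sup>2 = s")
    case True
    then obtain r where r: "r\<^sup>2 = s" by blast
    have "{x. x\<^sup>2 = s} = {r, - r}"
      unfolding r[symmetric] by (auto simp: power2_eq_iff)
    moreover have "card {r, - r} \<le> 2" by (simp add: card_insert_if)
    moreover have "card {r, - r} = 1" if "s = 0" using that r by simp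
    ultimately show ?thesis by simp
  next
    case False
    then have "{x. x\<^sup>2 = s} = {}" by blast
    then show ?thesis by simp
  qed
  have zero: "0 \<in> ?S" by (rule range_eqI[of _ _ 0]) simp
  have fin: "finite ?S" by simp
  have UN: "?F = (\<Union>s\<in>?S. {x. x\<^sup>2 = s})" by blast
  have "card ?F \<le> (\<Sum>s\<in>?S. card {x. x\<^sup>2 = s})"
    by (subst UN) (rule card_UN_le[OF fin])
  also have "\<dots> = card {x :: 'p mod_ring. x\<^sup>2 = 0} + (\<Sum>s\<in>?S - {0}. card {x. x\<^sup>2 = s})"
    by (rule sum.remove[OF fin zero])
  also have "\<dots> \<le> 1 + (\<Sum>s\<in>?S - {0}. 2)"
  proof (intro add_mono sum_mono)
    show "card {x :: 'p mod_ring. x\<^sup>2 = 0} \<le> 1" using fibre[of 0] by simp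
    show "card {x. x\<^sup>2 = s} \<le> 2" for s :: "'p mod_ring"
      using fibre[of s] by (simp split: if_splits)
  qed
  also have "\<dots> = 1 + 2 * (card ?S - 1)"
    using zero by simp
  finally show "card ?F + 1 \<le> 2 * card ?S"
    using card_gt_0_iff[of ?S] fin by auto
qed

text \<open>The elements \<open>x^2\<close> and the elements \<open>n - c y^2\<close> both make up
  more than half of the field, so the two sets meet.\<close>

lemma finite_field_binary_universal:
  fixes c n :: "'p::prime_card mod_ring"
  assumes c: "c \<noteq> 0"
  shows "\<exists>x y. n = x\<^sup>2 + c * y\<^sup>2"
proof -
  let ?F = "UNIV :: 'p mod_ring set"
  let ?S = "range (\<lambda>x :: 'p mod_ring. x\<^sup>2)"
  note card_squares_mod_ring[where 'p = 'p]
  moreover have "card ((\<lambda>s. n - c * s) ` ?S) = card ?S"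
    using c by (intro card_image) (auto simp: inj_on_def)
  ultimately have "card ?S + card ((\<lambda>s. n - c * s) ` ?S) > card ?F" by linarith
  moreover have "card ?S + card ((\<lambda>s. n - c * s) ` ?S) = card (?S \<union> (\<lambda>s. n - c * s) `
      ?S)"
    if "?S \<inter> (\<lambda>s. n - c * s) ` ?S = {}"
    using that by (intro card_Un_disjoint[symmetric]) auto
  moreover have "card (?S \<union> (\<lambda>s. n - c * s) ` ?S) \<le> card ?F"
    by (rule card_mono) auto
  ultimately have "?S \<inter> (\<lambda>s. n - c * s) ` ?S \<noteq> {}"
    by linarith
  then obtain x y where "x\<^sup>2 = n - c * y\<^sup>2" by auto
  then have "n = x\<^sup>2 + c * y\<^sup>2" by (simp add: algebra_simps)
  then show ?thesis by blast
qed

text \<open>The squares and the nonzero multiples \<open>s b\<close> of squares \<open>s\<close>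
  are disjoint, and together they exhaust the field.\<close>

lemma nonsquare_ratio:
  fixes a b :: "'p::prime_card mod_ring"
  assumes a: "\<nexists>x. a = x\<^sup>2" and b: "\<nexists>x. b = x\<^sup>2"
  shows "\<exists>s. a = s\<^sup>2 * b"
proof (rule ccontr)
  assume no: "\<nexists>s. a = s\<^sup>2 * b"
  let ?S = "range (\<lambda>x :: 'p mod_ring. x\<^sup>2)"
  let ?T = "(\<lambda>s. s * b) ` (?S - {0})"
  have b0: "b \<noteq> 0" using b by (metis zero_power2)
  have zero: "0 \<in> ?S" by (rule range_eqI[of _ _ 0]) simp
  have disj: "?S \<inter> ?T = {}"
  proof (rule equals0I, erule IntE)
    fix r assume "r \<in> ?S" "r \<in> ?T"
    obtain x where x: "r = x\<^sup>2" using \<open>r \<in> ?S\<close> by (rule rangeE)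
    obtain t where t: "r = t * b" "t \<in> ?S - {0}" using \<open>r \<in> ?T\<close> by (rule imageE)
    have "t \<in> ?S" using t(2) by (rule DiffD1)
    then obtain y where y: "t = y\<^sup>2" by (rule rangeE)
    have "t \<noteq> 0" using t(2) by (metis DiffD2 singletonI)
    then have "y \<noteq> 0" using y by auto
    then have "b = (x / y)\<^sup>2" using x y t(1) by (simp add: power_divide eq_divide_eq mult.commute)
    then show False using b by blast
  qed
  have "card ?T = card ?S - 1"
    using b0 zero by (subst card_image) (auto simp: inj_on_def)
  then have "card (?S \<union> ?T) = 2 * card ?S - 1"
    using disj card_gt_0_iff[of ?S] by (subst card_Un_disjoint) auto
  moreover have "a \<notin> ?S \<union> ?T"
  proof
    assume "a \<in> ?S \<union> ?T"
    then show False
    proof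
      assume "a \<in> ?S"
      then show False using a by (auto elim: rangeE)
    next
      assume "a \<in> ?T"
      then obtain t where t: "a = t * b" "t \<in> ?S - {0}" by (rule imageE)
      have "t \<in> ?S" using t(2) by (rule DiffD1)
      then show False using no t(1) by (auto elim: rangeE)
    qed
  qed
  then have "card (?S \<union> ?T) < card (UNIV :: 'p mod_ring set)"
    by (intro psubset_card_mono) auto
  ultimately show False
    using card_squares_mod_ring[where 'p = 'p] by linarith
qed

lemma mod_ring_two_nonzero:
  assumes "CARD('p::prime_card) > 2"
  shows "(2 :: 'p mod_ring) \<noteq> 0"
proof
  assume "(2 :: 'p mod_ring) = 0"
  then have "CARD('p) dvd 2"
    using of_nat_0_mod_ring_dvd[of 2, where 'a = 'p] by simp
  then show False using assms by (auto dest: dvd_imp_le)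
qed

lemma least_nonsquare_nonsquare:
  assumes "CARD('p::prime_card) > 2"
  shows "of_nat (least_nonsquare TYPE('p)) \<noteq> (x :: 'p mod_ring)\<^sup>2"
proof -
  have "\<not> inj (\<lambda>x :: 'p mod_ring. x\<^sup>2)"
  proof
    assume "inj (\<lambda>x :: 'p mod_ring. x\<^sup>2)"
    then have "(1 :: 'p mod_ring) = - 1" by (rule injD) simp
    then show False
      using mod_ring_two_nonzero[OF assms] by (metis add.right_inverse one_add_one)
  qed
  then have "\<not> surj (\<lambda>x :: 'p mod_ring. x\<^sup>2)"
    using finite_UNIV_surj_inj[of "\<lambda>x :: 'p mod_ring. x\<^sup>2"] by auto
  then obtain s :: "'p mod_ring" where s: "\<nexists>x. s = x\<^sup>2" by (auto simp: surj_def)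
  obtain i where i: "s = of_nat i"
    using surj_of_nat_mod_ring by blast
  have "i > 0"
    using s i by (metis gr0I of_nat_0 zero_power2)
  then have "\<exists>i > 0. \<nexists>x :: 'p mod_ring. of_nat i = x\<^sup>2"
    using s i by auto
  then have "\<nexists>x :: 'p mod_ring. of_nat (least_nonsquare TYPE('p)) = x\<^sup>2"
    unfolding least_nonsquare_def by (rule LeastI2_ex) blast
  then show ?thesis by blast
qed

definition residue :: "nat \<Rightarrow> 'p::prime_card padic_int \<Rightarrow> int" where
  "residue n x = Rep_padic_int x n"

lemma residue_range: "0 \<le> residue n x" "residue n x < int CARD('p) ^ n"
  for x :: "'p::prime_card padic_int"
  using Rep_padic_int[of x] by (auto simp: residue_def)

lemma residue_Suc: "residue (Suc n) x mod int CARD('p) ^ n = residue n x"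
  for x :: "'p::prime_card padic_int"
  using Rep_padic_int[of x] by (auto simp: residue_def)

lemma residue_add: "residue (n + k) x mod int CARD('p) ^ n = residue n x"
  for x :: "'p::prime_card padic_int"
proof (induction k)
  case 0
  then show ?case using residue_range[of n x] by simp
next
  case (Suc k)
  have "residue (n + Suc k) x mod int CARD('p) ^ n = residue (Suc (n + k)) x mod int CARD('p) ^ (n + k) mod int
      CARD('p) ^ n"
    by (simp add: mod_mod_cancel le_imp_power_dvd)
  then show ?case using Suc by (simp add: residue_Suc)
qed

lemma residue_arith:
  fixes x y :: "'p::prime_card padic_int"
  shows "residue n (x + y) = (residue n x + residue n y) mod int CARD('p) ^ n"
    "residue n (x - y) = (residue n x - residue n y) mod int CARD('p) ^ n"
    "residue n (- x) = (- residue n x) mod int CARD('p) ^ n"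
    "residue n (x * y) = (residue n x * residue n y) mod int CARD('p) ^ n"
    "residue n (0 :: 'p padic_int) = 0"
    "residue n (1 :: 'p padic_int) = 1 mod int CARD('p) ^ n"
  by (simp_all add: residue_def plus_padic_int.rep_eq minus_padic_int.rep_eq uminus_padic_int.rep_eq
      times_padic_int.rep_eq zero_padic_int.rep_eq one_padic_int.rep_eq)

lemma residue_of_nat: "residue n (of_nat m :: 'p::prime_card padic_int) = int m mod int CARD('p) ^ n"
  by (induction m) (simp_all add: residue_arith mod_simps)

lemma residue_of_int: "residue n (of_int m :: 'p::prime_card padic_int) = m mod int CARD('p) ^ n"
  by (cases m rule: int_cases2) (simp_all add: residue_arith residue_of_nat mod_simps)

lemma residue_eqI: "(\<And>n. residue n x = residue n y) \<Longrightarrow> x = y"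
  by (metis Rep_padic_int_inject ext residue_def)

text \<open>Completeness: integers that agree modulo higher and higher powers define a p-adic
  integer.\<close>

lemma residue_limit:
  fixes s :: "nat \<Rightarrow> int"
  assumes "\<And>n. s (Suc n) mod int CARD('p::prime_card) ^ n = s n mod int CARD('p) ^ n"
  obtains x :: "'p::prime_card padic_int" where "\<And>n. residue n x = s n mod int CARD('p) ^ n"
proof -
  let ?f = "\<lambda>n. s n mod int CARD('p) ^ n"
  have "?f n \<in> {0..<int CARD('p) ^ n} \<and> ?f (Suc n) mod int CARD('p) ^ n = ?f n" for n
    using assms[of n] prime_card_gt_1[where 'p = 'p] by (simp add: mod_power_Suc_mod_power del: power_Suc)
  then have "residue n (Abs_padic_int ?f :: 'p padic_int) = ?f n" for n
    unfolding residue_def by (subst Abs_padic_int_inverse) auto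
  then show thesis by (rule that)
qed

text \<open>Iterating \<open>t \<mapsto> c - t^2\<close>, a contraction on the multiples of
  \<open>p\<close>. Solving \<open>s^2 + s = c\<close> rather than \<open>s^2 = c\<close> makes
  the derivative a unit for \<open>p = 2\<close> as well.\<close>

lemma quadratic_root:
  fixes c :: "'p::prime_card padic_int"
  assumes c: "residue 1 c = 0"
  obtains s where "s * s + s = c"
proof -
  let ?p = "int CARD('p)"
  define s where "s = rec_nat 0 (\<lambda>n t. residue (Suc n) c - t * t)"
  have s: "s 0 = 0" "s (Suc n) = residue (Suc n) c - s n * s n" for n
    by (simp_all add: s_def)
  have dvd: "?p dvd s n" for n
  proof (induction n)
    case (Suc n)
    have "?p dvd residue (Suc n) c"
      using residue_add[of 1 n c] c by (simp add: mod_eq_0_iff_dvd)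
    then show ?case using Suc by (simp add: s)
  qed (simp add: s)
  have cauchy: "?p ^ n dvd s (Suc n) - s n" for n
  proof (induction n)
    case (Suc n)
    have "?p ^ Suc n dvd residue (Suc (Suc n)) c - residue (Suc n) c"
      using residue_Suc[of "Suc n" c] by (metis mod_eq_dvd_iff residue_range mod_pos_pos_trivial)
    moreover have "?p ^ Suc n dvd (s (Suc n) - s n) * (s (Suc n) + s n)"
      using mult_dvd_mono[OF Suc dvd_add[OF dvd[of "Suc n"] dvd[of n]]] by (simp add: mult.commute)
    ultimately have "?p ^ Suc n dvd (residue (Suc (Suc n)) c - residue (Suc n) c) - (s (Suc n) - s n) * (s (Suc
        n) + s n)"
      by (rule dvd_diff)
    then show ?case
      by (simp add: s(2)[of "Suc n"] s(2)[of n] algebra_simps)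
  qed simp
  obtain x :: "'p padic_int" where x: "\<And>n. residue n x = s n mod ?p ^ n"
    using residue_limit[of s] cauchy by (metis mod_eq_dvd_iff)
  have "residue n (x * x + x) = residue n c" for n
  proof -
    have "residue n (x * x + x) = (s n * s n + s n) mod ?p ^ n"
      by (simp add: residue_arith x mod_simps)
    also have "\<dots> = (s n * s n + s (Suc n)) mod ?p ^ n"
      using cauchy[of n] by (metis mod_add_cong mod_eq_dvd_iff)
    also have "\<dots> = residue n c"
      by (simp add: s residue_Suc)
    finally show ?thesis .
  qed
  then show thesis using that residue_eqI by blast
qed

text \<open>Iterating \<open>t \<mapsto> 1 + c t\<close>, that is, summing the geometric series.\<close>

lemma one_minus_inverse:
  fixes c :: "'p::prime_card padic_int"
  assumes c: "residue 1 c = 0"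
  obtains s where "s * (1 - c) = 1"
proof -
  let ?p = "int CARD('p)"
  define s where "s = rec_nat 0 (\<lambda>n t. 1 + residue (Suc n) c * t)"
  have s: "s 0 = 0" "s (Suc n) = 1 + residue (Suc n) c * s n" for n
    by (simp_all add: s_def)
  have dvd: "?p dvd residue (Suc n) c" for n
    using residue_add[of 1 n c] c by (simp add: mod_eq_0_iff_dvd)
  have cauchy: "?p ^ n dvd s (Suc n) - s n" for n
  proof (induction n)
    case (Suc n)
    have "?p ^ Suc n dvd residue (Suc (Suc n)) c - residue (Suc n) c"
      using residue_Suc[of "Suc n" c] by (metis mod_eq_dvd_iff residue_range mod_pos_pos_trivial)
    then have "?p ^ Suc n dvd (residue (Suc (Suc n)) c - residue (Suc n) c) * s (Suc n)"
      by (rule dvd_mult2)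
    moreover have "?p ^ Suc n dvd (s (Suc n) - s n) * residue (Suc n) c"
      using mult_dvd_mono[OF Suc dvd[of n]] by (simp add: mult.commute)
    ultimately have "?p ^ Suc n dvd (residue (Suc (Suc n)) c - residue (Suc n) c) * s (Suc n) + (s (Suc n) - s
        n) * residue (Suc n) c"
      by (rule dvd_add)
    then show ?case
      by (simp add: s(2)[of "Suc n"] s(2)[of n] algebra_simps)
  qed simp
  obtain x :: "'p padic_int" where x: "\<And>n. residue n x = s n mod ?p ^ n"
    using residue_limit[of s] cauchy by (metis mod_eq_dvd_iff)
  have "residue n (1 + c * x) = residue n x" for n
  proof -
    have "residue n (1 + c * x) = (1 + residue (Suc n) c mod ?p ^ n * s n) mod ?p ^ n"
      by (simp add: residue_arith x mod_simps residue_Suc)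
    also have "\<dots> = s (Suc n) mod ?p ^ n"
      unfolding s by (metis mod_add_right_eq mod_mult_left_eq)
    also have "\<dots> = residue n x"
      using cauchy[of n] by (metis mod_eq_dvd_iff x)
    finally show ?thesis .
  qed
  then have "1 + c * x = x" by (rule residue_eqI)
  then have "x * (1 - c) = 1" by (simp add: algebra_simps)
  then show thesis by (rule that)
qed

lemma residue_one_eq_zero_cases:
  fixes x :: "'p::prime_card padic_int"
  assumes "residue n x = 0"
  obtains y where "x = of_nat CARD('p) ^ n * y" "\<forall>k. residue k y = residue (n + k) x div int CARD('p) ^
      n"
proof -
  let ?p = "int CARD('p)"
  have p: "?p > 0" using prime_card_gt_1[where 'p = 'p] by simp
  have dvd: "?p ^ n dvd residue (n + k) x" for k
    using residue_add[of n k x] assms by (simp add: mod_eq_0_iff_dvd)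
  let ?s = "\<lambda>k. residue (n + k) x div ?p ^ n"
  have s: "?s (Suc k) mod ?p ^ k = ?s k mod ?p ^ k" for k
  proof -
    have "?p ^ (n + k) dvd residue (Suc (n + k)) x - residue (n + k) x"
      using residue_Suc[of "n + k" x] by (metis mod_eq_dvd_iff residue_range mod_pos_pos_trivial)
    then have "?p ^ n * ?p ^ k dvd ?p ^ n * (?s (Suc k) - ?s k)"
      using dvd[of k] dvd[of "Suc k"] by (simp add: power_add right_diff_distrib)
    then show ?thesis
      using p by (simp add: mod_eq_dvd_iff)
  qed
  obtain y :: "'p padic_int" where y: "\<And>k. residue k y = ?s k mod ?p ^ k"
    using residue_limit[of ?s] s by blast
  have s_mult: "?p ^ n * ?s k = residue (n + k) x" for k
    using dvd by (rule dvd_mult_div_cancel)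
  have ys: "residue k y = ?s k" for k
  proof -
    have "?p ^ n * ?s k < ?p ^ n * ?p ^ k" "0 \<le> ?p ^ n * ?s k"
      unfolding s_mult using residue_range[of "n + k" x] by (simp_all add: power_add)
    then have "?s k < ?p ^ k" "0 \<le> ?s k"
      using zero_less_power[OF p, of n] by (simp_all add: zero_le_mult_iff)
    then show ?thesis by (simp add: y)
  qed
  have "residue k x = residue k (of_nat CARD('p) ^ n * y)" for k
  proof -
    have "residue k (of_nat CARD('p) ^ n * y) = residue k (of_nat (CARD('p) ^ n) * y)"
      by simp
    also have "\<dots> = (?p ^ n * ?s k) mod ?p ^ k"
      unfolding residue_arith residue_of_nat ys by (simp add: mod_simps)
    also have "\<dots> = residue (n + k) x mod ?p ^ k"
      unfolding s_mult ..
    also have "\<dots> = residue k x"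
      using residue_add[of k n x] by (simp add: add.commute)
    finally show ?thesis by simp
  qed
  then show thesis
    using that[of y] residue_eqI ys by blast
qed

lemma padic_int_valuation:
  fixes x :: "'p::prime_card padic_int"
  assumes "x \<noteq> 0"
  obtains n e where "x = of_nat CARD('p) ^ n * e" "residue 1 e \<noteq> 0"
proof -
  have ex: "\<exists>n. residue n x \<noteq> 0"
    using assms residue_eqI[of x 0] by (auto simp: residue_arith)
  define m where "m = (LEAST n. residue n x \<noteq> 0)"
  have m: "residue m x \<noteq> 0" using ex unfolding m_def by (rule LeastI_ex)
  have "m \<noteq> 0" using m residue_range[of 0 x] by (cases m) auto
  then obtain n where n: "m = Suc n" by (cases m) auto
  have "residue n x = 0"
    using not_less_Least[of n "\<lambda>n. residue n x \<noteq> 0"] by (simp add: n m_def[symmetric])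
  then obtain e where e: "x = of_nat CARD('p) ^ n * e" "\<forall>k. residue k e = residue (n + k) x div int
      CARD('p) ^ n"
    by (rule residue_one_eq_zero_cases)
  have "residue 1 e \<noteq> 0"
  proof
    assume "residue 1 e = 0"
    then have "residue m x div int CARD('p) ^ n = 0" using e(2)[rule_format, of 1] by (simp add: n)
    moreover have "int CARD('p) ^ n dvd residue m x"
      using residue_Suc[of n x] \<open>residue n x = 0\<close> by (simp add: n mod_eq_0_iff_dvd)
    ultimately show False using m by (metis dvd_div_mult_self mult_zero_left)
  qed
  then show thesis using that e(1) by blast
qed

section \<open>Square classes of p-adic numbers\<close>

definition red :: "'p::prime_card padic_int \<Rightarrow> 'p mod_ring" where
  "red x = of_int (residue 1 x)"

lemma of_int_mod_card: "(of_int (m mod int CARD('p)) :: 'p::prime_card mod_ring) = of_int m"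
  using of_int_mod_CHAR[of m, where 'a = "'p mod_ring"] by simp

lemma red_hom:
  fixes x y :: "'p::prime_card padic_int"
  shows "red (x + y) = red x + red y" "red (x - y) = red x - red y" "red (x * y) = red x * red y"
    "red (- x) = - red x" "red (0 :: 'p padic_int) = 0" "red (1 :: 'p padic_int) = 1"
    "red (of_nat n :: 'p padic_int) = of_nat n" "red (of_int m :: 'p padic_int) = of_int m"
  by (simp_all add: red_def residue_arith residue_of_nat residue_of_int of_int_mod_card)

lemma red_eq_iff: "red x = red y \<longleftrightarrow> residue 1 x = residue 1 y"
  for x y :: "'p::prime_card padic_int"
proof
  assume "red x = red y"
  then have "(of_int_mod_ring (residue 1 x) :: 'p mod_ring) = of_int_mod_ring (residue 1 y)"
    by (simp add: red_def of_int_of_int_mod_ring)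
  then have "to_int_mod_ring (of_int_mod_ring (residue 1 x) :: 'p mod_ring) =
      to_int_mod_ring (of_int_mod_ring (residue 1 y) :: 'p mod_ring)" by simp
  moreover have r: "residue 1 t < int CARD('p)" for t :: "'p padic_int"
    using residue_range(2)[of 1 t] by simp
  ultimately show "residue 1 x = residue 1 y"
    by (simp only: to_int_mod_ring_of_int_mod_ring[OF residue_range(1) r])
qed (simp add: red_def)

lemma red_eq_zero_iff: "red x = 0 \<longleftrightarrow> residue 1 x = 0"
  using red_eq_iff[of x 0] by (simp add: red_hom residue_arith)

lemma red_surj: "\<exists>x :: 'p::prime_card padic_int. red x = r"
  using surj_of_nat_mod_ring[of r] red_hom(7) by metis

lemma padic_int_unit_inverse:
  fixes e :: "'p::prime_card padic_int"
  assumes "red e \<noteq> 0"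
  obtains s where "s * e = 1"
proof -
  obtain b :: "'p padic_int" where b: "red b = inverse (red e)" using red_surj by blast
  have "residue 1 (1 - b * e) = 0"
    unfolding red_eq_zero_iff[symmetric] using assms by (simp add: red_hom b)
  then obtain s where "s * (1 - (1 - b * e)) = 1" by (rule one_minus_inverse)
  then show thesis using that[of "s * b"] by (simp add: mult.assoc)
qed

text \<open>If \<open>t^2 + t = c\<close>, then \<open>1 + 4 c = (1 + 2 t)^2\<close>.\<close>

lemma padic_int_square:
  fixes c :: "'p::prime_card padic_int"
  assumes "red c = 0"
  shows "\<exists>s. 1 + 4 * c = s\<^sup>2"
proof -
  obtain t where "t * t + t = c"
    using quadratic_root assms red_eq_zero_iff by blast
  then have "1 + 4 * c = (1 + 2 * t)\<^sup>2"
    by (auto simp: power2_eq_square algebra_simps)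
  then show ?thesis by blast
qed

text \<open>The quotient of \<open>e\<close> and \<open>f\<close> is congruent to 1 modulo
  \<open>p\<close>. As 4 is a unit, it has the form \<open>1 + 4 c\<close> with \<open>p\<close>
  dividing \<open>c\<close>.\<close>

lemma padic_int_square_odd:
  fixes e f :: "'p::prime_card padic_int"
  assumes p: "CARD('p) > 2" and f: "red f \<noteq> 0" and ef: "red e = red f"
  shows "\<exists>s. e = s\<^sup>2 * f"
proof -
  have "red (4 :: 'p padic_int) = 2 * 2"
    using red_hom(7)[of 4, where 'p = 'p] by simp
  moreover have "(2 :: 'p mod_ring) * 2 \<noteq> 0"
    using mod_ring_two_nonzero[OF p] by (rule no_zero_divisors) (rule mod_ring_two_nonzero[OF p])
  ultimately have "red (4 :: 'p padic_int) \<noteq> 0"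
    by (simp only: not_False_eq_True)
  then obtain q :: "'p padic_int" where q: "q * 4 = 1" by (rule padic_int_unit_inverse)
  obtain f' where f': "f' * f = 1" using padic_int_unit_inverse[OF f] .
  have "red f' * red f = 1" using f' red_hom by metis
  then have "red (q * (e * f' - 1)) = 0"
    using ef by (simp add: red_hom mult.commute)
  then obtain s where "1 + 4 * (q * (e * f' - 1)) = s\<^sup>2" using padic_int_square by blast
  moreover have "4 * (q * (e * f' - 1)) = e * f' - 1"
    using q by (metis mult.assoc mult.commute mult_1)
  ultimately have "e * f' = s\<^sup>2" by simp
  then have "e = s\<^sup>2 * f" using f' by (metis mult.assoc mult_1_right)
  then show ?thesis by blast
qed

text \<open>The quotient of \<open>e\<close> and \<open>f\<close> is congruent to 1 modulo 8, so
  it has the form \<open>1 + 4 c\<close> with even \<open>c\<close>.\<close>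

lemma padic_int_square_two:
  fixes e f :: "'p::prime_card padic_int"
  assumes p: "CARD('p) = 2" and f: "red f \<noteq> 0" and ef: "residue 3 e = residue 3 f"
  shows "\<exists>s. e = s\<^sup>2 * f"
proof -
  obtain f' where f': "f' * f = 1" using padic_int_unit_inverse[OF f] .
  have "residue 3 (e * f' - 1) = residue 3 (f * f' - 1)"
    by (simp add: residue_arith ef)
  also have "\<dots> = 0" using f' by (simp add: mult.commute residue_arith)
  finally obtain d where d: "e * f' - 1 = of_nat CARD('p) ^ 3 * d"
    by (rule residue_one_eq_zero_cases)
  have "red (2 * d) = 0"
    using red_hom(7)[of 2, where 'p = 'p] of_nat_card_eq_0[where 'a = 'p] by (simp add: red_hom p)
  then obtain s where "1 + 4 * (2 * d) = s\<^sup>2" using padic_int_square by blast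
  moreover have "4 * (2 * d) = e * f' - 1"
    using d by (simp add: p power3_eq_cube)
  ultimately have "e * f' = s\<^sup>2" by simp
  then have "e = s\<^sup>2 * f" using f' by (metis mult.assoc mult_1_right)
  then show ?thesis by blast
qed

definition emb :: "'p::prime_card padic_int \<Rightarrow> 'p padic" where
  "emb x = Fract x 1"

lemma emb_hom:
  fixes x y :: "'p::prime_card padic_int"
  shows "emb (x + y) = emb x + emb y" "emb (x - y) = emb x - emb y" "emb (x * y) = emb x * emb y"
    "emb (- x) = - emb x" "emb (0 :: 'p padic_int) = 0" "emb (1 :: 'p padic_int) = 1"
    "emb (of_nat n :: 'p padic_int) = of_nat n" "emb (x ^ k) = emb x ^ k"
proof -
  show *: "emb (x * y) = emb x * emb y" "emb (1 :: 'p padic_int) = 1" for x y :: "'p padic_int"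
    by (simp_all add: emb_def One_fract_def)
  show "emb (x ^ k) = emb x ^ k" by (induction k) (simp_all add: *)
qed (simp_all add: emb_def Zero_fract_def Fract_of_nat_eq)

lemma emb_eq_zero_iff: "emb x = 0 \<longleftrightarrow> x = 0"
  by (simp add: emb_def Zero_fract_def eq_fract)

lemma emb_eq_iff: "emb x = emb y \<longleftrightarrow> x = y"
  by (simp add: emb_def eq_fract)

lemma padic_of_nat_nonzero:
  assumes "n > 0"
  shows "(of_nat n :: 'p::prime_card padic) \<noteq> 0"
proof
  assume "(of_nat n :: 'p padic) = 0"
  then have "emb (of_nat n :: 'p padic_int) = 0" by (simp add: emb_hom)
  then have "(of_nat n :: 'p padic_int) = 0" by (simp add: emb_eq_zero_iff)
  then have zero: "residue n (of_nat n :: 'p padic_int) = 0" by (simp add: residue_arith)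
  have "n < 2 ^ n" by (rule less_exp)
  also have "\<dots> \<le> CARD('p) ^ n"
    using prime_card_gt_1[where 'p = 'p] by (intro power_mono) auto
  finally have "n < CARD('p) ^ n" .
  then have "int n < int CARD('p) ^ n" by (metis of_nat_less_iff of_nat_power)
  then show False
    using assms zero by (simp add: residue_of_nat)
qed

lemma padic_fraction:
  fixes z :: "'p::prime_card padic"
  obtains a b where "b \<noteq> 0" "z = emb a / emb b"
  by (cases z rule: Fract_cases) (simp add: emb_def divide_fract)

lemma padic_square_class:
  fixes z :: "'p::prime_card padic"
  assumes "z \<noteq> 0"
  obtains r n e where "r \<noteq> 0" "n \<in> {0, 1}" "red e \<noteq> 0" "z = r\<^sup>2 * (of_nat CARD('p) ^ n
      * emb e)"
proof -
  obtain a b where ab: "b \<noteq> 0" "z = emb a / emb b" by (rule padic_fraction)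
  have b: "emb b \<noteq> 0" using ab by (simp add: emb_eq_zero_iff)
  have "a \<noteq> 0" using assms ab by (auto simp: emb_hom)
  then obtain m e where m: "a * b = of_nat CARD('p) ^ m * e" "residue 1 e \<noteq> 0"
    using padic_int_valuation[of "a * b"] ab(1) by (metis no_zero_divisors)
  have p: "(of_nat CARD('p) :: 'p padic) \<noteq> 0"
    by (rule padic_of_nat_nonzero) (simp add: card_gt_0_iff)
  let ?P = "of_nat CARD('p) :: 'p padic"
  have "z = emb (a * b) / (emb b)\<^sup>2"
    using b by (simp add: ab(2) emb_hom power2_eq_square)
  also have "emb (a * b) = ?P ^ m * emb e"
    unfolding m(1) by (simp add: emb_hom)
  also have "?P ^ m = (?P ^ (m div 2))\<^sup>2 * ?P ^ (m mod 2)"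
    by (metis div_mult_mod_eq power_add power_mult)
  finally have "z = (?P ^ (m div 2) / emb b)\<^sup>2 * (?P ^ (m mod 2) * emb e)"
    by (simp add: power_divide)
  moreover have "m mod 2 \<in> {0, 1}" by auto
  ultimately show thesis
    using that[of "?P ^ (m div 2) / emb b" "m mod 2" e] p b m(2) red_eq_zero_iff by auto
qed

text \<open>Clear denominators and divide by the largest power of \<open>p\<close> that divides
  all four numbers.\<close>

lemma padic_primitive_quadruple:
  fixes x y z w :: "'p::prime_card padic"
  assumes nz: "x \<noteq> 0 \<or> y \<noteq> 0 \<or> z \<noteq> 0 \<or> w \<noteq> 0"
  obtains c X Y Z W where "c \<noteq> 0" "emb X = c * x" "emb Y = c * y" "emb Z = c * z" "emb W = c * w"
    "red X \<noteq> 0 \<or> red Y \<noteq> 0 \<or> red Z \<noteq> 0 \<or> red W \<noteq> 0"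
proof -
  obtain a1 b1 where 1: "b1 \<noteq> 0" "x = emb a1 / emb b1" by (rule padic_fraction)
  obtain a2 b2 where 2: "b2 \<noteq> 0" "y = emb a2 / emb b2" by (rule padic_fraction)
  obtain a3 b3 where 3: "b3 \<noteq> 0" "z = emb a3 / emb b3" by (rule padic_fraction)
  obtain a4 b4 where 4: "b4 \<noteq> 0" "w = emb a4 / emb b4" by (rule padic_fraction)
  define b where "b = emb (b1 * b2 * b3 * b4)"
  have b: "b \<noteq> 0" using 1 2 3 4 by (simp add: b_def emb_eq_zero_iff)
  define X Y Z W where XYZW: "X = a1 * b2 * b3 * b4" "Y = a2 * b1 * b3 * b4" "Z = a3 * b1 * b2 * b4" "W = a4 *
      b1 * b2 * b3"
  have emb: "emb X = b * x" "emb Y = b * y" "emb Z = b * z" "emb W = b * w"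
    using 1(1) 2(1) 3(1) 4(1) by (simp_all add: XYZW b_def 1(2) 2(2) 3(2) 4(2) emb_hom emb_eq_zero_iff)
  have "X \<noteq> 0 \<or> Y \<noteq> 0 \<or> Z \<noteq> 0 \<or> W \<noteq> 0"
    using nz b emb by (metis emb_eq_zero_iff no_zero_divisors)
  then have ex: "\<exists>n. residue n X \<noteq> 0 \<or> residue n Y \<noteq> 0 \<or> residue n Z \<noteq> 0
      \<or> residue n W \<noteq> 0"
    by (metis residue_arith(5) residue_eqI)
  let ?P = "\<lambda>n. residue n X \<noteq> 0 \<or> residue n Y \<noteq> 0 \<or> residue n Z \<noteq> 0 \<or>
      residue n W \<noteq> 0"
  define m where "m = (LEAST n. ?P n)"
  have m: "?P m" using ex unfolding m_def by (rule LeastI_ex)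
  have "residue 0 t = 0" for t :: "'p padic_int" using residue_range[of 0 t] by simp
  then obtain n where n: "m = Suc n" using m by (cases m) auto
  have "n < m" by (simp add: n)
  then have "\<not> ?P n" unfolding m_def by (rule not_less_Least)
  then have zero: "residue n X = 0" "residue n Y = 0" "residue n Z = 0" "residue n W = 0"
    by blast+
  have divide: "\<exists>T. t = of_nat CARD('p) ^ n * T \<and> (residue m t \<noteq> 0 \<longrightarrow> red T
      \<noteq> 0)"
    if t: "residue n t = 0" for t :: "'p padic_int"
  proof -
    obtain T where T: "t = of_nat CARD('p) ^ n * T" "\<forall>k. residue k T = residue (n + k) t div int
        CARD('p) ^ n"
      using t by (rule residue_one_eq_zero_cases)
    have "int CARD('p) ^ n dvd residue m t"
      using residue_Suc[of n t] t by (simp add: n mod_eq_0_iff_dvd)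
    then have "residue 1 T \<noteq> 0" if "residue m t \<noteq> 0"
      using that T(2)[rule_format, of 1] by (auto simp: n dvd_div_eq_0_iff)
    then show ?thesis using T(1) red_eq_zero_iff by blast
  qed
  obtain X' where X': "X = of_nat CARD('p) ^ n * X'" "residue m X \<noteq> 0 \<longrightarrow> red X' \<noteq>
      0" using divide zero by blast
  obtain Y' where Y': "Y = of_nat CARD('p) ^ n * Y'" "residue m Y \<noteq> 0 \<longrightarrow> red Y' \<noteq>
      0" using divide zero by blast
  obtain Z' where Z': "Z = of_nat CARD('p) ^ n * Z'" "residue m Z \<noteq> 0 \<longrightarrow> red Z' \<noteq>
      0" using divide zero by blast
  obtain W' where W': "W = of_nat CARD('p) ^ n * W'" "residue m W \<noteq> 0 \<longrightarrow> red W' \<noteq>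
      0" using divide zero by blast
  let ?p = "(of_nat CARD('p) :: 'p padic) ^ n"
  have p: "?p \<noteq> 0" using padic_of_nat_nonzero[of "CARD('p)", where 'p = 'p] by (simp add: card_gt_0_iff)
  have e: "?p * emb X' = b * x" "?p * emb Y' = b * y" "?p * emb Z' = b * z" "?p * emb W' = b * w"
    using emb unfolding X'(1) Y'(1) Z'(1) W'(1) by (simp_all add: emb_hom)
  show thesis
  proof (rule that[of "b / ?p" X' Y' Z' W'])
    show "b / ?p \<noteq> 0" using b p by simp
    show "emb X' = b / ?p * x" "emb Y' = b / ?p * y" "emb Z' = b / ?p * z" "emb W' = b / ?p * w"
      using p by (simp_all add: e[symmetric])
    show "red X' \<noteq> 0 \<or> red Y' \<noteq> 0 \<or> red Z' \<noteq> 0 \<or> red W' \<noteq> 0"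
      using m X' Y' Z' W' by blast
  qed
qed

section \<open>The p-adic numbers for odd p\<close>

text \<open>Solve the equation modulo \<open>p\<close>; the ratio of both sides is then a square.\<close>

lemma padic_unit_norm_form:
  fixes e z :: "'p::prime_card padic_int"
  assumes p: "CARD('p) > 2" and e: "red e \<noteq> 0" and z: "red z \<noteq> 0"
  obtains X Y where "e = X\<^sup>2 + z * Y\<^sup>2"
proof -
  obtain x y where xy: "red e = x\<^sup>2 + red z * y\<^sup>2"
    using finite_field_binary_universal[OF z] by blast
  obtain X Y :: "'p padic_int" where XY: "red X = x" "red Y = y" using red_surj by metis
  have "red e = red (X\<^sup>2 + z * Y\<^sup>2)"
    by (simp add: xy red_hom XY power2_eq_square)
  then obtain s where "e = s\<^sup>2 * (X\<^sup>2 + z * Y\<^sup>2)"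
    using padic_int_square_odd[OF p] e by metis
  then have "e = (s * X)\<^sup>2 + z * (s * Y)\<^sup>2"
    by (simp add: power_mult_distrib algebra_simps)
  then show thesis by (rule that)
qed

lemma least_nonsquare_pos:
  assumes "CARD('p::prime_card) > 2"
  shows "least_nonsquare TYPE('p) > 0"
  using least_nonsquare_nonsquare[OF assms, of 0] by (cases "least_nonsquare TYPE('p)") simp_all

text \<open>By the parity of the valuations, one may assume that \<open>v2\<close> is a unit,
  after exchanging the parameters or replacing \<open>v2\<close> by \<open>v1 v2\<close>. If
  \<open>v1\<close> is a unit as well, \<open>\<langle>1, v1\<rangle>\<close> represents
  \<open>-v2\<close> and the norm form is isotropic. Otherwise \<open>v1\<close> is
  \<open>p\<close> times a unit. If \<open>-v2\<close> is a square, the norm form is isotropic; if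
  not, \<open>v2\<close> is minus the least nonsquare up to squares, and as \<open>\<langle>1,
  v2\<rangle>\<close> represents all units, \<open>v1\<close> can be made \<open>-p\<close>.\<close>

lemma padic_odd_reducible:
  fixes v1 v2 :: "'p::prime_card padic"
  assumes p: "CARD('p) > 2" and nz: "v1 \<noteq> 0" "v2 \<noteq> 0"
  shows "reducible_to (- of_nat CARD('p)) (- of_nat (least_nonsquare TYPE('p))) v1 v2"
proof -
  let ?P = "of_nat CARD('p) :: 'p padic" and ?z = "of_nat (least_nonsquare TYPE('p)) :: 'p padic_int"
  let ?Z = "of_nat (least_nonsquare TYPE('p)) :: 'p padic"
  let ?R = "reducible_to (- ?P) (- ?Z)"
  have two: "(2 :: 'p padic) \<noteq> 0"
    using padic_of_nat_nonzero[of 2, where 'p = 'p] by simp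
  have P: "?P \<noteq> 0" using p by (intro padic_of_nat_nonzero) simp
  have z: "red ?z \<noteq> x\<^sup>2" for x
    using least_nonsquare_nonsquare[OF p] by (simp add: red_hom)
  have zunit: "red (- ?z) \<noteq> 0" using z[of 0] by (simp add: red_hom)
  have Z: "?Z \<noteq> 0" by (rule padic_of_nat_nonzero[OF least_nonsquare_pos[OF p]])
  have emb_nz: "emb e \<noteq> 0" if "red e \<noteq> 0" for e :: "'p padic_int"
    using that by (auto simp: emb_eq_zero_iff red_hom)
  have units: "?R (emb e) (emb f)" if ef: "red e \<noteq> 0" "red f \<noteq> 0" for e f
  proof -
    obtain X Y where "- f = X\<^sup>2 + e * Y\<^sup>2"
      using padic_unit_norm_form[OF p, of "- f" e] ef by (auto simp: red_hom)
    note XY = this[symmetric]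
    have "X\<^sup>2 + e * Y\<^sup>2 + f * 1\<^sup>2 + e * f * 0\<^sup>2 = 0"
      unfolding XY by simp
    then have "emb (X\<^sup>2 + e * Y\<^sup>2 + f * 1\<^sup>2 + e * f * 0\<^sup>2) = emb 0"
      by (rule arg_cong)
    then have "(emb X)\<^sup>2 + emb e * (emb Y)\<^sup>2 + emb f * 1\<^sup>2 + emb e * emb f * 0\<^sup>2 = 0"
      by (simp only: emb_hom)
    then have "isotropic (emb e) (emb f)"
      unfolding isotropic_def using one_neq_zero by blast
    then show ?thesis by (simp add: reducible_to_def)
  qed
  have mixed: "?R (?P * emb e) (emb f)" if ef: "red e \<noteq> 0" "red f \<noteq> 0" for e f
  proof (cases "\<exists>x. red (- f) = x\<^sup>2")
    case True
    then obtain x :: "'p padic_int" where "red (- f) = red (x\<^sup>2)"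
      using red_surj by (metis power2_eq_square red_hom(3))
    moreover have "red (- f) \<noteq> 0" using ef by (simp add: red_hom)
    ultimately have "red (x\<^sup>2) \<noteq> 0" "red (- f) = red (x\<^sup>2)" by simp_all
    then obtain s where "- f = s\<^sup>2 * x\<^sup>2" using padic_int_square_odd[OF p] by blast
    then have sx: "(s * x)\<^sup>2 = - f" by (simp add: power_mult_distrib)
    have "(s * x)\<^sup>2 + of_nat CARD('p) * e * 0\<^sup>2 + f * 1\<^sup>2 + of_nat CARD('p) * e * f *
        0\<^sup>2 = 0"
      unfolding sx by simp
    then have "emb ((s * x)\<^sup>2 + of_nat CARD('p) * e * 0\<^sup>2 + f * 1\<^sup>2 + of_nat CARD('p) * e * f
        * 0\<^sup>2) = emb 0"
      by (rule arg_cong)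
    then have "(emb s * emb x)\<^sup>2 + ?P * emb e * 0\<^sup>2 + emb f * 1\<^sup>2 + ?P * emb e * emb f *
        0\<^sup>2 = 0"
      by (simp only: emb_hom)
    then have "isotropic (?P * emb e) (emb f)"
      unfolding isotropic_def using one_neq_zero by blast
    then show ?thesis by (simp add: reducible_to_def)
  next
    case False
    then obtain s where s: "red (- f) = s\<^sup>2 * red ?z"
      using nonsquare_ratio[of "red (- f)" "red ?z"] z by metis
    then obtain S :: "'p padic_int" where "red f = red (S\<^sup>2 * (- ?z))"
      using red_surj[of s] by (auto simp: red_hom power2_eq_square) (metis add.inverse_inverse)
    moreover have "red (S\<^sup>2 * (- ?z)) \<noteq> 0" using calculation ef by simp
    ultimately obtain r where "f = r\<^sup>2 * (S\<^sup>2 * (- ?z))" using padic_int_square_odd[OF p] by blast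
    then have "emb f = emb ((r * S)\<^sup>2 * (- ?z))" by (simp add: power_mult_distrib mult.assoc)
    then have f: "emb f = (emb (r * S))\<^sup>2 * (- ?Z)"
      by (simp only: emb_hom(3,4,7,8))
    have rS: "emb (r * S) \<noteq> 0" using f emb_nz[OF ef(2)] by auto
    obtain e' where e': "e' * e = 1" using padic_int_unit_inverse[OF ef(1)] .
    then have "red e' \<noteq> 0" by (metis mult_zero_left red_hom(3,6) zero_neq_one)
    then have "red (- e') \<noteq> 0" by (simp add: red_hom)
    then obtain X Y where "- e' = X\<^sup>2 + (- ?z) * Y\<^sup>2"
      using padic_unit_norm_form[OF p _ zunit] by blast
    then have "emb (- e') = emb (X\<^sup>2 + (- ?z) * Y\<^sup>2)" by simp
    then have n: "- emb e' = (emb X)\<^sup>2 + (- ?Z) * (emb Y)\<^sup>2"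
      by (simp only: emb_hom)
    have e'nz: "emb e' \<noteq> 0" using emb_nz[OF \<open>red e' \<noteq> 0\<close>] .
    have "emb e' * emb e = 1" using e' by (metis emb_hom(3,6))
    then have "- emb e' * (?P * emb e) = - ?P" by (simp add: mult.left_commute)
    moreover have "?R (- emb e' * (?P * emb e)) (- ?Z) \<longleftrightarrow> ?R (?P * emb e) (- ?Z)"
      by (rule reducible_12[OF two _ _ _ n]) (use e'nz emb_nz[OF ef(1)] P Z in simp_all)
    ultimately have "?R (?P * emb e) (- ?Z)"
      using reducible_to_refl[of "- ?P" "- ?Z"] by (simp only:)
    then show ?thesis
      unfolding f using reducible_squares[OF two, of 1 "emb (r * S)" "?P * emb e" "- ?Z"] rS emb_nz[OF ef(1)] P
          Z
      by simp
  qed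
  have both: "?R (?P * emb e) (?P * emb f)" if ef: "red e \<noteq> 0" "red f \<noteq> 0" for e f
  proof -
    note enz = emb_nz[OF ef(1)] and fnz = emb_nz[OF ef(2)]
    have "?R (?P * emb e) (emb (e * f))"
      using ef by (intro mixed) (simp_all add: red_hom)
    then have "?R (?P * emb e) (?P\<^sup>2 * emb (e * f))"
      using reducible_squares[OF two, of 1 ?P "?P * emb e" "emb (e * f)"] enz fnz P
      by (simp add: emb_hom)
    then show ?thesis
      using reducible_mult[OF two, of "?P * emb e" "?P * emb f"] enz fnz P
      by (simp add: emb_hom power2_eq_square ac_simps)
  qed
  obtain r n e where v1: "r \<noteq> 0" "n \<in> {0, 1}" "red e \<noteq> 0" "v1 = r\<^sup>2 * (?P ^ n * emb e)"
    using padic_square_class[OF nz(1)] .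
  obtain s m f where v2: "s \<noteq> 0" "m \<in> {0, 1}" "red f \<noteq> 0" "v2 = s\<^sup>2 * (?P ^ m * emb f)"
    using padic_square_class[OF nz(2)] .
  have "?R (?P ^ n * emb e) (?P ^ m * emb f)"
    using v1(2) v2(2) units[OF v1(3) v2(3)] mixed[OF v1(3) v2(3)] mixed[OF v2(3) v1(3)] both[OF v1(3) v2(3)]
      reducible_swap[OF two, of "emb e" "?P * emb f"] emb_nz[OF v1(3)] emb_nz[OF v2(3)] P by auto
  then show ?thesis
    unfolding v1(4) v2(4)
    using reducible_squares[OF two v1(1) v2(1), of "?P ^ n * emb e" "?P ^ m * emb f"] emb_nz[OF v1(3)]
        emb_nz[OF v2(3)] P
    by simp
qed

text \<open>The form \<open>\<langle>1, v2\<rangle>\<close> represents all units and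
  \<open>\<langle>1, v1\<rangle>\<close> represents \<open>-p\<close>; up to squares these
  generate all nonzero scalars.\<close>

lemma padic_odd_similarity:
  fixes n :: "'p::prime_card padic"
  assumes p: "CARD('p) > 2" and n: "n \<noteq> 0"
  shows "similarity_factor (- of_nat CARD('p)) (- of_nat (least_nonsquare TYPE('p))) n"
proof -
  let ?P = "of_nat CARD('p) :: 'p padic" and ?z = "of_nat (least_nonsquare TYPE('p)) :: 'p padic_int"
  let ?Z = "of_nat (least_nonsquare TYPE('p)) :: 'p padic"
  let ?S = "similarity_factor (- ?P) (- ?Z)"
  have P: "?P \<noteq> 0" using p by (intro padic_of_nat_nonzero) simp
  have z: "red ?z \<noteq> x\<^sup>2" for x
    using least_nonsquare_nonsquare[OF p] by (simp add: red_hom)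
  have zunit: "red (- ?z) \<noteq> 0" using z[of 0] by (simp add: red_hom)
  have Z: "?Z \<noteq> 0" by (rule padic_of_nat_nonzero[OF least_nonsquare_pos[OF p]])
  have unit: "?S (emb e)" if e: "red e \<noteq> 0" for e
  proof -
    obtain X Y where "e = X\<^sup>2 + (- ?z) * Y\<^sup>2"
      using padic_unit_norm_form[OF p e zunit] .
    then have "emb e = (emb X)\<^sup>2 + (- ?Z) * (emb Y)\<^sup>2"
      by (simp only: emb_hom)
    moreover have "emb e \<noteq> 0" using e by (auto simp: emb_eq_zero_iff red_hom)
    ultimately show ?thesis using P Z by (intro similarity_factor_norm_2) auto
  qed
  have "?S (- ?P)" using P Z by (intro similarity_factor_norm_1[of _ _ _ 0 1]) auto
  moreover have "?S (- 1)" using unit[of "- 1"] by (simp add: red_hom emb_hom)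
  ultimately have "?S ?P" using similarity_factor_mult[of "- ?P" "- ?Z" "- 1" "- ?P"] by simp
  obtain r m e where n': "r \<noteq> 0" "m \<in> {0, 1}" "red e \<noteq> 0" "n = r\<^sup>2 * (?P ^ m * emb e)"
    using padic_square_class[OF n] .
  have "?S (?P ^ m * emb e)"
    using n'(2) unit[OF n'(3)] similarity_factor_mult[OF \<open>?S ?P\<close> unit[OF n'(3)]] by auto
  moreover have "?S (r\<^sup>2)"
    using n'(1) P Z by (intro similarity_factor_square) auto
  ultimately show ?thesis
    unfolding n'(4) by (rule similarity_factor_mult[rotated])
qed

text \<open>Modulo \<open>p\<close>, a primitive zero satisfies \<open>x^2 = Z z^2\<close> for the
  nonsquare \<open>Z\<close>, so \<open>p\<close> divides \<open>x\<close> and \<open>z\<close>.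
  After division by \<open>p\<close> the same argument applies to \<open>y\<close> and
  \<open>w\<close>.\<close>

lemma padic_odd_anisotropic:
  assumes p: "CARD('p::prime_card) > 2"
  shows "\<not> isotropic (- of_nat CARD('p)) (- of_nat (least_nonsquare TYPE('p)) :: 'p padic)"
proof
  let ?P = "of_nat CARD('p) :: 'p padic_int" and ?z = "of_nat (least_nonsquare TYPE('p)) :: 'p padic_int"
  assume "isotropic (- of_nat CARD('p)) (- of_nat (least_nonsquare TYPE('p)) :: 'p padic)"
  then obtain x y z w where nz: "x \<noteq> 0 \<or> y \<noteq> 0 \<or> z \<noteq> 0 \<or> w \<noteq> 0"
    and eq: "x\<^sup>2 + - emb ?P * y\<^sup>2 + - emb ?z * z\<^sup>2 + - emb ?P * - emb ?z * w\<^sup>2 = 0"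
    by (auto simp: isotropic_def emb_hom)
  obtain c X Y Z W where c: "c \<noteq> 0" and emb: "emb X = c * x" "emb Y = c * y" "emb Z = c * z" "emb W = c
      * w"
    and prim: "red X \<noteq> 0 \<or> red Y \<noteq> 0 \<or> red Z \<noteq> 0 \<or> red W \<noteq> 0"
    using padic_primitive_quadruple[OF nz] .
  have "(c * x)\<^sup>2 + - emb ?P * (c * y)\<^sup>2 + - emb ?z * (c * z)\<^sup>2 + - emb ?P * - emb ?z * (c *
      w)\<^sup>2
      = c\<^sup>2 * (x\<^sup>2 + - emb ?P * y\<^sup>2 + - emb ?z * z\<^sup>2 + - emb ?P * - emb ?z * w\<^sup>2)"
    by (simp add: power2_eq_square algebra_simps)
  then have "emb (X\<^sup>2 + - ?P * Y\<^sup>2 + - ?z * Z\<^sup>2 + - ?P * - ?z * W\<^sup>2) = emb 0"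
    unfolding emb_hom(1,3,4,8) emb eq by (simp add: emb_hom(5))
  then have int: "X\<^sup>2 + - ?P * Y\<^sup>2 + - ?z * Z\<^sup>2 + - ?P * - ?z * W\<^sup>2 = 0"
    by (simp only: emb_eq_iff)
  have redP: "red ?P = 0" by (simp add: red_hom)
  have aniso: "red A = 0 \<and> red B = 0" if "red (A\<^sup>2) = red (?z * B\<^sup>2)" for A B :: "'p padic_int"
  proof -
    have *: "(red A)\<^sup>2 = red ?z * (red B)\<^sup>2" using that by (simp add: red_hom power2_eq_square)
    have "red B = 0"
    proof (rule ccontr)
      assume "red B \<noteq> 0"
      then have "red ?z = (red A / red B)\<^sup>2" using * by (simp add: power_divide)
      then show False using least_nonsquare_nonsquare[OF p] by (simp add: red_hom)
    qed
    then show ?thesis using * by simp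
  qed
  have divide: "\<exists>T. t = ?P * T" if "red t = 0" for t :: "'p padic_int"
    using residue_one_eq_zero_cases[of 1 t] that red_eq_zero_iff[of t] by (metis power_one_right)
  have "red (X\<^sup>2 + - ?P * Y\<^sup>2 + - ?z * Z\<^sup>2 + - ?P * - ?z * W\<^sup>2) = 0"
    by (simp only: int red_hom)
  then have "red (X\<^sup>2) = red (?z * Z\<^sup>2)"
    by (simp add: red_hom redP)
  then have XZ: "red X = 0" "red Z = 0" using aniso by blast+
  then obtain X' Z' where X': "X = ?P * X'" and Z': "Z = ?P * Z'" using divide by metis
  have "?P * (?P * (X'\<^sup>2 - ?z * Z'\<^sup>2) - (Y\<^sup>2 - ?z * W\<^sup>2)) = 0"
    using int by (simp add: X' Z' power2_eq_square algebra_simps)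
  moreover have "?P \<noteq> 0"
    using padic_of_nat_nonzero[of "CARD('p)", where 'p = 'p] p emb_eq_zero_iff[of ?P] by (simp add: emb_hom)
  ultimately have "Y\<^sup>2 - ?z * W\<^sup>2 = ?P * (X'\<^sup>2 - ?z * Z'\<^sup>2)" by simp
  then have "red (Y\<^sup>2 - ?z * W\<^sup>2) = 0" by (simp only: red_hom(3) redP mult_zero_left)
  then have "red (Y\<^sup>2) = red (?z * W\<^sup>2)" by (simp add: red_hom)
  then have "red Y = 0" "red W = 0" using aniso by blast+
  then show False using prim XZ by blast
qed

section \<open>The 2-adic numbers\<close>

text \<open>The number \<open>k\<close> represents the square class of \<open>z\<close>.\<close>

definition num_class :: "'k::field \<Rightarrow> nat \<Rightarrow> bool" where
  "num_class z k \<longleftrightarrow> (\<exists>r. r \<noteq> 0 \<and> z = r\<^sup>2 * of_nat k)"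

lemma padic_two_square_class:
  fixes z :: "'p::prime_card padic"
  assumes p: "CARD('p) = 2" and z: "z \<noteq> 0"
  shows "\<exists>k\<in>{1, 3, 5, 7, 2, 6, 10, 14}. num_class z k"
proof -
  obtain r n e where z: "r \<noteq> 0" "n \<in> {0, 1}" "red e \<noteq> 0" "z = r\<^sup>2 * (of_nat CARD('p) ^
      n * emb e)"
    using padic_square_class[OF z] .
  have p1: "residue 1 e = 1"
    using z(3) residue_range[of 1 e] unfolding red_eq_zero_iff p by simp
  have odd: "residue 3 e mod 2 = 1"
    using residue_add[of 1 2 e] p1 unfolding p by (simp add: numeral_3_eq_3)
  have range: "0 \<le> residue 3 e" "residue 3 e < 8"
    using residue_range[of 3 e] unfolding p by simp_all
  define m where "m = nat (residue 3 e)"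
  have m: "m \<in> {1, 3, 5, 7}"
  proof -
    have "residue 3 e \<in> {1, 3, 5, 7}" using odd range by (auto; presburger)
    then show ?thesis by (auto simp: m_def)
  qed
  have m3: "residue 3 e = residue 3 (of_nat m :: 'p padic_int)"
    using range unfolding residue_of_nat p m_def by simp
  have "odd m" using m by auto
  then have "int m mod int CARD('p) \<noteq> 0" unfolding p by presburger
  then have "residue 1 (of_nat m :: 'p padic_int) \<noteq> 0" unfolding residue_of_nat by simp
  then have "red (of_nat m :: 'p padic_int) \<noteq> 0" unfolding red_eq_zero_iff .
  then obtain s where "e = s\<^sup>2 * of_nat m" using padic_int_square_two[OF p _ m3] by blast
  then have e: "emb e = (emb s)\<^sup>2 * of_nat m" using emb_hom by metis
  have "emb s \<noteq> 0"
    using z(3) e by (auto simp: emb_eq_zero_iff red_hom emb_hom)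
  then have "num_class z (2 ^ n * m)"
    unfolding num_class_def using z(1) by (intro exI[of _ "r * emb s"]) (simp add: z(4) e p power_mult_distrib
        ac_simps)
  then show ?thesis using z(2) m by auto
qed

lemma padic_two_square:
  fixes z :: "'p::prime_card padic"
  assumes p: "CARD('p) = 2" and m: "m mod 8 = (1 :: int)"
  shows "\<exists>a :: 'p padic. of_int m = a\<^sup>2"
proof -
  have "residue 3 (of_int m :: 'p padic_int) = residue 3 (1 :: 'p padic_int)"
    unfolding residue_of_int residue_arith p using m by simp
  then obtain s where "(of_int m :: 'p padic_int) = s\<^sup>2 * 1"
    using padic_int_square_two[OF p, of 1] by (auto simp: red_hom)
  then have "emb (of_int m :: 'p padic_int) = (emb s)\<^sup>2" using emb_hom by (metis mult_1_right)
  moreover have "emb (of_int m :: 'p padic_int) = of_int m"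
    by (cases m rule: int_cases2) (simp_all add: emb_hom)
  ultimately show ?thesis by metis
qed

text \<open>What the classification over the 2-adic numbers uses of this field: the eight square
  classes, and that integers congruent to 1 modulo 8 are squares.\<close>

locale two_adic_like =
  fixes ty :: "'k::field itself"
  assumes char0: "\<And>n. n > 0 \<Longrightarrow> (of_nat n :: 'k) \<noteq> 0"
    and classes: "\<And>z :: 'k. z \<noteq> 0 \<Longrightarrow> \<exists>k\<in>{1, 3, 5, 7, 2, 6, 10, 14}.
        num_class z k"
    and square: "\<And>m. m mod 8 = 1 \<Longrightarrow> \<exists>a :: 'k. of_int m = a\<^sup>2"
begin

lemma two: "(2::'k) \<noteq> 0" using char0[of 2] by simp

abbreviation "R \<equiv> reducible_to (1::'k) 1"

lemma numerals: "(numeral n :: 'k) \<noteq> 0"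
  using char0[of "numeral n"] by simp

lemma class_left:
  assumes "num_class z k" "k > 0" "y \<noteq> 0"
  shows "R z y \<longleftrightarrow> R (of_nat k) y"
proof -
  obtain r where "r \<noteq> 0" "z = r\<^sup>2 * of_nat k" using assms by (auto simp: num_class_def)
  then show ?thesis
    using reducible_squares[OF two, where a=r and b=1] char0 assms(2,3) by simp
qed

lemma class_right:
  assumes "num_class z k" "k > 0" "y \<noteq> 0"
  shows "R y z \<longleftrightarrow> R y (of_nat k)"
proof -
  obtain r where "r \<noteq> 0" "z = r\<^sup>2 * of_nat k" using assms by (auto simp: num_class_def)
  then show ?thesis
    using reducible_squares[OF two, where a=1 and b=r] char0 assms(2,3) by simp
qed

lemma of_int_nonzero: "m \<noteq> 0 \<Longrightarrow> (of_int m :: 'k) \<noteq> 0"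
  using char0 by (cases m rule: int_cases2) auto

lemma square_mult:
  assumes "a * b mod 8 = (1::int)" "a \<noteq> 0" "b \<noteq> 0"
  obtains c :: 'k where "c \<noteq> 0" "of_int a = c\<^sup>2 * of_int b"
proof -
  obtain c :: 'k where c: "of_int (a * b) = c\<^sup>2" using square[OF assms(1)] by blast
  have nz: "(of_int a :: 'k) \<noteq> 0" "(of_int b :: 'k) \<noteq> 0"
    using of_int_nonzero[OF assms(2)] of_int_nonzero[OF assms(3)] by simp_all
  have "c / of_int b \<noteq> 0" using c nz by auto
  moreover have "of_int a = (c / of_int b)\<^sup>2 * of_int b"
    using c nz by (simp add: power_divide power2_eq_square[of "of_int b"] flip: c)
  ultimately show thesis by (rule that)
qed

lemma class_numI:
  assumes "a * b mod 8 = (1::int)" "a > 0" "b > 0" "d > 0" "e > 0"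
  shows "num_class (of_int (a * d\<^sup>2 * e) :: 'k) (nat (b * e))"
proof -
  obtain c :: 'k where c: "c \<noteq> 0" "of_int a = c\<^sup>2 * of_int b"
    using square_mult[OF assms(1)] assms by auto
  have "(of_int d :: 'k) \<noteq> 0"
    using of_int_nonzero assms by auto
  moreover have "of_int (a * d\<^sup>2 * e) = (c * of_int d)\<^sup>2 * (of_nat (nat (b * e)) :: 'k)"
    using assms by (simp add: c(2) power_mult_distrib ac_simps)
  ultimately show ?thesis
    unfolding num_class_def using c(1) by (intro exI[of _ "c * of_int d"]) simp
qed

lemma R_isotropic: "x\<^sup>2 + v1 * y\<^sup>2 + v2 * z\<^sup>2 + v1 * v2 * w\<^sup>2 = 0 \<Longrightarrow> x
    \<noteq> 0 \<or> y \<noteq> 0 \<or> z \<noteq> 0 \<or> w \<noteq> 0 \<Longrightarrow> R v1 v2"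
  unfolding reducible_to_def isotropic_def by blast

text \<open>Up to squares, either \<open>w\<close> or \<open>-w\<close> is 1, 2, 5 or 10, a sum of
  two squares. In the first case \<open>w\<close> can be made 1, in the second the norm form is
  isotropic.\<close>

lemma R_one:
  assumes w: "(w::'k) \<noteq> 0"
  shows "R 1 w"
proof -
  have sum: "R 1 (of_nat k)" if "of_nat k = X\<^sup>2 + 1 * (Y\<^sup>2 :: 'k)" "k > 0" for k X Y
  proof -
    have "R 1 (of_nat k * 1) \<longleftrightarrow> R 1 1"
      by (rule reducible_23[OF two _ _ _ that(1)]) (use that(2) char0 in simp_all)
    then show ?thesis
      using reducible_to_refl[of "1::'k" 1] by simp
  qed
  have neg: "R 1 (of_nat k)" if "of_int (- int k) = (X::'k)\<^sup>2 + Y\<^sup>2" for k X Y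
  proof (rule R_isotropic[of X _ Y _ 1 0])
    show "X\<^sup>2 + 1 * Y\<^sup>2 + of_nat k * 1\<^sup>2 + 1 * of_nat k * 0\<^sup>2 = 0"
      using that[symmetric] by simp
  qed simp
  obtain a :: 'k where a: "of_int (- 7) = a\<^sup>2" using square[of "- 7"] by auto
  obtain c :: 'k where c: "of_int (- 3) = c\<^sup>2 * of_int 5" using square_mult[of "- 3" 5] by auto
  have "R 1 (of_nat 1)" "R 1 (of_nat 2)" "R 1 (of_nat 5)" "R 1 (of_nat 10)"
    using sum[of 1 1 0] sum[of 2 1 1] sum[of 5 2 1] sum[of 10 3 1] by simp_all
  moreover have "R 1 (of_nat 7)" using neg[of 7 a 0] a by simp
  moreover have "R 1 (of_nat 14)"
  proof (rule neg[of 14 a a])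
    show "of_int (- int 14) = a\<^sup>2 + a\<^sup>2" unfolding a[symmetric] by simp
  qed
  moreover have "R 1 (of_nat 3)"
  proof (rule neg[of 3 "2 * c" c])
    have "(2 * c)\<^sup>2 + c\<^sup>2 = c\<^sup>2 * of_int 5" by (simp add: power_mult_distrib)
    then show "of_int (- int 3) = (2 * c)\<^sup>2 + c\<^sup>2" unfolding c[symmetric] by simp
  qed
  moreover have "R 1 (of_nat 6)"
  proof (rule neg[of 6 "3 * c" c])
    have "(3 * c)\<^sup>2 + c\<^sup>2 = 2 * (c\<^sup>2 * of_int 5)" by (simp add: power_mult_distrib)
    then show "of_int (- int 6) = (3 * c)\<^sup>2 + c\<^sup>2" unfolding c[symmetric] by simp
  qed
  moreover obtain k where "k \<in> {1, 3, 5, 7, 2, 6, 10, 14}" "num_class w k" using classes[OF w] by blast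
  ultimately show ?thesis
    using class_right[of w k 1] by auto
qed

text \<open>Since \<open>-7\<close> is a square, \<open>\<langle>1, 7\<rangle>\<close> is
  isotropic.\<close>

lemma R_seven:
  assumes w: "(w::'k) \<noteq> 0"
  shows "R (of_nat 7) w"
proof -
  obtain a :: 'k where a: "of_int (- 7) = a\<^sup>2" using square[of "- 7"] by auto
  show ?thesis
    using a by (intro R_isotropic[of a _ 1 _ 0 0]) (simp_all add: add_eq_0_iff)
qed

lemma R_norm:
  assumes "of_nat n = X\<^sup>2 + of_nat v * (Y::'k)\<^sup>2" "n > 0" "v > 0" "k > 0"
    and "num_class (of_nat (n * k) :: 'k) m" "m > 0" "R (of_nat v) (of_nat m)"
  shows "R (of_nat v) (of_nat k)"
proof -
  have "R (of_nat v) (of_nat n * of_nat k) \<longleftrightarrow> R (of_nat v) (of_nat k)"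
    using assms char0 by (intro reducible_23[OF two]) auto
  moreover have "R (of_nat v) (of_nat (n * k)) \<longleftrightarrow> R (of_nat v) (of_nat m)"
    using assms char0 by (intro class_right) auto
  ultimately show ?thesis using assms(7) by simp
qed

text \<open>If \<open>a b\<close> is congruent to 1 modulo 8, then \<open>a\<close> and
  \<open>b\<close> have the same square class. The decomposition \<open>n = a d^2 e\<close> splits
  off a square and a common factor.\<close>

lemma class_of_nat: "num_class (of_nat n :: 'k) m"
  if "n = a * d\<^sup>2 * e" "m = b * e" "a * b mod 8 = 1" "a > 0" "b > 0" "d > 0" "e > 0"
proof -
  have "int a * int b mod 8 = int (a * b mod 8)" by (simp add: zmod_int)
  then have "int a * int b mod 8 = 1" using that(3) by simp
  then have "num_class (of_int (int a * (int d)\<^sup>2 * int e) :: 'k) (nat (int b * int e))"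
    using that by (intro class_numI) auto
  moreover have "nat (int b * int e) = m" by (simp add: that(2) nat_mult_distrib)
  moreover have "of_int (int a * (int d)\<^sup>2 * int e) = (of_nat n :: 'k)" by (simp add: that(1))
  ultimately show ?thesis by simp
qed

text \<open>The form \<open>\<langle>1, 3\<rangle>\<close> represents 1, 3, 5 and 7 up to squares,
  so \<open>w\<close> can be made 1 or 6. In the latter case \<open>V\<close> is
  \<open>\<langle>3, 2, 6\<rangle>\<close> up to squares and represents \<open>9 = 3 + 6\<close>,
  so the first parameter can be made 1.\<close>

lemma R_three:
  assumes w: "(w::'k) \<noteq> 0"
  shows "R (of_nat 3) w"
proof -
  have one: "R (of_nat 3) (of_nat 1)"
    using R_one[of "of_nat 3"] numerals reducible_swap[OF two, of 1 "of_nat 3" 1 1] by simp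
  obtain c :: 'k where c: "of_int 5 = c\<^sup>2 * of_int 13" using square_mult[of 5 13] by auto
  have n5: "of_nat 5 = c\<^sup>2 + of_nat 3 * (2 * c)\<^sup>2"
  proof -
    have "c\<^sup>2 + of_nat 3 * (2 * c)\<^sup>2 = c\<^sup>2 * of_int 13" by (simp add: power_mult_distrib)
    then show ?thesis unfolding c[symmetric] by simp
  qed
  have six: "R (of_nat 3) (of_nat 6)"
  proof -
    have eq: "(3::'k) = 1\<^sup>2 + 3 * 6 * (1 / 3)\<^sup>2"
      using numerals by (simp add: power2_eq_square)
    have "R (3 * 3) (3 * 6) \<longleftrightarrow> R 3 6"
      by (rule reducible_13[OF two _ _ _ eq]) (use numerals in simp_all)
    moreover have "R (3\<^sup>2 * 1) (3\<^sup>2 * 2) \<longleftrightarrow> R 1 2"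
      using numerals by (intro reducible_squares[OF two]) auto
    ultimately show ?thesis using R_one[of 2] numerals by (simp add: power2_eq_square)
  qed
  have "R (of_nat 3) (of_nat 3)"
    by (rule R_norm[of 3 0 3 1 3 1]) (use one class_of_nat[of 9 1 3 1 1 1] in simp_all)
  moreover have "R (of_nat 3) (of_nat 7)"
    by (rule R_norm[of 7 2 3 1 7 1]) (use one class_of_nat[of 49 1 7 1 1 1] in simp_all)
  moreover have "R (of_nat 3) (of_nat 5)"
    by (rule R_norm[of 5 c 3 "2 * c" 5 1]) (use one n5 class_of_nat[of 25 1 5 1 1 1] in simp_all)
  moreover have "R (of_nat 3) (of_nat 2)"
    by (rule R_norm[of 3 0 3 1 2 6]) (use six class_of_nat[of 6 1 1 6 6 1] in simp_all)
  moreover have "R (of_nat 3) (of_nat 10)"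
    by (rule R_norm[of 7 2 3 1 10 6]) (use six class_of_nat[of 70 35 1 2 6 3] in simp_all)
  moreover have "R (of_nat 3) (of_nat 14)"
    by (rule R_norm[of 5 c 3 "2 * c" 14 6]) (use six n5 class_of_nat[of 70 35 1 2 6 3] in simp_all)
  moreover obtain k where "k \<in> {1, 3, 5, 7, 2, 6, 10, 14}" "num_class w k" using classes[OF w] by blast
  ultimately show ?thesis
    using one six class_right[of w k "of_nat 3"] numerals by auto
qed

text \<open>The form \<open>\<langle>1, 5\<rangle>\<close> represents 1, 5, 6 and 14. Up to
  squares these are one half of the classes and 7 lies in the other half, so \<open>w\<close> can
  be made 1 or 7.\<close>

lemma R_five:
  assumes w: "(w::'k) \<noteq> 0"
  shows "R (of_nat 5) w"
proof -
  have one: "R (of_nat 5) (of_nat 1)"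
    using R_one[of "of_nat 5"] numerals reducible_swap[OF two, of 1 "of_nat 5" 1 1] by simp
  have seven: "R (of_nat 5) (of_nat 7)"
    using R_seven[of "of_nat 5"] numerals reducible_swap[OF two, of "of_nat 7" "of_nat 5" 1 1] by simp
  have "R (of_nat 5) (of_nat 5)"
    by (rule R_norm[of 5 0 5 1 5 1]) (use one class_of_nat[of 25 1 5 1 1 1] in simp_all)
  moreover have "R (of_nat 5) (of_nat 6)"
    by (rule R_norm[of 6 1 5 1 6 1]) (use one class_of_nat[of 36 1 6 1 1 1] in simp_all)
  moreover have "R (of_nat 5) (of_nat 14)"
    by (rule R_norm[of 14 3 5 1 14 1]) (use one class_of_nat[of 196 1 14 1 1 1] in simp_all)
  moreover have "R (of_nat 5) (of_nat 3)"
    by (rule R_norm[of 5 0 5 1 3 7]) (use seven class_of_nat[of 15 15 1 1 7 7] in simp_all)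
  moreover have "R (of_nat 5) (of_nat 2)"
    by (rule R_norm[of 14 3 5 1 2 7]) (use seven class_of_nat[of 28 1 2 7 7 1] in simp_all)
  moreover have "R (of_nat 5) (of_nat 10)"
    by (rule R_norm[of 6 1 5 1 10 7]) (use seven class_of_nat[of 60 15 2 1 7 7] in simp_all)
  moreover obtain k where "k \<in> {1, 3, 5, 7, 2, 6, 10, 14}" "num_class w k" using classes[OF w] by blast
  ultimately show ?thesis
    using one seven class_right[of w k "of_nat 5"] numerals by auto
qed

text \<open>The four preceding lemmas cover odd square classes of \<open>v\<close>, and by
  symmetry of \<open>w\<close>. If both classes are even, then \<open>v w\<close> has an odd class
  and can replace \<open>w\<close>.\<close>

lemma R_all:
  assumes v: "(v::'k) \<noteq> 0" and w: "(w::'k) \<noteq> 0"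
  shows "R v w"
proof -
  have odd: "R z y" if "k \<in> {1, 3, 5, 7}" "num_class z k" "z \<noteq> 0" "y \<noteq> 0" for z y :: 'k and k
    using class_left[OF that(2) _ that(4)] that(1) R_one[OF that(4)] R_three[OF that(4)]
      R_five[OF that(4)] R_seven[OF that(4)] by auto
  obtain k where k: "k \<in> {1, 3, 5, 7, 2, 6, 10, 14}" "num_class v k" using classes[OF v] by blast
  obtain l where l: "l \<in> {1, 3, 5, 7, 2, 6, 10, 14}" "num_class w l" using classes[OF w] by blast
  consider "k \<in> {1, 3, 5, 7}" | "l \<in> {1, 3, 5, 7}" | "k \<in> {2, 6, 10, 14}" "l \<in> {2, 6, 10, 14}"
    using k(1) l(1) by blast
  then show ?thesis
  proof cases
    case 1
    then show ?thesis using odd k(2) v w by blast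
  next
    case 2
    then show ?thesis using odd[OF 2 l(2) w v] reducible_swap[OF two v w] by blast
  next
    case 3
    obtain r s where "r \<noteq> 0" "v = r\<^sup>2 * of_nat k" "s \<noteq> 0" "w = s\<^sup>2 * of_nat l"
      using k(2) l(2) by (auto simp: num_class_def)
    moreover obtain k' l' where kl: "k = 2 * k'" "l = 2 * l'" "k' \<in> {1, 3, 5, 7}" "l' \<in> {1, 3, 5, 7}"
      using 3 by fastforce
    ultimately have "v * w = (2 * r * s)\<^sup>2 * of_nat (k' * l')" "2 * r * s \<noteq> 0"
      using two by (simp_all add: power2_eq_square)
    then have class_vw: "num_class (v * w) (k' * l')" unfolding num_class_def by blast
    have "\<exists>m\<in>{1, 3, 5, 7}. num_class (v * w) m"
    proof -
      have "\<exists>m\<in>{1, 3, 5, 7}. (k' * l') * m mod 8 = 1"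
        using kl(3,4) by auto
      then obtain m where m: "m \<in> {1, 3, 5, 7}" "(k' * l') * m mod 8 = 1" by blast
      then have "num_class (of_nat (k' * l') :: 'k) m"
        using kl(3,4) by (intro class_of_nat[of _ "k' * l'" 1 1 _ m]) auto
      then obtain t where "t \<noteq> 0" "of_nat (k' * l') = t\<^sup>2 * (of_nat m :: 'k)" by (auto simp:
          num_class_def)
      moreover obtain q where "q \<noteq> 0" "v * w = q\<^sup>2 * of_nat (k' * l')" using class_vw by (auto
          simp: num_class_def)
      ultimately have "v * w = (q * t)\<^sup>2 * of_nat m" "q * t \<noteq> 0" by (simp_all add:
          power_mult_distrib)
      then show ?thesis using m(1) unfolding num_class_def by blast
    qed
    then have "R (v * w) v" using odd v w by (metis no_zero_divisors)
    then have "R v (v * w)" using reducible_swap[OF two, of "v * w" v] v w by simp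
    then show ?thesis using reducible_mult[OF two v w] by blast
  qed
qed

text \<open>The form \<open>\<langle>1, 1\<rangle>\<close> represents 2 and 5. Moreover \<open>V =
  \<langle>1, 1, 1\<rangle>\<close> is isometric to \<open>\<langle>2, 1, 2\<rangle>\<close> up to
  squares, and \<open>\<langle>1, 2\<rangle>\<close> represents 3. As 15 has the class of 7, the
  factors 2, 3 and 5 generate all square classes.\<close>

lemma similarity_one_one:
  assumes n: "(n::'k) \<noteq> 0"
  shows "similarity_factor (1::'k) 1 n"
proof -
  let ?S = "similarity_factor (1::'k) 1"
  have 2: "?S 2"
    by (rule similarity_factor_norm_1[of _ _ _ 1 1]) (use numerals in simp_all)
  have 5: "?S 5"
    by (rule similarity_factor_norm_1[of _ _ _ 2 1]) (use numerals in simp_all)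
  have 1: "?S 1"
    by (rule similarity_factor_norm_1[of _ _ _ 1 0]) simp_all
  have 3: "?S 3"
  proof -
    have "similarity_factor (2::'k) 2 3"
      using numerals by (intro similarity_factor_norm_1[of _ _ _ 1 1]) simp_all
    moreover have "torus_congruent (2 * 1, 2 * 1) (1, 1 :: 'k)"
      using numerals by (intro torus_congruent_13[of _ _ _ 1 1]) simp_all
    ultimately show ?thesis
      using similarity_factor_congruent[of 2 2 "1::'k" 1 3] numerals by simp
  qed
  have sq: "?S (r\<^sup>2 * x)" if "r \<noteq> 0" "?S x" for r x
    using that by (intro similarity_factor_mult similarity_factor_square) auto
  (* 7 * 15 = 105 is congruent to 1 modulo 8. *)
  obtain f :: 'k where f: "f \<noteq> 0" "of_int 7 = f\<^sup>2 * of_int 15"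
    using square_mult[of 7 15] by auto
  have "?S (3 * 5)" using 3 5 by (rule similarity_factor_mult)
  then have "?S (f\<^sup>2 * (3 * 5))" using f(1) by (intro sq)
  then have 7: "?S 7" using f(2) by simp
  have "?S 6" "?S 10" "?S 14"
    using similarity_factor_mult[OF 2 3] similarity_factor_mult[OF 2 5] similarity_factor_mult[OF 2 7]
    by simp_all
  then have "\<forall>k\<in>{1, 3, 5, 7, 2, 6, 10, 14}. ?S (of_nat k)"
    using 1 2 3 5 7 by simp
  moreover obtain k where "k \<in> {1, 3, 5, 7, 2, 6, 10, 14}" "num_class n k" using classes[OF n] by blast
  ultimately show ?thesis
    using sq unfolding num_class_def by blast
qed

end

text \<open>Four integers whose squares have a sum divisible by 8 are all even.\<close>

lemma padic_two_anisotropic: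
  assumes p: "CARD('p::prime_card) = 2"
  shows "\<not> isotropic (1 :: 'p padic) 1"
proof
  assume "isotropic (1 :: 'p padic) 1"
  then obtain x y z w :: "'p padic" where nz: "x \<noteq> 0 \<or> y \<noteq> 0 \<or> z \<noteq> 0 \<or> w
      \<noteq> 0"
    and eq: "x\<^sup>2 + y\<^sup>2 + z\<^sup>2 + w\<^sup>2 = 0"
    by (auto simp: isotropic_def)
  obtain c X Y Z W where c: "c \<noteq> 0" and emb: "emb X = c * x" "emb Y = c * y" "emb Z = c * z" "emb W = c
      * w"
    and prim: "red X \<noteq> 0 \<or> red Y \<noteq> 0 \<or> red Z \<noteq> 0 \<or> red W \<noteq> 0"
    using padic_primitive_quadruple[OF nz] .
  have "(c * x)\<^sup>2 + (c * y)\<^sup>2 + (c * z)\<^sup>2 + (c * w)\<^sup>2 = c\<^sup>2 * (x\<^sup>2 +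
      y\<^sup>2 + z\<^sup>2 + w\<^sup>2)"
    by (simp add: power2_eq_square algebra_simps)
  then have "emb (X\<^sup>2 + Y\<^sup>2 + Z\<^sup>2 + W\<^sup>2) = emb 0"
    unfolding emb_hom(1,8) emb eq by (simp add: emb_hom(5))
  then have int: "X\<^sup>2 + Y\<^sup>2 + Z\<^sup>2 + W\<^sup>2 = 0"
    by (simp only: emb_eq_iff)
  define s where "s t = residue 3 t" for t :: "'p padic_int"
  have "residue 3 (X\<^sup>2 + Y\<^sup>2 + Z\<^sup>2 + W\<^sup>2) = (s X ^ 2 + s Y ^ 2 + s Z ^ 2 + s W ^ 2) mod
      8"
    by (simp add: residue_arith power2_eq_square p s_def mod_simps)
  then have sum: "(s X ^ 2 + s Y ^ 2 + s Z ^ 2 + s W ^ 2) mod 8 = 0"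
    unfolding int by (simp add: residue_arith)
  have sq: "(even t \<longrightarrow> t\<^sup>2 mod 8 = 0 \<or> t\<^sup>2 mod 8 = 4) \<and> (odd t
      \<longrightarrow> t\<^sup>2 mod 8 = 1)" for t :: int
  proof -
    define r where "r = t mod 8"
    have "r = 0 \<or> r = 1 \<or> r = 2 \<or> r = 3 \<or> r = 4 \<or> r = 5 \<or> r = 6 \<or> r = 7"
      unfolding r_def by presburger
    moreover have "even t \<longleftrightarrow> even r"
      unfolding r_def by presburger
    moreover have "t\<^sup>2 mod 8 = r\<^sup>2 mod 8"
      unfolding r_def by (simp add: power_mod)
    ultimately show ?thesis
      by (elim disjE) simp_all
  qed
  have red_even: "red t = 0 \<longleftrightarrow> even (s t)" for t :: "'p padic_int"
  proof -
    have "residue 3 t mod 2 = residue 1 t"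
      using residue_add[of 1 2 t] unfolding p by (simp add: numeral_3_eq_3)
    then show ?thesis
      unfolding red_eq_zero_iff s_def even_iff_mod_2_eq_zero by (simp only:)
  qed
  have "even (s X) \<and> even (s Y) \<and> even (s Z) \<and> even (s W)"
  proof -
    have sum8: "((s X)\<^sup>2 mod 8 + (s Y)\<^sup>2 mod 8 + (s Z)\<^sup>2 mod 8 + (s W)\<^sup>2 mod 8) mod 8 =
        0"
    proof -
      have "(a mod 8 + b mod 8 + c mod 8 + d mod 8) mod 8 = (a + b + c + d) mod 8" for a b c d :: int
        by (intro mod_add_cong mod_mod_trivial)
      then show ?thesis by (simp only: sum)
    qed
    have key: "A \<and> B \<and> C \<and> D"
      if "A \<and> (a = 0 \<or> a = 4) \<or> \<not> A \<and> a = 1" "B \<and> (b = 0 \<or> b = 4) \<or> \<not>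
          B \<and> b = 1"
        "C \<and> (c = 0 \<or> c = 4) \<or> \<not> C \<and> c = 1" "D \<and> (d = 0 \<or> d = 4) \<or> \<not> D
            \<and> d = 1"
        and "(a + b + c + d) mod 8 = 0" for A B C D and a b c d :: int
      using that by (elim disjE conjE) simp_all
    have cases: "even t \<and> (t\<^sup>2 mod 8 = 0 \<or> t\<^sup>2 mod 8 = 4) \<or> \<not> even t \<and>
        t\<^sup>2 mod 8 = 1" for t :: int
      using sq[of t] by blast
    show ?thesis
      by (rule key[OF cases cases cases cases sum8])
  qed
  then show False using prim red_even by blast
qed

section \<open>Representatives of the classes\<close>

text \<open>If all binary forms \<open>\<langle>1, c\<rangle>\<close> are universal, then first
  \<open>x\<close> and then \<open>y\<close> can be made 1 in a form \<open>T(x, y)\<close>.\<close>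

lemma gt_conj_of_universal:
  fixes u1 :: "'k::field"
  assumes univ: "\<And>c n :: 'k. c \<noteq> 0 \<Longrightarrow> \<exists>X Y. n = X\<^sup>2 + c * Y\<^sup>2"
    and nz: "u1 \<noteq> 0" "u2 \<noteq> 0" "v1 \<noteq> 0" "v2 \<noteq> 0"
  shows "gt_conj (u1, u2, v1, v2) (1, 1, 1, 1)"
proof -
  have step: "\<exists>w. w \<noteq> 0 \<and> torus_congruent (1, w) (x, y) \<and> torus_congruent (1, 1) (1,
      w)"
    if xy: "x \<noteq> 0" "y \<noteq> 0" for x y :: 'k
  proof -
    obtain X Y where n: "1 / x = X\<^sup>2 + x * y * Y\<^sup>2" using univ[of "x * y" "1 / x"] xy by auto
    define w where "w = 1 / x * y"
    have w: "w \<noteq> 0" using xy by (simp add: w_def)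
    obtain X' Y' where m: "1 / w = X'\<^sup>2 + 1 * Y'\<^sup>2" using univ[of 1 "1 / w"] by auto
    have "torus_congruent (1 / x * x, 1 / x * y) (x, y)"
      using xy by (intro torus_congruent_13[OF _ _ n]) auto
    moreover have "torus_congruent (1, 1 / w * w) (1, w)"
      using w by (intro torus_congruent_23[OF _ _ m]) auto
    moreover have "1 / x * x = 1" "1 / w * w = 1"
      using xy w by simp_all
    ultimately have "torus_congruent (1, w) (x, y)" "torus_congruent (1, 1) (1, w)"
      by (simp_all only: w_def)
    then show ?thesis using w by blast
  qed
  obtain w where w: "w \<noteq> 0" "torus_congruent (1, w) (v1, v2)" "torus_congruent (1, 1) (1, w)"
    using step[OF nz(3,4)] by blast
  obtain t where t: "t \<noteq> 0" "torus_congruent (1, t) (u1, u2)" "torus_congruent (1, 1) (1, t)"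
    using step[OF nz(1,2)] by blast
  have "gt_conj (1, 1, 1, 1) (1, t, 1, w)"
    using t w by (intro gt_conj_congruent) auto
  also have "gt_conj \<dots> (u1, u2, v1, v2)"
    using t w nz by (intro gt_conj_congruent) auto
  finally show ?thesis by (rule gt_conj_sym)
qed

lemma class_representatives_of_universal:
  assumes two: "(2::'k::field) \<noteq> 0"
    and univ: "\<And>c n :: 'k. c \<noteq> 0 \<Longrightarrow> \<exists>X Y. n = X\<^sup>2 + c * Y\<^sup>2"
  shows "class_representatives {(1, 1, 1, 1) :: 'k \<times> 'k \<times> 'k \<times> 'k}"
proof (rule class_representativesI[OF two])
  fix \<tau> :: "'k \<times> 'k \<times> 'k \<times> 'k" assume "\<tau> \<in> torus_params"
  then show "\<exists>\<sigma>\<in>{(1, 1, 1, 1)}. gt_conj \<sigma> \<tau>"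
    using gt_conj_of_universal[OF univ] by (auto simp: torus_params_def intro: gt_conj_sym)
qed (auto simp: torus_params_def)

lemma alg_closed_square_root:
  obtains y :: "'a::alg_closed_field" where "x = y\<^sup>2"
  using nth_root_exists[of 2 x] by auto

lemma two_nonzero_of_char:
  assumes "CHAR('a::idom) \<noteq> 2"
  shows "(2::'a) \<noteq> 0"
proof
  assume "(2::'a) = 0"
  then have "CHAR('a) dvd 2" using of_nat_eq_0_iff_char_dvd[of 2, where 'a = 'a] by simp
  then have "CHAR('a) = 1 \<or> CHAR('a) = 2" using two_is_prime_nat prime_nat_iff by blast
  then show False using assms of_nat_CHAR[where 'a = 'a] by auto
qed

lemma isotropic_minus_one: "isotropic (- 1) (1::'k::field)"
  unfolding isotropic_def by (intro exI[of _ 1] exI[of _ 0]) auto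

text \<open>Whenever one anisotropic norm form \<open>\<langle>1, d1, d2, d1 d2\<rangle>\<close>
  accounts for all, and every scalar is a similarity factor for it, there are exactly two classes,
  and the type of the quaternion algebra distinguishes them.\<close>

lemma two_classes:
  fixes d1 d2 :: "'k::field"
  assumes two: "(2::'k) \<noteq> 0" and d: "d1 \<noteq> 0" "d2 \<noteq> 0"
    and red: "\<And>v1 v2. v1 \<noteq> 0 \<Longrightarrow> v2 \<noteq> 0 \<Longrightarrow> reducible_to d1 d2
        v1 v2"
    and sim: "\<And>n. n \<noteq> 0 \<Longrightarrow> similarity_factor d1 d2 n"
    and aniso: "\<not> isotropic d1 d2"
  shows "class_representatives {(1, 1, - 1, 1), (1, 1, d1, d2)} \<and>
    (\<forall>\<tau>\<in>torus_params. (fixed_split \<tau> \<longleftrightarrow> gt_isomorphic (1, 1, - 1, 1)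
        \<tau>) \<and>
      (fixed_division \<tau> \<longleftrightarrow> gt_isomorphic (1, 1, d1, d2) \<tau>))"
proof -
  have params: "(1, 1, - 1, 1) \<in> torus_params" "(1, 1, d1, d2) \<in> torus_params"
    using d by (auto simp: torus_params_def)
  have split: "gt_conj (1, 1, - 1, 1) (u1, u2, v1, v2) \<longleftrightarrow> isotropic v1 v2"
    and division: "gt_conj (1, 1, d1, d2) (u1, u2, v1, v2) \<longleftrightarrow> \<not> isotropic v1 v2"
    if nz: "u1 \<noteq> 0" "u2 \<noteq> 0" "v1 \<noteq> 0" "v2 \<noteq> 0" for u1 u2 v1 v2
  proof -
    show "gt_conj (1, 1, - 1, 1) (u1, u2, v1, v2) \<longleftrightarrow> isotropic v1 v2"
      using gt_conj_of_isotropic[OF two nz] gt_conj_isotropic[OF two _ _ _ _ nz, of 1 1 "- 1" 1]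
        isotropic_minus_one by (auto intro: gt_conj_sym)
    have "gt_conj (u1, u2, v1, v2) (1, 1, d1, d2)" if "\<not> isotropic v1 v2"
    proof -
      have "gt_conj (u1, u2, v1, v2) (u1, u2, d1, d2)"
        using red[OF nz(3,4)] that nz by (simp add: reducible_to_def)
      also have "gt_conj \<dots> (1, 1, d1, d2)"
        by (rule gt_conj_collapse_u[OF two nz(1,2) d sim])
      finally show ?thesis .
    qed
    then show "gt_conj (1, 1, d1, d2) (u1, u2, v1, v2) \<longleftrightarrow> \<not> isotropic v1 v2"
      using gt_conj_isotropic[OF two _ _ d nz, of 1 1] aniso by (auto intro: gt_conj_sym)
  qed
  have reps: "class_representatives {(1, 1, - 1, 1), (1, 1, d1, d2)}"
  proof (rule class_representativesI[OF two])
    fix \<tau> :: "'k \<times> 'k \<times> 'k \<times> 'k" assume "\<tau> \<in> torus_params"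
    then show "\<exists>\<sigma>\<in>{(1, 1, - 1, 1), (1, 1, d1, d2)}. gt_conj \<sigma> \<tau>"
      using split division by (cases \<tau>) (auto simp: torus_params_def)
  next
    fix \<sigma> \<sigma>' :: "'k \<times> 'k \<times> 'k \<times> 'k"
    assume "\<sigma> \<in> {(1, 1, - 1, 1), (1, 1, d1, d2)}" "\<sigma>' \<in> {(1, 1, - 1, 1), (1, 1, d1, d2)}"
        "gt_conj \<sigma> \<sigma>'"
    then show "\<sigma> = \<sigma>'"
      using split[of 1 1 d1 d2] division[of 1 1 "- 1" 1] d aniso isotropic_minus_one by auto
  qed (use params in auto)
  moreover have "(fixed_split \<tau> \<longleftrightarrow> gt_isomorphic (1, 1, - 1, 1) \<tau>) \<and>
      (fixed_division \<tau> \<longleftrightarrow> gt_isomorphic (1, 1, d1, d2) \<tau>)" if \<tau>: "\<tau>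
          \<in> torus_params" for \<tau>
  proof -
    have "gt_isomorphic (1, 1, - 1, 1) \<tau> \<longleftrightarrow> gt_conj (1, 1, - 1, 1) \<tau>"
      "gt_isomorphic (1, 1, d1, d2) \<tau> \<longleftrightarrow> gt_conj (1, 1, d1, d2) \<tau>"
      using isomorphic_of_gt_conj gt_conj_of_isomorphic[OF two] params \<tau> by blast+
    then show ?thesis
      using \<tau> split division fixed_types[OF two] by (cases \<tau>) (auto simp: torus_params_def)
  qed
  ultimately show ?thesis by blast
qed

lemma real_isotropic:
  fixes v1 v2 :: real
  assumes nz: "v1 \<noteq> 0" "v2 \<noteq> 0"
  shows "isotropic v1 v2 \<longleftrightarrow> \<not> (v1 > 0 \<and> v2 > 0)"
proof
  assume iso: "isotropic v1 v2"
  show "\<not> (v1 > 0 \<and> v2 > 0)"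
  proof
    assume pos: "v1 > 0 \<and> v2 > 0"
    obtain x y z w where nz': "x \<noteq> 0 \<or> y \<noteq> 0 \<or> z \<noteq> 0 \<or> w \<noteq> 0"
      and eq: "x\<^sup>2 + v1 * y\<^sup>2 + v2 * z\<^sup>2 + v1 * v2 * w\<^sup>2 = 0"
      using iso by (auto simp: isotropic_def)
    have ge: "x\<^sup>2 \<ge> 0" "v1 * y\<^sup>2 \<ge> 0" "v2 * z\<^sup>2 \<ge> 0" "v1 * v2 * w\<^sup>2 \<ge> 0"
      using pos by simp_all
    then have "x\<^sup>2 = 0" "v1 * y\<^sup>2 = 0" "v2 * z\<^sup>2 = 0" "v1 * v2 * w\<^sup>2 = 0"
      using eq by linarith+
    then show False using nz nz' by simp
  qed
next
  assume "\<not> (v1 > 0 \<and> v2 > 0)"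
  then consider "v1 < 0" | "v2 < 0" using nz by linarith
  then show "isotropic v1 v2"
  proof cases
    case 1
    then show ?thesis unfolding isotropic_def
      by (intro exI[of _ "sqrt (- v1)"] exI[of _ 1] exI[of _ 0]) simp
  next
    case 2
    then show ?thesis unfolding isotropic_def
      by (intro exI[of _ "sqrt (- v2)"] exI[of _ 0] exI[of _ 1]) simp
  qed
qed

text \<open>The norm of a quaternion in terms of its coordinates.\<close>

definition quat_form :: "real \<Rightarrow> real \<Rightarrow> real \<times> real \<times> real \<times> real
    \<Rightarrow> real" where
  "quat_form w1 w2 = (\<lambda>(x, b, c, e). x\<^sup>2 + b\<^sup>2 / w1 + c\<^sup>2 / w2 + e\<^sup>2 * w1 * w2)"

lemma quat_form_pos:
  assumes "w1 > 0" "w2 > 0"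
  shows "quat_form w1 w2 q \<ge> 0" "quat_form w1 w2 q = 0 \<longleftrightarrow> q = 0"
proof -
  obtain x b c e where q: "q = (x, b, c, e)" by (cases q)
  have ge: "x\<^sup>2 \<ge> 0" "b\<^sup>2 / w1 \<ge> 0" "c\<^sup>2 / w2 \<ge> 0" "e\<^sup>2 * w1 * w2 \<ge> 0"
    using assms by simp_all
  then show "quat_form w1 w2 q \<ge> 0" by (simp add: quat_form_def q)
  have "x\<^sup>2 = 0" "b\<^sup>2 / w1 = 0" "c\<^sup>2 / w2 = 0" "e\<^sup>2 * w1 * w2 = 0" if "quat_form w1 w2
      q = 0"
    using that ge unfolding quat_form_def q prod.case by linarith+
  then have "q = 0" if "quat_form w1 w2 q = 0"
    using that assms by (simp add: q zero_prod_def)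
  moreover have "quat_form w1 w2 0 = 0"
    by (simp add: quat_form_def zero_prod_def)
  ultimately show "quat_form w1 w2 q = 0 \<longleftrightarrow> q = 0"
    by blast
qed

lemma albert_Q_fixed_elem:
  fixes u1 u2 v1 v2 :: real
  assumes nz: "u1 \<noteq> 0" "u2 \<noteq> 0" "v1 \<noteq> 0" "v2 \<noteq> 0"
  shows "albert_Q (fixed_elem u1 (u2 / u1) (1 / u2) v1 (v2 / v1) (1 / v2) ((d1, d2, d3), q1, q2, q3)) =
    (d1\<^sup>2 + d2\<^sup>2 + d3\<^sup>2) / 2 + u1\<^sup>2 / u2 * quat_form v1 (v2 / v1) q1 + u2\<^sup>2 / u1
        * quat_form v1 (v2 / v1) q2
      + 1 / (u1 * u2) * quat_form v1 (v2 / v1) q3"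
proof -
  obtain x1 b1 c1 e1 where q1: "q1 = (x1, b1, c1, e1)" by (cases q1)
  obtain x2 b2 c2 e2 where q2: "q2 = (x2, b2, c2, e2)" by (cases q2)
  obtain x3 b3 c3 e3 where q3: "q3 = (x3, b3, c3, e3)" by (cases q3)
  have sq: "albert_mult (fixed_elem u1 (u2 / u1) (1 / u2) v1 (v2 / v1) (1 / v2) c) (fixed_elem u1 (u2 / u1) (1
      / u2) v1 (v2 / v1) (1 / v2) c)
     = fixed_elem u1 (u2 / u1) (1 / u2) v1 (v2 / v1) (1 / v2) (coords_square u1 (u2 / u1) (1 / u2) v1 (v2 / v1)
         c)" for c
    using nz by (intro fixed_elem_square) auto
  have Tr: "albert_Tr (fixed_elem u1 (u2 / u1) (1 / u2) v1 (v2 / v1) (1 / v2) c) =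
      fst (fst c) + fst (snd (fst c)) + snd (snd (fst c))" for c
    by (cases rule: coordsE[of c]) (simp add: fixed_elem_def albert_Tr_def trace_def sum_3)
  show ?thesis
    unfolding albert_Q_def sq Tr using nz
    by (simp add: q1 q2 q3 coords_square_def Let_def quat_form_def) (simp add: field_simps power2_eq_square)
qed

text \<open>In coordinates \<open>Q\<close> is the orthogonal sum of \<open>\<langle>1/2, 1/2,
  1/2\<rangle>\<close> and of three multiples of the norm form, which is positive definite. The
  signs of the multiples are those of \<open>u2\<close>, \<open>u1\<close> and \<open>u1
  u2\<close>.\<close>

lemma real_fixed_Q:
  fixes u1 u2 v1 v2 :: real
  assumes nz: "u1 \<noteq> 0" "u2 \<noteq> 0" and v: "v1 > 0" "v2 > 0"
  shows "Q_positive_definite (gt_fixed (u1, u2, v1, v2)) \<longleftrightarrow> u1 > 0 \<and> u2 > 0"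
    and "Q_indefinite (gt_fixed (u1, u2, v1, v2)) \<longleftrightarrow> \<not> (u1 > 0 \<and> u2 > 0)"
proof -
  let ?S = "gt_fixed (u1, u2, v1, v2)"
  let ?\<Phi> = "fixed_elem u1 (u2 / u1) (1 / u2) v1 (v2 / v1) (1 / v2)"
  have nz': "v1 \<noteq> 0" "v2 \<noteq> 0" "v2 / v1 > 0" using v by simp_all
  note Q = albert_Q_fixed_elem[OF nz nz'(1,2)] and mem = fixed_elem_in_gt_fixed[OF nz nz'(1,2)]
    and N = quat_form_pos[OF v(1) nz'(3)]
  have N0: "quat_form v1 (v2 / v1) (0, 0, 0, 0) = 0" "quat_form v1 (v2 / v1) (1, 0, 0, 0) = 1"
    by (simp_all add: quat_form_def)
  have pd: "Q_positive_definite ?S" if u: "u1 > 0" "u2 > 0"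
    unfolding Q_positive_definite_def
  proof (intro ballI impI)
    fix a assume a: "a \<in> ?S" "a \<noteq> 0"
    obtain c where c: "a = ?\<Phi> c" using gt_fixed_eq_fixed_elem[OF nz nz'(1,2) a(1)] by metis
    obtain d1 d2 d3 q1 q2 q3 where c': "c = ((d1, d2, d3), q1, q2, q3)" by (metis prod.exhaust)
    define A B C E where "A = u1\<^sup>2 / u2 * quat_form v1 (v2 / v1) q1"
      and "B = u2\<^sup>2 / u1 * quat_form v1 (v2 / v1) q2" and "C = 1 / (u1 * u2) * quat_form v1 (v2 / v1) q3"
      and "E = (d1\<^sup>2 + d2\<^sup>2 + d3\<^sup>2) / 2"
    have Qa: "albert_Q a = E + A + B + C"
      unfolding c c' Q A_def B_def C_def E_def ..
    have ge: "A \<ge> 0" "B \<ge> 0" "C \<ge> 0" "E \<ge> 0"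
      using u N(1) by (simp_all add: A_def B_def C_def E_def)
    have "albert_Q a \<ge> 0" unfolding Qa using ge by linarith
    moreover have "albert_Q a \<noteq> 0"
    proof
      assume "albert_Q a = 0"
      then have "A = 0" "B = 0" "C = 0" and E: "E = 0"
        unfolding Qa using ge by linarith+
      then have "q1 = 0" "q2 = 0" "q3 = 0"
        using nz N(2) by (simp_all add: A_def B_def C_def)
      moreover have "d1 = 0 \<and> d2 = 0 \<and> d3 = 0"
        using E by (simp add: E_def add_nonneg_eq_0_iff)
      ultimately have "c = 0" by (simp add: c' zero_prod_def)
      then have "a = 0" unfolding c by (simp add: fixed_elem_def zero_prod_def mat3_simps)
      then show False using a(2) by simp
    qed
    ultimately show "albert_Q a > 0" by linarith
  qed
  have indef: "Q_indefinite ?S" if u: "\<not> (u1 > 0 \<and> u2 > 0)"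
  proof -
    have "albert_Q (?\<Phi> ((1, 0, 0), (0, 0, 0, 0), (0, 0, 0, 0), (0, 0, 0, 0))) > 0"
      by (simp add: Q N0)
    moreover have "\<exists>c. albert_Q (?\<Phi> c) < 0"
    proof (cases "u2 < 0")
      case True
      then have "albert_Q (?\<Phi> ((0, 0, 0), (1, 0, 0, 0), (0, 0, 0, 0), (0, 0, 0, 0))) < 0"
        using nz by (simp add: Q N0 divide_neg_neg divide_pos_neg)
      then show ?thesis by blast
    next
      case False
      then have "u1 < 0" using u nz by linarith
      then have "albert_Q (?\<Phi> ((0, 0, 0), (0, 0, 0, 0), (1, 0, 0, 0), (0, 0, 0, 0))) < 0"
        using nz by (simp add: Q N0 divide_pos_neg)
      then show ?thesis by blast
    qed
    ultimately show ?thesis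
      unfolding Q_indefinite_def using mem by blast
  qed
  have excl: "\<not> (Q_positive_definite ?S \<and> Q_indefinite ?S)"
  proof
    assume H: "Q_positive_definite ?S \<and> Q_indefinite ?S"
    then obtain a where a: "a \<in> ?S" "albert_Q a < 0" unfolding Q_indefinite_def by blast
    have "?\<Phi> ((0, 0, 0), (0, 0, 0, 0), (0, 0, 0, 0), (0, 0, 0, 0)) = 0"
      by (simp add: fixed_elem_def zero_prod_def mat3_simps)
    then have "albert_Q (0 :: real albert) = 0"
      using Q[of 0 0 0 "(0, 0, 0, 0)" "(0, 0, 0, 0)" "(0, 0, 0, 0)"] by (simp only: N0) simp
    then have "a \<noteq> 0" using a(2) by force
    then have "albert_Q a > 0" using H a(1) unfolding Q_positive_definite_def by blast
    then show False using a(2) by linarith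
  qed
  show "Q_positive_definite ?S \<longleftrightarrow> u1 > 0 \<and> u2 > 0" using pd indef excl by blast
  show "Q_indefinite ?S \<longleftrightarrow> \<not> (u1 > 0 \<and> u2 > 0)" using pd indef excl by blast
qed

text \<open>The fixed algebra of one involution contains a nonzero element of square zero. On the
  fixed algebra of the other one \<open>Q\<close> is positive definite, so there is no such
  element.\<close>

lemma real_compact_not_conj: "\<not> gt_conj (1, 1, 1, 1) (- 1, 1, 1, 1 :: real)"
proof
  assume conj: "gt_conj (1, 1, 1, 1) (- 1, 1, 1, 1 :: real)"
  obtain h where h: "h \<in> carrier albert_Aut" "bij_betw h (gt_fixed (- 1, 1, 1, 1)) (gt_fixed (1, 1, 1, 1 ::
      real))"
    using gt_conj_fixed_bij[OF gt_conj_sym[OF conj]] .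
  (* The block with rows (1, 1) and (-1, -1) in the last two coordinates of the first matrix. *)
  define a where "a = fixed_elem (- 1) (1 / - 1) (1 / 1) 1 (1 / 1) (1 / 1 :: real)
    ((0, 1, - 1), (0, 0, 0, 0), (1, 0, 0, 0), (0, 0, 0, 0))"
  have a: "a \<in> gt_fixed (- 1, 1, 1, 1)"
    unfolding a_def by (rule fixed_elem_in_gt_fixed) auto
  have "albert_mult a a = fixed_elem (- 1) (1 / - 1) (1 / 1) 1 (1 / 1) (1 / 1 :: real)
     (coords_square (- 1) (1 / - 1) (1 / 1) 1 (1 / 1) ((0, 1, - 1), (0, 0, 0, 0), (1, 0, 0, 0), (0, 0, 0, 0)))"
    unfolding a_def by (rule fixed_elem_square) auto
  also have "\<dots> = 0"
    by (simp add: coords_square_def Let_def fixed_elem_def zero_prod_def mat3_simps)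
  finally have "albert_mult (h a) (h a) = 0"
    using Aut_albert_mult[OF h(1), of a a] Aut_zero[OF h(1)] by simp
  then have "albert_Q (h a) = 0"
    by (simp add: albert_Q_def albert_Tr_def zero_prod_def trace_def)
  moreover have "h a \<in> gt_fixed (1, 1, 1, 1)"
    using h(2) a by (auto simp: bij_betw_def)
  moreover have "Q_positive_definite (gt_fixed (1, 1, 1, 1))"
    using real_fixed_Q(1)[of 1 1 1 1] by simp
  ultimately have "h a = 0"
    unfolding Q_positive_definite_def by (metis less_irrefl)
  then have "a = 0"
    using Aut_bij[OF h(1)] Aut_zero[OF h(1)] by (metis bij_pointE)
  moreover have "fst a $ 2 $ 2 = 1"
    by (simp add: a_def fixed_elem_def)
  ultimately show False
    by simp
qed

lemma real_conj:
  fixes u1 u2 v1 v2 :: real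
  assumes nz: "u1 \<noteq> 0" "u2 \<noteq> 0" "v1 \<noteq> 0" "v2 \<noteq> 0"
  shows "gt_conj (1, 1, - 1, 1) (u1, u2, v1, v2) \<longleftrightarrow> \<not> (v1 > 0 \<and> v2 > 0)"
    and "gt_conj (1, 1, 1, 1) (u1, u2, v1, v2) \<longleftrightarrow> v1 > 0 \<and> v2 > 0 \<and> u1 > 0 \<and>
        u2 > 0"
    and "gt_conj (- 1, 1, 1, 1) (u1, u2, v1, v2) \<longleftrightarrow> v1 > 0 \<and> v2 > 0 \<and> \<not> (u1 >
        0 \<and> u2 > 0)"
proof -
  let ?\<tau> = "(u1, u2, v1, v2)"
  have two: "(2::real) \<noteq> 0" by simp
  show split: "gt_conj (1, 1, - 1, 1) ?\<tau> \<longleftrightarrow> \<not> (v1 > 0 \<and> v2 > 0)"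
    unfolding real_isotropic[OF nz(3,4), symmetric]
    using gt_conj_sym[OF gt_conj_of_isotropic[OF two nz]] gt_conj_isotropic[OF two _ _ _ _ nz, of 1 1 "- 1" 1]
      isotropic_minus_one by auto
  have only_pos: "v1 > 0 \<and> v2 > 0" if "gt_conj (s, 1, 1, 1) ?\<tau>" "s \<noteq> 0" for s
    using gt_conj_isotropic[OF two that(2) _ _ _ nz that(1)] real_isotropic[of 1 1] real_isotropic[OF nz(3,4)]
        by auto
  have sgn: "torus_congruent (x, y) (sgn x, sgn y)" if "x \<noteq> 0" "y \<noteq> 0" for x y :: real
  proof -
    have "(sqrt \<bar>x\<bar>)\<^sup>2 * sgn x = x" "(sqrt \<bar>y\<bar>)\<^sup>2 * sgn y = y" by (simp_all
        add: abs_mult_sgn)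
    then show ?thesis
      using torus_congruent_squares[of "sqrt \<bar>x\<bar>" "sqrt \<bar>y\<bar>" "sgn x" "sgn y"] that by (simp
          add: sgn_eq_0_iff)
  qed
  have to_sgn: "gt_conj ?\<tau> (sgn u1, sgn u2, 1, 1)" if "v1 > 0" "v2 > 0"
    using sgn[OF nz(1,2)] sgn[OF nz(3,4)] that nz by (intro gt_conj_congruent) (auto simp: sgn_eq_0_iff)
  have pos: "gt_conj (1, 1, 1, 1) ?\<tau>" if "v1 > 0" "v2 > 0" "u1 > 0" "u2 > 0"
    using gt_conj_sym[OF to_sgn[OF that(1,2)]] that by simp
  have neg: "gt_conj (- 1, 1, 1, 1) ?\<tau>" if v: "v1 > 0" "v2 > 0" and u: "\<not> (u1 > 0 \<and> u2 > 0)"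
  proof -
    have "torus_congruent (sgn u1, sgn u2) (- 1, 1)"
    proof -
      consider "u1 < 0" "u2 > 0" | "u1 > 0" "u2 < 0" | "u1 < 0" "u2 < 0" using u nz by linarith
      then show ?thesis
      proof cases
        case 1
        then show ?thesis by (simp add: torus_congruent_refl)
      next
        case 2
        then show ?thesis using torus_congruent_swap[of "- 1 :: real" 1] by simp
      next
        case 3
        then show ?thesis using torus_congruent_23[of "- 1 :: real" 1 "- 1" 0 1] by simp
      qed
    qed
    then have "gt_conj (sgn u1, sgn u2, 1, 1) (- 1, 1, 1, 1)"
      using nz by (intro gt_conj_congruent_u) (auto simp: sgn_eq_0_iff)
    with to_sgn[OF v] have "gt_conj ?\<tau> (- 1, 1, 1, 1)" by (rule gt_conj_trans)
    then show ?thesis by (rule gt_conj_sym)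
  qed
  have excl: "\<not> (gt_conj (1, 1, 1, 1) ?\<tau> \<and> gt_conj (- 1, 1, 1, 1) ?\<tau>)"
    using real_compact_not_conj gt_conj_trans[OF _ gt_conj_sym] by blast
  show "gt_conj (1, 1, 1, 1) ?\<tau> \<longleftrightarrow> v1 > 0 \<and> v2 > 0 \<and> u1 > 0 \<and> u2 > 0"
    using only_pos[OF _ one_neq_zero] pos neg excl by blast
  show "gt_conj (- 1, 1, 1, 1) ?\<tau> \<longleftrightarrow> v1 > 0 \<and> v2 > 0 \<and> \<not> (u1 > 0 \<and>
      u2 > 0)"
    using only_pos[of "- 1"] pos neg excl by auto
qed

lemma real_case:
  "class_representatives {(1, 1, -1, 1), (1, 1, 1, 1), (-1, 1, 1, 1) :: real \<times> real \<times> real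
      \<times> real} \<and>
      (\<forall>\<tau> \<in> torus_params :: (real \<times> real \<times> real \<times> real) set.
        (fixed_split \<tau> \<longleftrightarrow> gt_isomorphic (1, 1, -1, 1) \<tau>) \<and>
        (fixed_division \<tau> \<and> Q_positive_definite (gt_fixed \<tau>) \<longleftrightarrow> gt_isomorphic
            (1, 1, 1, 1) \<tau>) \<and>
        (fixed_division \<tau> \<and> Q_indefinite (gt_fixed \<tau>) \<longleftrightarrow> gt_isomorphic (-1,
            1, 1, 1) \<tau>))"
proof
  have two: "(2::real) \<noteq> 0" by simp
  let ?T = "{(1, 1, -1, 1), (1, 1, 1, 1), (-1, 1, 1, 1) :: real \<times> real \<times> real \<times> real}"
  have params: "?T \<subseteq> torus_params" by (simp add: torus_params_def)
  show "class_representatives ?T"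
  proof (rule class_representativesI[OF two params])
    fix \<tau> :: "real \<times> real \<times> real \<times> real" assume "\<tau> \<in> torus_params"
    then show "\<exists>\<sigma>\<in>?T. gt_conj \<sigma> \<tau>"
      using real_conj by (cases \<tau>) (auto simp: torus_params_def)
  next
    fix \<sigma> \<sigma>' assume "\<sigma> \<in> ?T" "\<sigma>' \<in> ?T" "gt_conj \<sigma> \<sigma>'"
    then show "\<sigma> = \<sigma>'"
      using real_conj[of 1 1 "- 1" 1] real_conj[of 1 1 1 1] real_conj[of "- 1" 1 1 1] by auto
  qed
  show "\<forall>\<tau> \<in> torus_params :: (real \<times> real \<times> real \<times> real) set.
        (fixed_split \<tau> \<longleftrightarrow> gt_isomorphic (1, 1, -1, 1) \<tau>) \<and>
        (fixed_division \<tau> \<and> Q_positive_definite (gt_fixed \<tau>) \<longleftrightarrow> gt_isomorphic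
            (1, 1, 1, 1) \<tau>) \<and>
        (fixed_division \<tau> \<and> Q_indefinite (gt_fixed \<tau>) \<longleftrightarrow> gt_isomorphic (-1,
            1, 1, 1) \<tau>)"
  proof
    fix \<tau> :: "real \<times> real \<times> real \<times> real" assume \<tau>: "\<tau> \<in> torus_params"
    obtain u1 u2 v1 v2 where \<tau>_eq: "\<tau> = (u1, u2, v1, v2)" and nz: "u1 \<noteq> 0" "u2 \<noteq> 0" "v1
        \<noteq> 0" "v2 \<noteq> 0"
      using \<tau> by (auto simp: torus_params_def)
    have iff: "gt_isomorphic \<sigma> \<tau> \<longleftrightarrow> gt_conj \<sigma> \<tau>" if "\<sigma> \<in>
        ?T" for \<sigma>
      using that params \<tau> isomorphic_of_gt_conj gt_conj_of_isomorphic[OF two] by blast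
    have iff': "gt_isomorphic (1, 1, - 1, 1) \<tau> \<longleftrightarrow> gt_conj (1, 1, - 1, 1) \<tau>"
      "gt_isomorphic (1, 1, 1, 1) \<tau> \<longleftrightarrow> gt_conj (1, 1, 1, 1) \<tau>"
      "gt_isomorphic (- 1, 1, 1, 1) \<tau> \<longleftrightarrow> gt_conj (- 1, 1, 1, 1) \<tau>"
      by (rule iff, simp)+
    show "(fixed_split \<tau> \<longleftrightarrow> gt_isomorphic (1, 1, -1, 1) \<tau>) \<and>
        (fixed_division \<tau> \<and> Q_positive_definite (gt_fixed \<tau>) \<longleftrightarrow> gt_isomorphic
            (1, 1, 1, 1) \<tau>) \<and>
        (fixed_division \<tau> \<and> Q_indefinite (gt_fixed \<tau>) \<longleftrightarrow> gt_isomorphic (-1,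
            1, 1, 1) \<tau>)"
      unfolding iff' unfolding \<tau>_eq real_conj[OF nz] fixed_types[OF two nz] real_isotropic[OF nz(3,4)]
      using real_fixed_Q[OF nz(1,2), of v1 v2] by blast
  qed
qed

lemma padic_two_case:
  assumes p: "CARD('p::prime_card) = 2"
  shows "class_representatives {(1, 1, -1, 1), (1, 1, 1, 1) :: 'p padic \<times> 'p padic \<times> 'p padic
      \<times> 'p padic} \<and>
        (\<forall>\<tau> \<in> torus_params :: ('p padic \<times> 'p padic \<times> 'p padic \<times> 'p padic)
            set.
          (fixed_split \<tau> \<longleftrightarrow> gt_isomorphic (1, 1, -1, 1) \<tau>) \<and>
          (fixed_division \<tau> \<longleftrightarrow> gt_isomorphic (1, 1, 1, 1) \<tau>))"
proof -
  interpret two_adic_like "TYPE('p padic)"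
    using padic_of_nat_nonzero padic_two_square_class[OF p] padic_two_square[OF p] by unfold_locales
  show ?thesis
    by (rule two_classes[OF two _ _ R_all similarity_one_one padic_two_anisotropic[OF p]]) auto
qed

lemma padic_odd_case:
  assumes p: "CARD('p::prime_card) > 2"
  shows "let d = (1, 1, - of_nat CARD('p), - of_nat (least_nonsquare TYPE('p))) in
        class_representatives {(1, 1, -1, 1), d :: 'p padic \<times> 'p padic \<times> 'p padic \<times> 'p
            padic} \<and>
        (\<forall>\<tau> \<in> torus_params.
          (fixed_split \<tau> \<longleftrightarrow> gt_isomorphic (1, 1, -1, 1) \<tau>) \<and>
          (fixed_division \<tau> \<longleftrightarrow> gt_isomorphic d \<tau>))"
  unfolding Let_def
proof (rule two_classes)
  show "(2 :: 'p padic) \<noteq> 0"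
    using padic_of_nat_nonzero[of 2, where 'p = 'p] by simp
  show "- of_nat CARD('p) \<noteq> (0 :: 'p padic)"
    using padic_of_nat_nonzero[of "CARD('p)", where 'p = 'p] p by simp
  show "- of_nat (least_nonsquare TYPE('p)) \<noteq> (0 :: 'p padic)"
    using padic_of_nat_nonzero[OF least_nonsquare_pos[OF p]] by simp
  show "reducible_to (- of_nat CARD('p)) (- of_nat (least_nonsquare TYPE('p))) v1 v2"
    if "v1 \<noteq> 0" "v2 \<noteq> 0" for v1 v2 :: "'p padic"
    using padic_odd_reducible[OF p that] .
  show "similarity_factor (- of_nat CARD('p)) (- of_nat (least_nonsquare TYPE('p))) n"
    if "n \<noteq> 0" for n :: "'p padic"
    using padic_odd_similarity[OF p that] .
  show "\<not> isotropic (- of_nat CARD('p)) (- of_nat (least_nonsquare TYPE('p)) :: 'p padic)"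
    by (rule padic_odd_anisotropic[OF p])
qed

theorem proposition4p4p10:
  shows
    "(CHAR('K::alg_closed_field) \<noteq> 2 \<longrightarrow>
        class_representatives {(1, 1, 1, 1) :: 'K \<times> 'K \<times> 'K \<times> 'K}) \<and>
     (CARD('p::prime_card) > 2 \<longrightarrow>
        class_representatives {(1, 1, 1, 1) :: 'p mod_ring \<times> 'p mod_ring \<times> 'p mod_ring \<times>
            'p mod_ring}) \<and>
     (class_representatives {(1, 1, -1, 1), (1, 1, 1, 1), (-1, 1, 1, 1) :: real \<times> real \<times> real
         \<times> real} \<and>
      (\<forall>\<tau> \<in> torus_params :: (real \<times> real \<times> real \<times> real) set.
        (fixed_split \<tau> \<longleftrightarrow> gt_isomorphic (1, 1, -1, 1) \<tau>) \<and>
        (fixed_division \<tau> \<and> Q_positive_definite (gt_fixed \<tau>) \<longleftrightarrow> gt_isomorphic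
            (1, 1, 1, 1) \<tau>) \<and>
        (fixed_division \<tau> \<and> Q_indefinite (gt_fixed \<tau>) \<longleftrightarrow> gt_isomorphic (-1,
            1, 1, 1) \<tau>))) \<and>
     (CARD('p) = 2 \<longrightarrow>
        class_representatives {(1, 1, -1, 1), (1, 1, 1, 1) :: 'p padic \<times> 'p padic \<times> 'p padic
            \<times> 'p padic} \<and>
        (\<forall>\<tau> \<in> torus_params :: ('p padic \<times> 'p padic \<times> 'p padic \<times> 'p padic)
            set.
          (fixed_split \<tau> \<longleftrightarrow> gt_isomorphic (1, 1, -1, 1) \<tau>) \<and>
          (fixed_division \<tau> \<longleftrightarrow> gt_isomorphic (1, 1, 1, 1) \<tau>))) \<and>
     (CARD('p) > 2 \<longrightarrow>
        (let d = (1, 1, - of_nat CARD('p), - of_nat (least_nonsquare TYPE('p))) in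
        class_representatives {(1, 1, -1, 1), d :: 'p padic \<times> 'p padic \<times> 'p padic \<times> 'p
            padic} \<and>
        (\<forall>\<tau> \<in> torus_params.
          (fixed_split \<tau> \<longleftrightarrow> gt_isomorphic (1, 1, -1, 1) \<tau>) \<and>
          (fixed_division \<tau> \<longleftrightarrow> gt_isomorphic d \<tau>))))"
proof -
  have closed: "CHAR('K) \<noteq> 2 \<longrightarrow> class_representatives {(1, 1, 1, 1) :: 'K \<times> 'K
      \<times> 'K \<times> 'K}"
  proof (intro impI class_representatives_of_universal two_nonzero_of_char)
    fix c n :: 'K
    obtain y where "n = y\<^sup>2" by (rule alg_closed_square_root)
    then show "\<exists>X Y. n = X\<^sup>2 + c * Y\<^sup>2" by (intro exI[of _ y] exI[of _ 0]) simp
  qed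
  have finite: "CARD('p) > 2 \<longrightarrow>
      class_representatives {(1, 1, 1, 1) :: 'p mod_ring \<times> 'p mod_ring \<times> 'p mod_ring \<times> 'p
          mod_ring}"
    by (intro impI class_representatives_of_universal mod_ring_two_nonzero finite_field_binary_universal)
  show ?thesis
    by (rule conjI[OF closed conjI[OF finite conjI[OF real_case conjI]]]; rule impI)
      (erule padic_two_case, erule padic_odd_case)
qed

end
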